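(* Let $(\mathcal Z,\Sigma,\mu)$ be a normalized measure space (i.e. $\mu$ is a probability measure), and let $d\ge 1$ be an integer. Let $S_m$ be any (training) dataset of size $m$, let $Z_{m'}=\{z^{(1)},\dots,z^{(m')}\}$ be any dataset of $m'\ge 1$ points of $\mathcal Z$ (the case $Z_{m'}=S_m$ being allowed), and let $L\hat y_{\mathcal A(S_m)}:\mathcal Z\to\mathbb R$ be any function (the loss of the learned model, which may depend on $S_m$ in an arbitrary way). Let $\mathcal F[L\hat y_{\mathcal A(S_m)}]$ be the set of all pairs $(\mathcal T,f)$ such that $\mathcal T:(\mathcal Z,\Sigma)\to([0,1]^d,\mathcal B([0,1]^d))$ is measurable, $f:([0,1]^d,\mathcal B([0,1]^d))\to(\mathbb R,\mathcal B(\mathbb R))$ is of bounded variation in the sense that $V[f]<\infty$, and $$L\hat y_{\mathcal A(S_m)}(z)=(f\circ\mathcal T)(z)\quad\text{for all } z\in\mathcal Z .$$ Then the following hold. (i) $$\mathbb E_\mu[L\hat y_{\mathcal A(S_m)}]\le \hat{\mathbb E}_{Z_{m'}}[L\hat y_{\mathcal A(S_m)}]+\inf_{(\mathcal T,f)\in\mathcal F[L\hat y_{\mathcal A(S_m)}]} V[f]\,D^*[\mathcal T_*\mu,\mathcal T(Z_{m'})].$$ (ii) For any $(\mathcal T,f)\in\mathcal F[L\hat y_{\mathcal A(S_m)}]$ such that $f$ is left-continuous component-wise (in each coordinate, at every point of $[0,1]^d$), $$\mathbb E_\mu[L\hat y_{\mathcal A(S_m)}]=\hat{\mathbb E}_{Z_{m'}}[L\hat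 y_{\mathcal A(S_m)}]+\int_{[0,1]^d}\left((\mathcal T_*\mu)([\mathbf 0,t])-\frac1{m'}\sum_{i=1}^{m'}\mathbf 1_{[\mathbf 0,t]}(\mathcal T(z^{(i)}))\right)d\nu_f(t),$$ where $\nu_f$ is a signed Borel measure on $[0,1]^d$ corresponding to $f$ in the sense that $f(t)=\nu_f([t,\mathbf 1])+f(\mathbf 1)$ for all $t\in[0,1]^d$ and $|\nu_f|([0,1]^d)=V[f]$ (such a $\nu_f$ exists).
   Context: Errors: $\mathbb E_\mu[g]=\int_{\mathcal Z} g\,d\mu$ (Lebesgue integral, assumed to be meaningful for $g=L\hat y_{\mathcal A(S_m)}$) and $\hat{\mathbb E}_{Z_{m'}}[g]=\frac1{m'}\sum_{i=1}^{m'}g(z^{(i)})$. Datasets are finite families of points (repetitions allowed). $\mathcal T_*\mu$ is the pushforward measure, $\mathcal T(Z_{m'})=\{\mathcal T(z^{(1)}),\dots,\mathcal T(z^{(m')})\}$ (with multiplicity), $\mathcal B(A)$ is the Borel $\sigma$-algebra on $A$. $\mathbf 0=(0,\dots,0)$, $\mathbf 1=(1,\dots,1)$; for $a,b\in[0,1]^d$, $[a,b]=\{t\in[0,1]^d:a\le t\le b\}$ with $\le$ the coordinatewise (product) order. $|\nu|(E)$ is the total variation of a signed measure $\nu$ on $E$. The infimum of the empty set is $+\infty$. Star-discrepancy: for a dataset $T_n=\{t^{(1)},\dots,t^{(n)}\}\subset[0,1]^d$ and a normalized Borel measure $\nu$ on $[0,1]^d$, $$D^*[\nu,T_n]=\sup_{t\in[0,1]^d}\left|\frac1n\sum_{i=1}^n\mathbf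 1_{[\mathbf 0,t]}(t^{(i)})-\nu([\mathbf 0,t])\right|.$$ Variation in the sense of Hardy and Krause: a partition $P$ of $[0,1]^k$ with size $m^P_1,\dots,m^P_k$ is a set of finite sequences $0=t_l^{(0)}\le t_l^{(1)}\le\dots\le t_l^{(m_l^P)}=1$, $l=1,\dots,k$. The difference operator $\Delta^P_l$ is $\Delta_l^P g(t_1,\dots,t_l^{(i)},\dots,t_k)=g(t_1,\dots,t_l^{(i+1)},\dots,t_k)-g(t_1,\dots,t_l^{(i)},\dots,t_k)$ for $i=0,\dots,m_l^P-1$, and $\Delta^P_{1,\dots,k}=\Delta^P_1\cdots\Delta^P_k$. For $f:[0,1]^d\to\mathbb R$ and $1\le j_1<\dots<j_k\le d$, $f_{j_1\dots j_k}$ is the function of $(t_{j_1},\dots,t_{j_k})\in[0,1]^k$ obtained from $f$ by fixing all other variables to be $1$. The Vitali variation is $$V^{(k)}[f_{j_1\dots j_k}]=\sup_{P}\sum_{i_1=1}^{m_1^P-1}\cdots\sum_{i_k=1}^{m_k^P-1}\left|\Delta^P_{1,\dots,k}f_{j_1\dots j_k}(t_{j_1}^{(i_1)},\dots,t_{j_k}^{(i_k)})\right|,$$ the supremum being over all partitions of $[0,1]^k$ (since repeated partition points are allowed, starting the sums at $0$ gives the same value). Finally $V[f]=\sum_{k=1}^d\sum_{1\le j_1<\dots<j_k\le d}V^{(k)}[f_{j_1\dots j_k}]$. *)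

theory Defs
  imports "HOL-Probability.Probability"
begin

section \<open>The unit cube\<close>

text \<open>
  The library order on \<^typ>\<open>real ^ 'd\<close> is the coordinatewise one, and \<open>0\<close>, \<open>1\<close> are the
  constant vectors, so \<open>{0..1}\<close> is the unit cube and \<open>{s..t}\<close> is a box. A function on the cube is
  a function on all of \<^typ>\<open>real ^ 'd\<close>; no definition below looks at its values outside the cube.
\<close>

abbreviation unit_cube :: "(real ^ 'd) set" where
  "unit_cube \<equiv> {0..1}"

abbreviation cube_borel :: "(real ^ 'd) measure" where
  "cube_borel \<equiv> restrict_space borel unit_cube"

definition left_continuous_componentwise :: "(real ^ 'd \<Rightarrow> real) \<Rightarrow> bool" where
  "left_continuous_componentwise f \<longleftrightarrow>
     (\<forall>t\<in>unit_cube. \<forall>l. ((\<lambda>s. f (\<chi> j. if j = l then s else t $ j)) \<longlongrightarrow> f t)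
                            (at (t $ l) within {0..<t $ l}))"


section \<open>Expectations\<close>

text \<open>
  The Lebesgue integral of a real function with values in the extended reals; it is meaningful
  if the function is measurable and its positive and negative parts do not both have infinite
  integral. (The library integral is restricted to integrable functions.)
\<close>

definition integral_meaningful :: "'z measure \<Rightarrow> ('z \<Rightarrow> real) \<Rightarrow> bool" where
  "integral_meaningful M g \<longleftrightarrow> g \<in> borel_measurable M \<and>
     ((\<integral>\<^sup>+ z. ennreal (g z) \<partial>M) < \<infinity> \<or> (\<integral>\<^sup>+ z. ennreal (- g z) \<partial>M) < \<infinity>)"

definition expected :: "'z measure \<Rightarrow> ('z \<Rightarrow> real) \<Rightarrow> ereal" where
  "expected M g =
     enn2ereal (\<integral>\<^sup>+ z. ennreal (g z) \<partial>M) - enn2ereal (\<integral>\<^sup>+ z. ennreal (- g z) \<partial>M)"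

lemma expected_eq_integral:
  assumes "integrable M g"
  shows "expected M g = ereal (integral\<^sup>L M g)"
proof -
  have *: "integral\<^sup>N M (\<lambda>z. ennreal (g z)) \<noteq> \<infinity>" "integral\<^sup>N M (\<lambda>z. ennreal (- g z)) \<noteq> \<infinity>"
    using assms by (auto simp: real_integrable_def)
  then show ?thesis
    unfolding expected_def real_lebesgue_integral_def[OF assms]
    by (cases "integral\<^sup>N M (\<lambda>z. ennreal (g z))"; cases "integral\<^sup>N M (\<lambda>z. ennreal (- g z))")
       (auto simp: enn2ereal_ennreal)
qed

text \<open>A dataset is a list of points; repetitions count.\<close>

definition empirical_mean :: "'z list \<Rightarrow> ('z \<Rightarrow> real) \<Rightarrow> real" where
  "empirical_mean zs g = (\<Sum>z\<leftarrow>zs. g z) / real (length zs)"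

definition star_discrepancy :: "(real ^ 'd) measure \<Rightarrow> (real ^ 'd) list \<Rightarrow> ereal" where
  "star_discrepancy N ts =
     (SUP t\<in>unit_cube. ereal \<bar>empirical_mean ts (indicat_real {0..t}) - measure N {0..t}\<bar>)"


section \<open>Variation in the sense of Hardy and Krause\<close>

text \<open>
  Difference operators act on functions of the grid index \<open>i\<close> (one natural number per
  coordinate), not on functions of the grid point, since partition points may be repeated.
  They commute, so that iterating them over a finite set of coordinates is well defined.
\<close>

definition diff_op :: "'d \<Rightarrow> (('d \<Rightarrow> nat) \<Rightarrow> real) \<Rightarrow> ('d \<Rightarrow> nat) \<Rightarrow> real" where
  "diff_op l G = (\<lambda>i. G (i(l := Suc (i l))) - G i)"

definition mixed_diff :: "'d set \<Rightarrow> (('d \<Rightarrow> nat) \<Rightarrow> real) \<Rightarrow> ('d \<Rightarrow> nat) \<Rightarrow> real" where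
  "mixed_diff J G = Finite_Set.fold diff_op G J"

lemma comp_fun_commute_diff_op: "comp_fun_commute diff_op"
proof
  fix k l :: 'd
  show "diff_op l \<circ> diff_op k = diff_op k \<circ> diff_op l"
    by (cases "k = l") (auto simp: diff_op_def fun_eq_iff fun_upd_twist)
qed

lemma mixed_diff_empty: "mixed_diff {} G = G"
  by (simp add: mixed_diff_def)

lemma mixed_diff_insert:
  assumes "finite J" "l \<notin> J"
  shows "mixed_diff (insert l J) G = diff_op l (mixed_diff J G)"
  unfolding mixed_diff_def
  using comp_fun_commute_on.fold_insert[OF comp_fun_commute_diff_op[unfolded comp_fun_commute_def'], of l J G] assms
  by simp

text \<open>
  A partition in the coordinates \<open>J\<close> is a pair \<open>(m, p)\<close>: for \<open>l \<in> J\<close> the sequence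
  \<open>0 = p l 0 \<le> \<dots> \<le> p l (m l) = 1\<close>.
\<close>

definition partitions :: "'d set \<Rightarrow> (('d \<Rightarrow> nat) \<times> ('d \<Rightarrow> nat \<Rightarrow> real)) set" where
  "partitions J = {(m, p). \<forall>l\<in>J. p l 0 = 0 \<and> p l (m l) = 1 \<and> (\<forall>i<m l. p l i \<le> p l (Suc i))}"

definition face :: "(real ^ 'd \<Rightarrow> real) \<Rightarrow> 'd set \<Rightarrow> ('d \<Rightarrow> real) \<Rightarrow> real" where
  "face f J s = f (\<chi> j. if j \<in> J then s j else 1)"

definition vitali_variation :: "(real ^ 'd \<Rightarrow> real) \<Rightarrow> 'd set \<Rightarrow> ereal" where
  "vitali_variation f J =
     (SUP (m, p)\<in>partitions J.
        ereal (\<Sum>i\<in>Pi\<^sub>E J (\<lambda>l. {1..<m l}).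
                 \<bar>mixed_diff J (\<lambda>i. face f J (\<lambda>l. p l (i l))) i\<bar>))"

text \<open>The index tuples \<open>j\<^sub>1 < \<dots> < j\<^sub>k\<close> with \<open>k \<ge> 1\<close> are the nonempty sets of coordinates.\<close>

definition hk_variation :: "(real ^ 'd \<Rightarrow> real) \<Rightarrow> ereal" where
  "hk_variation f = (\<Sum>J\<in>{J. J \<noteq> {}}. vitali_variation f J)"


section \<open>Signed measures\<close>

text \<open>
  Real-valued, i.e. finite, signed measures; every signed measure of finite total variation is
  of this kind.
\<close>

definition signed_measure :: "'a measure \<Rightarrow> ('a set \<Rightarrow> real) \<Rightarrow> bool" where
  "signed_measure M \<nu> \<longleftrightarrow> \<nu> {} = 0 \<and>
     (\<forall>A::nat \<Rightarrow> 'a set. range A \<subseteq> sets M \<longrightarrow> disjoint_family A \<longrightarrow>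
        (\<lambda>n. \<nu> (A n)) sums \<nu> (\<Union>n. A n))"

definition total_variation :: "'a measure \<Rightarrow> ('a set \<Rightarrow> real) \<Rightarrow> 'a set \<Rightarrow> ereal" where
  "total_variation M \<nu> E =
     (SUP P\<in>{P. finite P \<and> P \<subseteq> sets M \<and> disjoint P \<and> \<Union>P = E}. ereal (\<Sum>A\<in>P. \<bar>\<nu> A\<bar>))"

text \<open>
  The upper variation is the positive part of the Jordan decomposition, and the upper variation
  of \<open>- \<nu>\<close> is the negative part.
\<close>

definition upper_variation :: "'a measure \<Rightarrow> ('a set \<Rightarrow> real) \<Rightarrow> 'a measure" where
  "upper_variation M \<nu> =
     measure_of (space M) (sets M) (\<lambda>A. SUP B\<in>{B\<in>sets M. B \<subseteq> A}. ennreal (\<nu> B))"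

definition signed_integral :: "'a measure \<Rightarrow> ('a set \<Rightarrow> real) \<Rightarrow> ('a \<Rightarrow> real) \<Rightarrow> real" where
  "signed_integral M \<nu> h =
     (\<integral>t. h t \<partial>upper_variation M \<nu>) - (\<integral>t. h t \<partial>upper_variation M (\<lambda>A. - \<nu> A))"

definition corresponding_signed_measure :: "(real ^ 'd \<Rightarrow> real) \<Rightarrow> ((real ^ 'd) set \<Rightarrow> real) \<Rightarrow> bool" where
  "corresponding_signed_measure f \<nu> \<longleftrightarrow>
     signed_measure cube_borel \<nu> \<and>
     (\<forall>t\<in>unit_cube. f t = \<nu> {t..1} + f 1) \<and>
     total_variation cube_borel \<nu> unit_cube = hk_variation f"


section \<open>Representations of the loss\<close>

text \<open>The set of all \<open>(T, f)\<close> that factor \<open>g\<close> through the \<open>d\<close>-dimensional cube.\<close>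

definition representations ::
  "'z measure \<Rightarrow> ('z \<Rightarrow> real) \<Rightarrow> (('z \<Rightarrow> real ^ 'd) \<times> (real ^ 'd \<Rightarrow> real)) set" where
  "representations M g =
     {(T, f). T \<in> M \<rightarrow>\<^sub>M cube_borel \<and> f \<in> cube_borel \<rightarrow>\<^sub>M borel \<and> hk_variation f < \<infinity> \<and>
              (\<forall>z\<in>space M. g z = f (T z))}"

end

theory Submission
  imports Defs
begin

text \<open>
  On a finite product grid, Moebius inversion gives weights \<open>w\<close> with
  \<open>f x = f 1 + (\<Sum>y\<ge>x. w y)\<close> and \<open>(\<Sum>y. \<bar>w y\<bar>) \<le> V[f]\<close>. For discrete measures this summation by
  parts is the Koksma--Hlawka inequality. A general measure is reduced to a discrete one by moving
  each point to a point of its grid cell at which \<open>f\<close> is almost maximal; no continuity of \<open>f\<close> is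
  needed, and the discrepancy changes little if the gaps of the grid have small marginal mass.

  For left-continuous \<open>f\<close> the weights on successive dyadic grids are compatible, and so are their
  positive and negative parts after passing to the limit of refinements. A compatible family of
  nonnegative weights is, up to scaling, a projective family of distributions; Kolmogorov's theorem
  yields a random sequence of nested cells, and the law of its limit point is a measure on the cube.
  The difference of the two measures is \<open>\<nu>\<^sub>f\<close>. The integral identity is Fubini's theorem applied to
  the indicator function of \<open>t \<le> s\<close>.
\<close>

subsection \<open>Summation by parts on finite grids\<close>

text \<open>A grid point belongs to exactly one face, the one given by the set J of coordinates in
  which it lies below 1. For this reason the Vitali sums of all faces merge into a single family of
  weights, and V[f], as the sum over J, is the right bound for their absolute sum. In (ii) the
  obstacle is the boundary of the cells. Dyadic cells are half-open, but a nested sequence of them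
  may converge to a point on an upper side, which belongs to another cell. So the mass of [t,1] is
  not the limit of the weights above t; it is the limit of the weights above t - 2^-n. Their sum is
  a value of f at a dyadic point strictly to the left of t in every nonzero coordinate, and this is
  where left-continuity enters. The construction bounds the total variation of the signed measure by
  V[f] only from above. The reverse inequality reads each Vitali sum as a sum of measures of
  disjoint half-open boxes, and boxes from different faces are disjoint as well.\<close>

text \<open>Differences in the coordinates J leave all others untouched, so only the slice through
  \<open>i\<close> along J matters. Thus the function on the full grid can be exchanged for
  \<open>face\<close>, whose index tuples carry no information outside J.\<close>

lemma mixed_diff_cong:
  assumes "finite J" and "\<And>a. G (override_on i a J) = G' (override_on i' a J)"
    and "\<And>l. l \<in> J \<Longrightarrow> i l = i' l"
  shows "mixed_diff J G i = mixed_diff J G' i'"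
  using assms
proof (induction J arbitrary: i i' rule: finite_induct)
  case empty
  then show ?case by (simp add: mixed_diff_empty)
next
  case (insert l J)
  have "mixed_diff J G (i(l := c)) = mixed_diff J G' (i'(l := c))" for c
  proof (rule insert.IH)
    fix a
    have "override_on (k(l := c)) a J = override_on k (a(l := c)) (insert l J)" for k :: "_ \<Rightarrow> nat"
      using insert.hyps by (auto simp: override_on_def)
    then show "G (override_on (i(l := c)) a J) = G' (override_on (i'(l := c)) a J)"
      using insert.prems(1)[of "a(l := c)"] by (simp del: fun_upd_apply)
  qed (use insert.prems in auto)
  from this[of "Suc (i l)"] this[of "i l"] show ?case
    using insert.hyps insert.prems(2)[of l] by (simp add: mixed_diff_insert diff_op_def) (metis fun_upd_triv)
qed

lemma mixed_diff_minus_const: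
  assumes "finite J" "J \<noteq> {}"
  shows "mixed_diff J (\<lambda>i. G i - c) = mixed_diff J G"
  using assms
proof (induction J rule: finite_ne_induct)
  case (singleton l)
  then show ?case
    using mixed_diff_insert[of "{}" l]
    by (simp add: mixed_diff_empty diff_op_def fun_eq_iff)
next
  case (insert l J)
  then show ?case by (simp add: mixed_diff_insert)
qed

text \<open>The term at \<open>a = m\<close> is the boundary value that the telescoping differences
  leave over.\<close>

lemma telescope_diff_op:
  assumes "i k \<le> m"
  shows "(\<Sum>a = i k..m. if a < m then - diff_op k H (i(k := a)) else H (i(k := a))) = H i"
proof -
  have "(\<Sum>a = b..m. if a < m then - diff_op k H (i(k := a)) else H (i(k := a))) = H (i(k := b))"
    if "b \<le> m" for b
    using that
  proof (induction b rule: inc_induct)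
    case base
    then show ?case by (simp del: fun_upd_apply)
  next
    case (step b)
    then show ?case by (simp add: sum.atLeast_Suc_atMost diff_op_def del: fun_upd_apply) simp
  qed
  from this[OF assms] show ?thesis by simp
qed

text \<open>\<open>telescope_diff_op\<close> is applied in one coordinate after the other. The
  summand at \<open>j\<close> carries a difference in the coordinates with \<open>j l < m l\<close>
  and a boundary value in the others; the sign counts the forward differences, each of which enters
  negatively.\<close>

lemma abel_summation:
  fixes G :: "('d \<Rightarrow> nat) \<Rightarrow> real"
  assumes "finite K" "\<And>l. l \<in> K \<Longrightarrow> i l \<le> m l"
  shows "G i = (\<Sum>j\<in>Pi\<^sub>E K (\<lambda>l. {i l..m l}).
           (-1) ^ card {l\<in>K. j l < m l} * mixed_diff {l\<in>K. j l < m l} G (override_on i j K))"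
  using assms
proof (induction K rule: finite_induct)
  case empty
  then show ?case by (simp add: mixed_diff_empty)
next
  case (insert k K)
  define J where "J j = {l\<in>K. j l < m l}" for j
  let ?term = "\<lambda>j. (-1) ^ card {l\<in>insert k K. j l < m l} *
      mixed_diff {l\<in>insert k K. j l < m l} G (override_on i j (insert k K))"
  have inner: "(\<Sum>a = i k..m k. ?term (j(k := a))) = (-1) ^ card (J j) * mixed_diff (J j) G (override_on i j K)"
    for j
  proof -
    let ?x = "override_on i j K"
    have xk: "?x k = i k" using insert.hyps by (simp add: override_on_def)
    have fin: "finite (J j)" "k \<notin> J j" using insert.hyps by (auto simp: J_def)
    have "?term (j(k := a)) = (-1) ^ card (J j) *
        (if a < m k then - diff_op k (mixed_diff (J j) G) (?x(k := a)) else mixed_diff (J j) G (?x(k := a)))" for a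
    proof -
      have set: "{l\<in>insert k K. (j(k := a)) l < m l} = (if a < m k then insert k (J j) else J j)"
        using insert.hyps by (auto simp: J_def)
      have ov: "override_on i (j(k := a)) (insert k K) = ?x(k := a)"
        using insert.hyps by (auto simp: override_on_def)
      show ?thesis unfolding set ov using fin by (simp add: mixed_diff_insert)
    qed
    then have "(\<Sum>a = i k..m k. ?term (j(k := a))) = (-1) ^ card (J j) *
        (\<Sum>a = ?x k..m k. if a < m k then - diff_op k (mixed_diff (J j) G) (?x(k := a)) else mixed_diff (J j) G (?x(k := a)))"
      by (simp add: sum_distrib_left xk del: fun_upd_apply)
    also have "\<dots> = (-1) ^ card (J j) * mixed_diff (J j) G ?x"
      by (subst telescope_diff_op) (use xk insert.prems in auto)
    finally show ?thesis .
  qed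
  have "sum ?term (Pi\<^sub>E (insert k K) (\<lambda>l. {i l..m l})) =
      (\<Sum>j\<in>Pi\<^sub>E K (\<lambda>l. {i l..m l}). \<Sum>a = i k..m k. ?term (j(k := a)))"
    unfolding PiE_insert_eq
    by (subst sum.reindex, rule inj_combinator[OF insert.hyps(2)], subst sum.swap)
       (simp add: sum.cartesian_product case_prod_unfold)
  also have "\<dots> = G i"
    unfolding inner using insert.IH insert.prems by (simp add: J_def)
  finally show ?case by simp
qed


section \<open>Grids in the cube and their Moebius weights\<close>

definition grid :: "('d \<Rightarrow> real set) \<Rightarrow> (real ^ 'd) set" where
  "grid G = {x. \<forall>l. x $ l \<in> G l}"

text \<open>Index 0 is padding. A partition has to start at 0, which may or may not lie in
  \<open>A\<close>. Since Vitali sums begin at index 1, the interval from \<open>p 0\<close> to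
  \<open>p 1\<close> contributes nothing, and \<open>A\<close> occupies the indices from 1
  on.\<close>

lemma sorted_enumeration:
  fixes A :: "real set"
  assumes "finite A" "A \<noteq> {}" "A \<subseteq> {0..1}" "1 \<in> A"
  obtains p where "p 0 = 0" "bij_betw p {1..card A} A" "strict_mono_on {1..card A} p" "p (card A) = 1"
proof -
  define xs where "xs = sorted_list_of_set A"
  define p where "p i = (if i = 0 then 0 else xs ! (i - 1))" for i :: nat
  have xs: "set xs = A" "length xs = card A" "sorted_wrt (<) xs"
    using assms by (auto simp: xs_def)
  have pos: "card A > 0" using assms by (auto simp: card_gt_0_iff)
  have mono: "strict_mono_on {1..card A} p"
    unfolding strict_mono_on_def p_def using sorted_wrt_nth_less[OF xs(3)] xs(2) by auto
  have surj: "p ` {1..card A} = A"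
  proof
    show "p ` {1..card A} \<subseteq> A" using xs by (auto simp: p_def)
    show "A \<subseteq> p ` {1..card A}"
    proof
      fix a assume "a \<in> A"
      then obtain k where "k < card A" "xs ! k = a" using xs by (metis in_set_conv_nth)
      then show "a \<in> p ` {1..card A}" by (intro image_eqI[of _ _ "Suc k"]) (auto simp: p_def)
    qed
  qed
  have "bij_betw p {1..card A} A"
    using surj mono by (auto simp: bij_betw_def intro: strict_mono_on_imp_inj_on)
  moreover have "p (card A) = 1"
  proof (rule antisym)
    show "p (card A) \<le> 1" using surj pos assms(3) by force
    obtain k where k: "k \<in> {1..card A}" "p k = 1" using surj assms(4) by (metis imageE)
    have "p k \<le> p (card A)"
      using strict_mono_on_leD[OF mono k(1), of "card A"] k(1) by simp
    with k show "1 \<le> p (card A)" by simp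
  qed
  ultimately show ?thesis using that[of p] mono by (simp add: p_def)
qed

text \<open>The weights are the summands of \<open>abel_summation\<close> except for the top corner,
  whose value becomes the constant f 1. The points whose coordinates below 1 are exactly those in L
  contribute one Vitali sum of the face L, and one partition serves all faces; this bounds the
  absolute sum.\<close>

lemma grid_moebius:
  fixes f :: "real ^ 'd \<Rightarrow> real" and G :: "'d \<Rightarrow> real set"
  assumes G: "\<And>l. finite (G l)" "\<And>l. G l \<subseteq> {0..1}" "\<And>l. 1 \<in> G l"
  obtains w where "\<And>x. x \<in> grid G \<Longrightarrow> f x = f 1 + (\<Sum>y\<in>{y\<in>grid G. x \<le> y}. w y)"
    and "ereal (\<Sum>y\<in>grid G. \<bar>w y\<bar>) \<le> hk_variation f"
proof -
  define m where "m l = card (G l)" for l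
  have "\<exists>p. p 0 = 0 \<and> bij_betw p {1..m l} (G l) \<and> strict_mono_on {1..m l} p \<and> p (m l) = 1" for l
    using sorted_enumeration[of "G l"] G[of l] unfolding m_def by (metis empty_iff)
  then obtain p where p0: "\<And>l. p l 0 = 0" and p1: "\<And>l. p l (m l) = 1"
    and bij: "\<And>l. bij_betw (p l) {1..m l} (G l)" and mono: "\<And>l. strict_mono_on {1..m l} (p l)"
    by metis
  have m1: "m l \<ge> 1" for l using G[of l] by (auto simp: m_def Suc_le_eq card_gt_0_iff)
  define pt where "pt j = (\<chi> l. p l (j l))" for j :: "'d \<Rightarrow> nat"
  define I where "I = Pi\<^sub>E (UNIV :: 'd set) (\<lambda>l. {1..m l})"
  define F where "F j = f (pt j)" for j
  define J where "J j = {l. j l < m l}" for j :: "'d \<Rightarrow> nat"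
  \<comment> \<open>Among the indices in \<open>I\<close>, only \<open>m\<close> has
    \<open>J j = {}\<close>; its summand is split off as f 1.\<close>
  define v where "v j = (if J j = {} then 0 else (-1) ^ card (J j) * mixed_diff (J j) F j)" for j
  define w where "w y = v (inv_into I pt y)" for y
  have finI: "finite I" unfolding I_def by (intro finite_PiE) auto
  have inj: "inj_on pt I"
  proof (rule inj_onI)
    fix i j assume "i \<in> I" "j \<in> I" "pt i = pt j"
    then have "p l (i l) = p l (j l)" "i l \<in> {1..m l}" "j l \<in> {1..m l}" for l
      by (auto simp: pt_def I_def vec_eq_iff)
    then show "i = j" using bij unfolding bij_betw_def inj_on_def by blast
  qed
  have img: "pt ` I = grid G"
  proof
    show "pt ` I \<subseteq> grid G"
      using bij unfolding grid_def pt_def I_def bij_betw_def by fastforce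
    show "grid G \<subseteq> pt ` I"
    proof
      fix x assume x: "x \<in> grid G"
      have "\<exists>k. k \<in> {1..m l} \<and> p l k = x $ l" for l
      proof -
        have "x $ l \<in> p l ` {1..m l}" using x bij[of l] by (simp add: grid_def bij_betw_def)
        then show ?thesis by force
      qed
      then obtain j where "\<And>l. j l \<in> {1..m l}" "\<And>l. p l (j l) = x $ l" by metis
      then show "x \<in> pt ` I" by (intro image_eqI[of _ _ j]) (auto simp: pt_def I_def vec_eq_iff)
    qed
  qed
  have w_pt: "w (pt j) = v j" if "j \<in> I" for j
    using that inj by (simp add: w_def)
  have le_iff: "pt i \<le> pt j \<longleftrightarrow> (\<forall>l. i l \<le> j l)" if "i \<in> I" "j \<in> I" for i j
    using that strict_mono_on_less_eq[OF mono] by (auto simp: pt_def less_eq_vec_def I_def PiE_iff)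
  have I_less: "j l < m l \<longleftrightarrow> j l \<noteq> m l" if "j \<in> I" for j l
    using that by (auto simp: I_def PiE_iff intro!: le_neq_implies_less)
  have pt_m: "pt m = 1" using p1 by (simp add: pt_def vec_eq_iff)
  show ?thesis
  proof
    fix x assume "x \<in> grid G"
    then obtain i where i: "i \<in> I" "x = pt i" using img by blast
    then have im: "i l \<le> m l" "i l \<ge> 1" for l by (auto simp: I_def PiE_iff)
    define K where "K = Pi\<^sub>E (UNIV :: 'd set) (\<lambda>l. {i l..m l})"
    have K: "finite K" "m \<in> K" using im unfolding K_def by (auto intro!: finite_PiE)
    have KI: "K = {j\<in>I. pt i \<le> pt j}"
      using im le_iff[OF i(1)]
      by (auto simp: K_def I_def PiE_iff) (meson order_trans)+
    have "{y\<in>grid G. x \<le> y} = pt ` K" unfolding KI i(2) img[symmetric] by auto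
    moreover have "inj_on pt K" using inj by (rule inj_on_subset) (auto simp: KI)
    ultimately have "(\<Sum>y\<in>{y\<in>grid G. x \<le> y}. w y) = (\<Sum>j\<in>K. w (pt j))"
      by (simp add: sum.reindex)
    also have "\<dots> = (\<Sum>j\<in>K. v j)" by (intro sum.cong) (auto simp: KI w_pt)
    finally have 1: "(\<Sum>y\<in>{y\<in>grid G. x \<le> y}. w y) = (\<Sum>j\<in>K. v j)" .
    have Jm: "J j = {} \<longleftrightarrow> j = m" if "j \<in> K" for j
      using that by (auto simp: J_def KI I_less fun_eq_iff)
    have Jmm: "J m = {}" by (simp add: J_def)
    have "F i = (\<Sum>j\<in>K. (-1) ^ card (J j) * mixed_diff (J j) F j)"
      using abel_summation[of UNIV i m F] im by (simp add: K_def J_def override_on_def)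
    also have "\<dots> = (\<Sum>j\<in>K. v j + (if j = m then f 1 else 0))"
      by (intro sum.cong refl) (auto simp: v_def Jm Jmm mixed_diff_empty F_def pt_m)
    also have "\<dots> = (\<Sum>j\<in>K. v j) + f 1"
      using K by (simp add: sum.distrib)
    finally show "f x = f 1 + (\<Sum>y\<in>{y\<in>grid G. x \<le> y}. w y)"
      using 1 by (simp add: F_def i)
  next
    define s where "s L = (\<Sum>i\<in>Pi\<^sub>E L (\<lambda>l. {1..<m l}). \<bar>mixed_diff L (\<lambda>i. face f L (\<lambda>l. p l (i l))) i\<bar>)" for L
    have "(\<Sum>y\<in>grid G. \<bar>w y\<bar>) = (\<Sum>j\<in>I. \<bar>v j\<bar>)"
      unfolding img[symmetric] using inj by (simp add: sum.reindex w_pt)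
    \<comment> \<open>Every index is sorted into the face on which it lies; the class L = {} drops
      out because \<open>v\<close> vanishes there.\<close>
    also have "\<dots> = (\<Sum>L\<in>UNIV. \<Sum>j\<in>{j\<in>I. J j = L}. \<bar>v j\<bar>)"
      using finI by (intro sum.group[symmetric]) auto
    also have "\<dots> = (\<Sum>L\<in>{L. L \<noteq> {}}. \<Sum>j\<in>{j\<in>I. J j = L}. \<bar>v j\<bar>)"
      by (intro sum.mono_neutral_right) (auto simp: v_def)
    also have "\<dots> = (\<Sum>L\<in>{L. L \<noteq> {}}. s L)"
    proof (rule sum.cong)
      fix L :: "'d set" assume L: "L \<in> {L. L \<noteq> {}}"
      have mixed: "mixed_diff L F j = mixed_diff L (\<lambda>i. face f L (\<lambda>l. p l (i l))) (restrict j L)"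
        if "j \<in> I" "J j = L" for j
      proof (rule mixed_diff_cong)
        fix a
        have "j l = m l" if "l \<notin> L" for l
          using \<open>j \<in> I\<close> \<open>J j = L\<close> that by (auto simp: J_def I_less)
        then have "pt (override_on j a L) = (\<chi> l. if l \<in> L then p l (override_on (restrict j L) a L l) else 1)"
          by (auto simp: pt_def vec_eq_iff override_on_def p1)
        then show "F (override_on j a L) = face f L (\<lambda>l. p l (override_on (restrict j L) a L l))"
          by (simp add: F_def face_def)
      qed auto
      show "(\<Sum>j\<in>{j\<in>I. J j = L}. \<bar>v j\<bar>) = s L"
        unfolding s_def
      \<comment> \<open>Outside L all indices of this group sit at their maximum \<open>m l\<close>,
        so the inverse map can fill them in.\<close>
      proof (rule sum.reindex_bij_witness[where j = "\<lambda>j. restrict j L" and i = "\<lambda>i l. if l \<in> L then i l else m l"])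
        fix j assume j: "j \<in> {j\<in>I. J j = L}"
        show "restrict j L \<in> Pi\<^sub>E L (\<lambda>l. {1..<m l})" using j by (auto simp: I_def J_def PiE_iff)
        show "(\<lambda>l. if l \<in> L then restrict j L l else m l) = j"
          using j by (auto simp: J_def I_less fun_eq_iff)
        show "\<bar>mixed_diff L (\<lambda>i. face f L (\<lambda>l. p l (i l))) (restrict j L)\<bar> = \<bar>v j\<bar>"
          using j L mixed[of j] by (simp add: v_def abs_mult power_abs)
      next
        fix i assume i: "i \<in> Pi\<^sub>E L (\<lambda>l. {1..<m l})"
        show "restrict (\<lambda>l. if l \<in> L then i l else m l) L = i"
          using i by (auto simp: PiE_iff fun_eq_iff extensional_def)
        show "(\<lambda>l. if l \<in> L then i l else m l) \<in> {j\<in>I. J j = L}"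
          using i m1 by (fastforce simp: I_def J_def PiE_iff)
      qed
    qed simp
    finally have "ereal (\<Sum>y\<in>grid G. \<bar>w y\<bar>) = (\<Sum>L\<in>{L. L \<noteq> {}}. ereal (s L))" by simp
    also have "\<dots> \<le> hk_variation f"
      unfolding hk_variation_def
    proof (rule sum_mono)
      fix L :: "'d set"
      \<comment> \<open>The padded step from 0 may be an equality, which partitions permit.\<close>
      have "p l i \<le> p l (Suc i)" if "i < m l" for l i
      proof (cases "i = 0")
        case True
        have "p l 1 \<in> G l" using bij[of l] m1[of l] unfolding bij_betw_def by force
        then show ?thesis using True G(2)[of l] p0 by auto
      next
        case False
        then show ?thesis using that mono[of l] by (auto simp: strict_mono_on_def less_imp_le)
      qed
      then have "(m, p) \<in> partitions L" by (simp add: partitions_def p0 p1)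
      then show "ereal (s L) \<le> vitali_variation f L"
        unfolding vitali_variation_def s_def by (rule SUP_upper2) simp
    qed
    finally show "ereal (\<Sum>y\<in>grid G. \<bar>w y\<bar>) \<le> hk_variation f" .
  qed
qed

text \<open>The one-point grid at 1 already bounds the variation from below by a sum of absolute
  values.\<close>

lemma hk_variation_nonneg: "0 \<le> hk_variation (f :: real ^ 'a \<Rightarrow> real)"
proof (rule grid_moebius[where G = "\<lambda>l. {1}" and f = f])
  fix w :: "real ^ 'a \<Rightarrow> real"
  assume "ereal (\<Sum>y\<in>grid (\<lambda>l. {1}). \<bar>w y\<bar>) \<le> hk_variation f"
  moreover have "(0 :: ereal) \<le> ereal (\<Sum>y\<in>grid (\<lambda>l. {1}). \<bar>w y\<bar>)"
    by (simp add: sum_nonneg)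
  ultimately show ?thesis by (rule order_trans[rotated])
qed auto

lemma hk_variation_real:
  assumes "hk_variation f < \<infinity>"
  obtains V where "hk_variation f = ereal V" "0 \<le> V"
proof (cases "hk_variation f")
  case (real V)
  then show ?thesis using that[of V] hk_variation_nonneg[of f] by simp
qed (use assms hk_variation_nonneg[of f] in simp_all)

lemma finite_grid:
  assumes "\<And>l. finite (G l)"
  shows "finite (grid (G :: 'd::finite \<Rightarrow> real set))"
proof (rule finite_subset)
  show "grid G \<subseteq> (\<lambda>j. \<chi> l. j l) ` Pi\<^sub>E UNIV G"
  proof
    fix x assume "x \<in> grid G"
    then show "x \<in> (\<lambda>j. \<chi> l. j l) ` Pi\<^sub>E UNIV G"
      by (intro image_eqI[of _ _ "\<lambda>l. x $ l"]) (auto simp: grid_def vec_eq_iff)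
  qed
  show "finite ((\<lambda>j. \<chi> l. j l) ` Pi\<^sub>E UNIV G)"
    using assms by (intro finite_imageI finite_PiE) auto
qed

text \<open>The smallest grid through \<open>x\<close> and the corner 1 expresses f x - f 1 as a sum
  of weights.\<close>

lemma hk_variation_bound:
  assumes "x \<in> unit_cube" "hk_variation f = ereal V"
  shows "\<bar>f x - f 1\<bar> \<le> V"
proof -
  define G where "G l = {x $ l, 1}" for l
  have G: "finite (G l)" "G l \<subseteq> {0..1}" "1 \<in> G l" for l
    using assms(1) by (auto simp: G_def less_eq_vec_def)
  obtain w where w: "\<And>x. x \<in> grid G \<Longrightarrow> f x = f 1 + (\<Sum>y\<in>{y\<in>grid G. x \<le> y}. w y)"
    "ereal (\<Sum>y\<in>grid G. \<bar>w y\<bar>) \<le> hk_variation f"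
    using grid_moebius[where f = f and G = G] G by metis
  have "x \<in> grid G" by (simp add: grid_def G_def)
  then have "\<bar>f x - f 1\<bar> = \<bar>\<Sum>y\<in>{y\<in>grid G. x \<le> y}. w y\<bar>" using w(1) by simp
  also have "\<dots> \<le> (\<Sum>y\<in>{y\<in>grid G. x \<le> y}. \<bar>w y\<bar>)" by (rule sum_abs)
  also have "\<dots> \<le> (\<Sum>y\<in>grid G. \<bar>w y\<bar>)" by (rule sum_mono2) (use finite_grid[of G] G in auto)
  also have "\<dots> \<le> V" using w(2) assms(2) by simp
  finally show ?thesis .
qed

subsection \<open>Quantization and the Koksma--Hlawka inequality\<close>

text \<open>The classes are the single points of G and the open intervals between them, so a point
  of G is never merged with its neighbours.\<close>

definition same_gap :: "real set \<Rightarrow> real \<Rightarrow> real \<Rightarrow> bool" where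
  "same_gap G a b \<longleftrightarrow> (\<forall>g\<in>G. (g \<le> a \<longleftrightarrow> g \<le> b) \<and> (g < a \<longleftrightarrow> g < b))"

lemma same_gap_refl: "same_gap G a a"
  and same_gap_sym: "same_gap G a b \<Longrightarrow> same_gap G b a"
  and same_gap_trans: "same_gap G a b \<Longrightarrow> same_gap G b c \<Longrightarrow> same_gap G a c"
  by (auto simp: same_gap_def)

lemma same_gap_between:
  assumes "same_gap G a b" "a \<le> t" "t < b"
  shows "t \<notin> G" "same_gap G a t" "same_gap G b t"
  using assms unfolding same_gap_def by force+

text \<open>A heavy atom stays heavy under refinement, so it has to be a point of G. Around every
  point a punctured neighbourhood has small mass by continuity from above, and compactness leaves
  finitely many of these neighbourhoods.\<close>

lemma (in finite_measure) small_gaps: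
  assumes [measurable]: "X \<in> borel_measurable M" and "0 < e"
  obtains G where "finite G"
    "\<And>t. t \<in> {0..1} \<Longrightarrow> t \<notin> G \<Longrightarrow> measure M {x\<in>space M. same_gap G (X x) t} \<le> e"
proof -
  have "\<exists>d>0. measure M {x\<in>space M. X x \<noteq> a \<and> \<bar>X x - a\<bar> < d} < e" for a
  proof -
    define A where "A n = {x\<in>space M. X x \<noteq> a \<and> \<bar>X x - a\<bar> < inverse (real (Suc n))}" for n
    have "range A \<subseteq> sets M" unfolding A_def by auto
    moreover have "decseq A"
    proof (rule decseq_SucI)
      fix n
      have "inverse (real (Suc (Suc n))) \<le> inverse (real (Suc n))" by (simp add: field_simps)
      then show "A (Suc n) \<subseteq> A n" unfolding A_def by (force intro: less_le_trans)
    qed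
    ultimately have "(\<lambda>n. measure M (A n)) \<longlonglongrightarrow> measure M (\<Inter>n. A n)"
      by (intro finite_Lim_measure_decseq)
    moreover have "(\<Inter>n. A n) = {}"
    proof (rule ccontr)
      assume "(\<Inter>n. A n) \<noteq> {}"
      then obtain x where x: "\<And>n. x \<in> A n" by auto
      then have "0 < \<bar>X x - a\<bar>" by (auto simp: A_def)
      then obtain n where "inverse (real (Suc n)) < \<bar>X x - a\<bar>" using reals_Archimedean by blast
      with x[of n] show False by (simp add: A_def)
    qed
    ultimately have "(\<lambda>n. measure M (A n)) \<longlonglongrightarrow> 0" by simp
    then have "\<forall>\<^sub>F n in sequentially. measure M (A n) < e" using \<open>0 < e\<close> by (rule order_tendstoD)
    then obtain n where "measure M (A n) < e" by (auto simp: eventually_sequentially)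
    then show ?thesis unfolding A_def by (intro exI[of _ "inverse (real (Suc n))"]) simp
  qed
  then have "\<forall>a. \<exists>d. d > 0 \<and> measure M {x\<in>space M. X x \<noteq> a \<and> \<bar>X x - a\<bar> < d} < e" by blast
  from choice[OF this] obtain d where d: "\<And>a. d a > 0"
    "\<And>a. measure M {x\<in>space M. X x \<noteq> a \<and> \<bar>X x - a\<bar> < d a} < e" by auto
  obtain C where C: "C \<subseteq> {0..1}" "finite C" "{0..1} \<subseteq> (\<Union>c\<in>C. ball c (d c))"
    by (rule compactE_image[of "{0..1::real}" "{0..1}" "\<lambda>c. ball c (d c)"]) (use d in \<open>force+\<close>)
  \<comment> \<open>The centre keeps a gap away from the puncture; the two ends keep it inside the
    ball.\<close>
  define G where "G = (\<Union>c\<in>C. {c, c - d c, c + d c})"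
  show ?thesis
  proof (rule that[of G])
    show "finite G" using C by (simp add: G_def)
    fix t :: real assume t: "t \<in> {0..1}" "t \<notin> G"
    then obtain c where c: "c \<in> C" "t \<in> ball c (d c)" using C by blast
    have "{c, c - d c, c + d c} \<subseteq> G" using c by (auto simp: G_def)
    have "{x\<in>space M. same_gap G (X x) t} \<subseteq> {x\<in>space M. X x \<noteq> c \<and> \<bar>X x - c\<bar> < d c}"
    proof
      fix x assume x: "x \<in> {x\<in>space M. same_gap G (X x) t}"
      then have "c \<le> X x \<longleftrightarrow> c \<le> t" "c < X x \<longleftrightarrow> c < t" "c - d c < X x \<longleftrightarrow> c - d c < t"
        "c + d c \<le> X x \<longleftrightarrow> c + d c \<le> t"
        using \<open>{c, c - d c, c + d c} \<subseteq> G\<close> unfolding same_gap_def by blast+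
      moreover have "c \<noteq> t" using t \<open>{c, c - d c, c + d c} \<subseteq> G\<close> by blast
      moreover have "\<bar>c - t\<bar> < d c" using c(2) by (simp add: dist_real_def)
      ultimately have "X x \<noteq> c \<and> \<bar>X x - c\<bar> < d c" by argo
      with x show "x \<in> {x\<in>space M. X x \<noteq> c \<and> \<bar>X x - c\<bar> < d c}" by simp
    qed
    then have "measure M {x\<in>space M. same_gap G (X x) t}
        \<le> measure M {x\<in>space M. X x \<noteq> c \<and> \<bar>X x - c\<bar> < d c}"
      by (rule finite_measure_mono) measurable
    with d(2)[of c] show "measure M {x\<in>space M. same_gap G (X x) t} \<le> e" by simp
  qed
qed

lemma measurable_nth_cube [measurable]: "(\<lambda>x. x $ l) \<in> borel_measurable cube_borel"
  by (intro measurable_restrict_space1) simp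

lemma box_sets_cube: "a \<in> unit_cube \<Longrightarrow> b \<in> unit_cube \<Longrightarrow> {a..b} \<in> sets cube_borel"
  by (subst sets_restrict_space_iff) (auto intro: order_trans)

lemma empirical_mean_add:
  "empirical_mean zs (\<lambda>z. g z + h z) = empirical_mean zs g + empirical_mean zs h"
  by (simp add: empirical_mean_def sum_list_addf add_divide_distrib)

lemma empirical_mean_mult:
  "empirical_mean zs (\<lambda>z. c * g z) = c * empirical_mean zs g"
  by (simp add: empirical_mean_def sum_list_const_mult)

lemma empirical_mean_sum:
  "empirical_mean zs (\<lambda>z. \<Sum>i\<in>I. k i z) = (\<Sum>i\<in>I. empirical_mean zs (k i))"
  unfolding empirical_mean_def sum_divide_distrib[symmetric] sum_list_sum_nth
  by (simp add: sum.swap[of _ _ I])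

lemma empirical_mean_const: "zs \<noteq> [] \<Longrightarrow> empirical_mean zs (\<lambda>z. c) = c"
  by (simp add: empirical_mean_def sum_list_triv)

lemma empirical_mean_cong:
  "(\<And>z. z \<in> set zs \<Longrightarrow> g z = h z) \<Longrightarrow> empirical_mean zs g = empirical_mean zs h"
  unfolding empirical_mean_def by (metis map_cong)

lemma near_sup_representatives:
  fixes f :: "'a \<Rightarrow> real"
  assumes E: "\<And>x. E x x" "\<And>x y. E x y \<Longrightarrow> E y x" "\<And>x y z. E x y \<Longrightarrow> E y z \<Longrightarrow> E x z"
    and "bdd_above (f ` S)" "0 < e"
  obtains r where "\<And>x. x \<in> S \<Longrightarrow> r x \<in> S" "\<And>x. x \<in> S \<Longrightarrow> E x (r x)"
    "\<And>x. x \<in> S \<Longrightarrow> f x \<le> f (r x) + e" "\<And>x y. x \<in> S \<Longrightarrow> E x y \<Longrightarrow> r x = r y"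
proof -
  define P where "P x y \<longleftrightarrow> y \<in> S \<and> E x y \<and> (\<forall>z\<in>S. E x z \<longrightarrow> f z \<le> f y + e)" for x y
  define r where "r x = (SOME y. P x y)" for x
  have "\<exists>y. P x y" if "x \<in> S" for x
  proof -
    let ?A = "f ` {z\<in>S. E x z}"
    have ne: "?A \<noteq> {}" using that E(1) by auto
    have bdd: "bdd_above ?A" using assms(4) by (rule bdd_above_mono) auto
    obtain y where y: "y \<in> S" "E x y" "Sup ?A - e < f y"
      using less_cSupD[OF ne, of "Sup ?A - e"] \<open>0 < e\<close> by auto
    have "f z \<le> f y + e" if "z \<in> S" "E x z" for z
    proof -
      have "f z \<le> Sup ?A" using that by (intro cSup_upper bdd) auto
      with y show ?thesis by simp
    qed
    with y show ?thesis by (auto simp: P_def)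
  qed
  then have P: "P x (r x)" if "x \<in> S" for x
    using that unfolding r_def by (metis someI_ex)
  \<comment> \<open>Equivalent points have the same predicate, so \<open>SOME\<close> returns the
    same value for both, which makes r constant on classes.\<close>
  have "P x = P y" if "E x y" for x y
    using that E unfolding P_def by (intro ext) blast
  then have "r x = r y" if "E x y" for x y using that by (simp add: r_def)
  with P show ?thesis using that[of r] E(1) by (auto simp: P_def)
qed

text \<open>On S the map r factors through a signature that records the position of each coordinate
  relative to G and takes only finitely many values.\<close>

lemma finite_representatives:
  fixes r :: "real ^ 'd \<Rightarrow> 'a"
  assumes G: "\<And>l. finite (G l)"
    and eq: "\<And>x y. x \<in> S \<Longrightarrow> y \<in> S \<Longrightarrow> (\<And>l. same_gap (G l) (x $ l) (y $ l)) \<Longrightarrow> r x = r y"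
  shows "finite (r ` S)"
proof -
  define k where "k x = (\<lambda>l. ({g\<in>G l. g \<le> x $ l}, {g\<in>G l. g < x $ l}))" for x :: "real ^ 'd"
  have k_eq: "r x = r y" if "x \<in> S" "y \<in> S" "k x = k y" for x y
    using that(1,2)
  proof (rule eq)
    fix l
    have "fst (k x l) = fst (k y l)" "snd (k x l) = snd (k y l)" using that(3) by simp_all
    then show "same_gap (G l) (x $ l) (y $ l)"
      unfolding k_def same_gap_def fst_conv snd_conv by blast
  qed
  have "r x = (r \<circ> inv_into S k) (k x)" if "x \<in> S" for x
    using k_eq[of x "inv_into S k (k x)"] that by (simp add: f_inv_into_f inv_into_into)
  then have "r ` S \<subseteq> (r \<circ> inv_into S k) ` range k" by auto
  moreover have "range k \<subseteq> Pi\<^sub>E UNIV (\<lambda>l. Pow (G l) \<times> Pow (G l))" by (auto simp: k_def)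
  then have "finite (range k)" using G by (auto elim!: finite_subset intro!: finite_PiE)
  ultimately show ?thesis by (meson finite_imageI finite_subset)
qed

text \<open>Points move only inside their class. Whether x and r x lie below t can therefore differ
  only if t lies strictly inside the gap of x in some coordinate. Each such slab has mass at most e,
  and there is one slab per coordinate.\<close>

lemma quantization:
  fixes f :: "real ^ 'd \<Rightarrow> real"
  assumes "finite_measure N" and sets_N: "sets N = sets cube_borel"
    and "bdd_above (f ` unit_cube)" and "0 < e"
  obtains r where "finite (r ` unit_cube)" "r ` unit_cube \<subseteq> unit_cube"
    "\<And>x. x \<in> unit_cube \<Longrightarrow> f x \<le> f (r x) + e"
    "\<And>t. t \<in> unit_cube \<Longrightarrow> {x\<in>unit_cube. r x \<le> t} \<in> sets N"
    "\<And>t. t \<in> unit_cube \<Longrightarrow>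
       \<bar>measure N {x\<in>unit_cube. r x \<le> t} - measure N {0..t}\<bar> \<le> real CARD('d) * e"
proof -
  interpret finite_measure N by fact
  have space_N: "space N = unit_cube"
    using sets_eq_imp_space_eq[OF sets_N] by (simp add: space_restrict_space)
  have nth [measurable]: "(\<lambda>x. x $ l) \<in> borel_measurable N" for l
    unfolding measurable_cong_sets[OF sets_N refl] by (rule measurable_nth_cube)
  have "\<forall>l. \<exists>G. finite G \<and> (\<forall>t. t \<in> {0..1} \<longrightarrow> t \<notin> G \<longrightarrow>
      measure N {x\<in>space N. same_gap G (x $ l) t} \<le> e)"
  proof
    fix l
    show "\<exists>G. finite G \<and> (\<forall>t. t \<in> {0..1} \<longrightarrow> t \<notin> G \<longrightarrow>
        measure N {x\<in>space N. same_gap G (x $ l) t} \<le> e)"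
      by (rule small_gaps[OF nth \<open>0 < e\<close>, of l]) blast
  qed
  from choice[OF this] obtain G where G: "\<And>l. finite (G l)" "\<And>l t. t \<in> {0..1} \<Longrightarrow> t \<notin> G l \<Longrightarrow>
      measure N {x\<in>space N. same_gap (G l) (x $ l) t} \<le> e" by blast
  define E where "E x y \<longleftrightarrow> (\<forall>l. same_gap (G l) (x $ l) (y $ l))" for x y :: "real ^ 'd"
  obtain r where r: "\<And>x. x \<in> unit_cube \<Longrightarrow> r x \<in> unit_cube" "\<And>x. x \<in> unit_cube \<Longrightarrow> E x (r x)"
    "\<And>x. x \<in> unit_cube \<Longrightarrow> f x \<le> f (r x) + e" "\<And>x y. x \<in> unit_cube \<Longrightarrow> E x y \<Longrightarrow> r x = r y"
  proof (rule near_sup_representatives[of E f unit_cube e])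
    show "E x z" if "E x y" "E y z" for x y z
      using that same_gap_trans unfolding E_def by blast
  qed (use assms same_gap_refl same_gap_sym in \<open>auto simp: E_def\<close>)
  have E_sym: "E x y \<Longrightarrow> E y x" for x y using same_gap_sym by (auto simp: E_def)
  have E_trans: "E x y \<Longrightarrow> E y z \<Longrightarrow> E x z" for x y z using same_gap_trans unfolding E_def by blast
  have fin: "finite (r ` unit_cube)"
  proof (rule finite_representatives)
    show "finite (G l)" for l by (rule G)
    fix x y assume "x \<in> unit_cube" "\<And>l. same_gap (G l) (x $ l) (y $ l)"
    then show "r x = r y" by (intro r(4)) (simp_all add: E_def)
  qed
  have class_sets: "{x\<in>unit_cube. E x z} \<in> sets N" for z
  proof -
    have "{x\<in>space N. \<forall>l. \<forall>g\<in>G l. (g \<le> x $ l \<longleftrightarrow> g \<le> z $ l) \<and> (g < x $ l \<longleftrightarrow> g < z $ l)} \<in> sets N"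
      using G(1) by measurable
    then show ?thesis by (simp add: E_def same_gap_def space_N)
  qed
  have le_sets: "{x\<in>unit_cube. r x \<le> t} \<in> sets N" for t
  proof -
    have "{x\<in>unit_cube. r x \<le> t} = (\<Union>z\<in>{z\<in>r ` unit_cube. z \<le> t}. {x\<in>unit_cube. E x z})"
    proof (intro equalityI subsetI)
      fix x assume "x \<in> (\<Union>z\<in>{z\<in>r ` unit_cube. z \<le> t}. {x\<in>unit_cube. E x z})"
      then obtain y where "x \<in> unit_cube" "y \<in> unit_cube" "r y \<le> t" "E x (r y)" by auto
      moreover have "E x y" using E_trans[OF \<open>E x (r y)\<close> E_sym[OF r(2)]] \<open>y \<in> unit_cube\<close> by blast
      ultimately show "x \<in> {x\<in>unit_cube. r x \<le> t}" using r(4)[of x y] by simp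
    qed (use r(2) in auto)
    also have "\<dots> \<in> sets N" using fin by (intro sets.finite_UN class_sets) auto
    finally show ?thesis .
  qed
  have le_diff: "\<bar>measure N {x\<in>unit_cube. r x \<le> t} - measure N {0..t}\<bar> \<le> real CARD('d) * e"
    if t: "t \<in> unit_cube" for t
  proof -
    let ?A = "{x\<in>unit_cube. r x \<le> t}"
    \<comment> \<open>If the coordinate of t lies in G, no gap straddles it by
      \<open>same_gap_between\<close>, hence the empty slab.\<close>
    define B where "B l = (if t $ l \<in> G l then {} else {x\<in>space N. same_gap (G l) (x $ l) (t $ l)})" for l
    have B_gap: "x \<in> (\<Union>l. B l)" if "x \<in> unit_cube" "same_gap (G l) (x $ l) (t $ l)" "t $ l \<notin> G l" for x l
      using that by (auto simp: B_def space_N)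
    have B_sets: "B l \<in> sets N" for l
      unfolding B_def same_gap_def using G(1)[of l] by (cases "t $ l \<in> G l") simp_all
    have B_le: "measure N (B l) \<le> e" for l
      using t G(2)[of "t $ l" l] \<open>0 < e\<close> by (auto simp: B_def less_eq_vec_def)
    have "measure N (\<Union>l. B l) \<le> (\<Sum>l\<in>UNIV. measure N (B l))"
      using B_sets by (intro finite_measure_subadditive_finite) auto
    also have "\<dots> \<le> real CARD('d) * e" using sum_bounded_above[of UNIV "\<lambda>l. measure N (B l)" e] B_le by simp
    finally have mB: "measure N (\<Union>l. B l) \<le> real CARD('d) * e" .
    have BU: "(\<Union>l. B l) \<in> sets N" using B_sets by (intro sets.finite_UN) auto
    have cube_t: "{0..t} \<in> sets N"
      unfolding sets_N using t by (intro box_sets_cube) (auto intro: order_trans)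
    have gap: "same_gap (G l) (x $ l) (r x $ l)" if "x \<in> unit_cube" for x l
      using r(2)[OF that] by (simp add: E_def)
    have "?A \<subseteq> {0..t} \<union> (\<Union>l. B l)"
    proof
      fix x assume x: "x \<in> ?A"
      show "x \<in> {0..t} \<union> (\<Union>l. B l)"
      proof (cases "x \<le> t")
        case False
        then obtain l where l: "t $ l < x $ l" by (auto simp: less_eq_vec_def not_le)
        have "r x $ l \<le> t $ l" using x by (auto simp: less_eq_vec_def)
        from same_gap_between[OF same_gap_sym[OF gap] this l] x show ?thesis by (intro UnI2 B_gap) auto
      qed (use x in auto)
    qed
    then have "measure N ?A \<le> measure N ({0..t} \<union> (\<Union>l. B l))"
      by (intro finite_measure_mono) (use cube_t BU in auto)
    also have "\<dots> \<le> measure N {0..t} + measure N (\<Union>l. B l)"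
      by (intro measure_Un_le cube_t BU)
    finally have 1: "measure N ?A \<le> measure N {0..t} + real CARD('d) * e" using mB by simp
    have "{0..t} \<subseteq> ?A \<union> (\<Union>l. B l)"
    proof
      fix x assume x: "x \<in> {0..t}"
      then have xc: "x \<in> unit_cube" using t by auto
      show "x \<in> ?A \<union> (\<Union>l. B l)"
      proof (cases "r x \<le> t")
        case False
        then obtain l where l: "t $ l < r x $ l" by (auto simp: less_eq_vec_def not_le)
        have "x $ l \<le> t $ l" using x by (auto simp: less_eq_vec_def)
        from same_gap_between[OF gap[OF xc] this l] xc show ?thesis by (intro UnI2 B_gap) auto
      qed (use xc in auto)
    qed
    then have "measure N {0..t} \<le> measure N (?A \<union> (\<Union>l. B l))"
      by (intro finite_measure_mono) (use le_sets BU in auto)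
    also have "\<dots> \<le> measure N ?A + measure N (\<Union>l. B l)"
      by (intro measure_Un_le le_sets BU)
    finally have 2: "measure N {0..t} \<le> measure N ?A + real CARD('d) * e" using mB by simp
    from 1 2 show ?thesis by simp
  qed
  show ?thesis
    by (rule that[of r]) (use fin r(1,3) le_sets le_diff in \<open>simp_all add: image_subset_iff\<close>)
qed

lemma empirical_mean_mono:
  "(\<And>z. z \<in> set zs \<Longrightarrow> g z \<le> h z) \<Longrightarrow> empirical_mean zs g \<le> empirical_mean zs h"
  unfolding empirical_mean_def by (intro divide_right_mono sum_list_mono) auto

lemma zero_in_cube [simp]: "(0 :: real ^ 'd) \<in> unit_cube"
  and one_in_cube [simp]: "(1 :: real ^ 'd) \<in> unit_cube"
  by (auto simp: less_eq_vec_def)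

lemma hk_variation_bdd:
  assumes "hk_variation f = ereal V"
  shows "bdd_above (f ` unit_cube)" "x \<in> unit_cube \<Longrightarrow> \<bar>f x\<bar> \<le> V + \<bar>f 1\<bar>"
  using hk_variation_bound[OF _ assms]
  by (force intro!: bdd_aboveI2[of _ _ "V + \<bar>f 1\<bar>"] simp: abs_le_iff)+

text \<open>After quantization the measure is as discrete as the data, and summation by parts turns
  the difference of the two means into weights times differences of box masses. Near-maximality
  enters through f x \<le> f (r x) + e.\<close>

lemma koksma_hlawka_le:
  fixes f :: "real ^ 'd \<Rightarrow> real"
  assumes "prob_space N" and sets_N: "sets N = sets cube_borel"
    and f: "f \<in> borel_measurable cube_borel" and V: "hk_variation f = ereal V"
    and xs: "xs \<noteq> []" "set xs \<subseteq> unit_cube"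
    and D: "\<And>t. t \<in> unit_cube \<Longrightarrow> \<bar>empirical_mean xs (indicat_real {0..t}) - measure N {0..t}\<bar> \<le> D"
  shows "(\<integral>x. f x \<partial>N) \<le> empirical_mean xs f + V * D"
proof -
  interpret prob_space N by fact
  have space_N: "space N = unit_cube"
    using sets_eq_imp_space_eq[OF sets_N] by (simp add: space_restrict_space)
  have [measurable]: "f \<in> borel_measurable N"
    using f unfolding measurable_cong_sets[OF sets_N refl] .
  have V0: "0 \<le> V" using hk_variation_nonneg[of f] V by simp
  have int: "integrable N f"
    by (rule integrable_const_bound[of _ "V + \<bar>f 1\<bar>"]) (use hk_variation_bdd(2)[OF V] in \<open>auto simp: space_N\<close>)
  let ?d = "real CARD('d)"
  have *: "(\<integral>x. f x \<partial>N) \<le> empirical_mean xs f + V * D + (1 + V * ?d) * e" if "0 < e" for e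
  proof (rule quantization[OF finite_measure_axioms sets_N hk_variation_bdd(1)[OF V] that])
    fix r :: "real ^ 'd \<Rightarrow> real ^ 'd"
    assume r: "finite (r ` unit_cube)" "r ` unit_cube \<subseteq> unit_cube"
      "\<And>x. x \<in> unit_cube \<Longrightarrow> f x \<le> f (r x) + e"
      "\<And>t. t \<in> unit_cube \<Longrightarrow> {x\<in>unit_cube. r x \<le> t} \<in> sets N"
      "\<And>t. t \<in> unit_cube \<Longrightarrow>
       \<bar>measure N {x\<in>unit_cube. r x \<le> t} - measure N {0..t}\<bar> \<le> ?d * e"
    define S where "S = r ` unit_cube \<union> set xs"
    \<comment> \<open>The grid runs through all representatives and all data points, so the
      expansion is exact wherever it is evaluated.\<close>
    define G where "G l = insert 1 ((\<lambda>x. x $ l) ` S)" for l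
    have S: "finite S" "S \<subseteq> unit_cube" using r(1,2) xs by (auto simp: S_def)
    have G: "finite (G l)" "G l \<subseteq> {0..1}" "1 \<in> G l" for l
      using S by (auto simp: G_def less_eq_vec_def)
    have finG: "finite (grid G)" using G(1) by (rule finite_grid)
    have grid_cube: "grid G \<subseteq> unit_cube"
      using G(2) by (fastforce simp: grid_def less_eq_vec_def)
    have S_grid: "S \<subseteq> grid G" by (auto simp: grid_def G_def)
    obtain w where w: "\<And>x. x \<in> grid G \<Longrightarrow> f x = f 1 + (\<Sum>y\<in>{y\<in>grid G. x \<le> y}. w y)"
      "ereal (\<Sum>y\<in>grid G. \<bar>w y\<bar>) \<le> hk_variation f"
      using grid_moebius[where f = f and G = G] G by metis
    have fS: "f x = f 1 + (\<Sum>y\<in>grid G. w y * indicat_real {z. z \<le> y} x)" if "x \<in> S" for x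
    proof -
      have "(\<Sum>y\<in>{y\<in>grid G. x \<le> y}. w y) = (\<Sum>y\<in>grid G. w y * indicat_real {z. z \<le> y} x)"
        by (rule sum.mono_neutral_cong_left) (use finG in auto)
      then show ?thesis using w(1)[of x] S_grid that by auto
    qed
    have ind_int: "integrable N (\<lambda>x. w y * indicat_real {x\<in>unit_cube. r x \<le> y} x)"
      if "y \<in> grid G" for y
      using r(4) that grid_cube by (intro integrable_mult_right integrable_real_indicator) (auto simp: less_top[symmetric])
    have "(\<integral>x. f x \<partial>N) \<le> (\<integral>x. f 1 + e + (\<Sum>y\<in>grid G. w y * indicat_real {x\<in>unit_cube. r x \<le> y} x) \<partial>N)"
    proof (rule integral_mono[OF int])
      show "integrable N (\<lambda>x. f 1 + e + (\<Sum>y\<in>grid G. w y * indicat_real {x\<in>unit_cube. r x \<le> y} x))"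
        by (intro Bochner_Integration.integrable_add Bochner_Integration.integrable_sum ind_int) simp_all
      fix x assume "x \<in> space N"
      then have x: "x \<in> unit_cube" by (simp add: space_N)
      have "f (r x) = f 1 + (\<Sum>y\<in>grid G. w y * indicat_real {x\<in>unit_cube. r x \<le> y} x)"
        using fS[of "r x"] x by (simp add: S_def indicator_def)
      then show "f x \<le> f 1 + e + (\<Sum>y\<in>grid G. w y * indicat_real {x\<in>unit_cube. r x \<le> y} x)"
        using r(3)[OF x] by simp
    qed
    also have "\<dots> = f 1 + e + (\<Sum>y\<in>grid G. w y * measure N {x\<in>unit_cube. r x \<le> y})"
    proof -
      have wint: "(\<integral>x. w y * indicat_real {x\<in>unit_cube. r x \<le> y} x \<partial>N) = w y * measure N {x\<in>unit_cube. r x \<le> y}"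
        if "y \<in> grid G" for y
      proof -
        have "{x\<in>unit_cube. r x \<le> y} \<in> sets N" using r(4) that grid_cube by auto
        then have "{x\<in>unit_cube. r x \<le> y} \<inter> space N = {x\<in>unit_cube. r x \<le> y}" by (auto simp: space_N)
        then show ?thesis by simp
      qed
      have "(\<integral>x. (\<Sum>y\<in>grid G. w y * indicat_real {x\<in>unit_cube. r x \<le> y} x) \<partial>N)
          = (\<Sum>y\<in>grid G. w y * measure N {x\<in>unit_cube. r x \<le> y})"
        using Bochner_Integration.integral_sum[OF ind_int] sum.cong[OF refl wint] by (rule trans)
      moreover have "integrable N (\<lambda>x. \<Sum>y\<in>grid G. w y * indicat_real {x\<in>unit_cube. r x \<le> y} x)"
        by (intro Bochner_Integration.integrable_sum ind_int)
      ultimately show ?thesis by (simp add: prob_space)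
    qed
    \<comment> \<open>The empirical box masses are added and subtracted. The first part reassembles
      the empirical mean; the second consists of local discrepancies of the quantized
      measure.\<close>
    also have "\<dots> = f 1 + e + (\<Sum>y\<in>grid G. w y * empirical_mean xs (indicat_real {0..y}))
        + (\<Sum>y\<in>grid G. w y * (measure N {x\<in>unit_cube. r x \<le> y} - empirical_mean xs (indicat_real {0..y})))"
      by (simp add: right_diff_distrib sum_subtractf)
    also have "f 1 + e + (\<Sum>y\<in>grid G. w y * empirical_mean xs (indicat_real {0..y})) = empirical_mean xs f + e"
    proof -
      have "empirical_mean xs f = empirical_mean xs (\<lambda>x. f 1 + (\<Sum>y\<in>grid G. w y * indicat_real {0..y} x))"
      proof (rule empirical_mean_cong)
        fix x assume x: "x \<in> set xs"
        have "(\<Sum>y\<in>grid G. w y * indicat_real {z. z \<le> y} x) = (\<Sum>y\<in>grid G. w y * indicat_real {0..y} x)"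
          by (rule sum.cong) (use x xs in \<open>auto simp: indicator_def\<close>)
        then show "f x = f 1 + (\<Sum>y\<in>grid G. w y * indicat_real {0..y} x)"
          using fS[of x] x by (simp add: S_def)
      qed
      then show ?thesis
        using xs(1) by (simp add: empirical_mean_add empirical_mean_sum empirical_mean_mult empirical_mean_const)
    qed
    also have "(\<Sum>y\<in>grid G. w y * (measure N {x\<in>unit_cube. r x \<le> y} - empirical_mean xs (indicat_real {0..y})))
        \<le> (\<Sum>y\<in>grid G. \<bar>w y\<bar> * (D + ?d * e))"
    proof (rule sum_mono)
      fix y assume "y \<in> grid G"
      then have y: "y \<in> unit_cube" using grid_cube by auto
      have "\<bar>measure N {x\<in>unit_cube. r x \<le> y} - empirical_mean xs (indicat_real {0..y})\<bar> \<le> D + ?d * e"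
        using r(5)[OF y] D[OF y] by linarith
      then have "\<bar>w y\<bar> * \<bar>measure N {x\<in>unit_cube. r x \<le> y} - empirical_mean xs (indicat_real {0..y})\<bar>
          \<le> \<bar>w y\<bar> * (D + ?d * e)" by (intro mult_left_mono) auto
      then show "w y * (measure N {x\<in>unit_cube. r x \<le> y} - empirical_mean xs (indicat_real {0..y}))
          \<le> \<bar>w y\<bar> * (D + ?d * e)"
        unfolding abs_mult[symmetric] by linarith
    qed
    also have "\<dots> \<le> V * (D + ?d * e)"
    proof -
      have "(\<Sum>y\<in>grid G. \<bar>w y\<bar>) \<le> V" using w(2) V by simp
      moreover have "0 \<le> D" using D[OF one_in_cube] by linarith
      ultimately show ?thesis
        unfolding sum_distrib_right[symmetric] using that by (intro mult_right_mono) auto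
    qed
    finally show ?thesis by (simp add: algebra_simps)
  qed
  show ?thesis
  proof (rule field_le_epsilon)
    fix e :: real assume "0 < e"
    have pos: "0 < 1 + V * ?d" using V0 by (intro add_pos_nonneg) auto
    then have "(1 + V * ?d) * (e / (1 + V * ?d)) = e" by simp
    with *[of "e / (1 + V * ?d)"] \<open>0 < e\<close> pos
    show "(\<integral>x. f x \<partial>N) \<le> empirical_mean xs f + V * D + e" by simp
  qed
qed

lemma star_discrepancy_real:
  assumes "prob_space N"
  obtains D where "star_discrepancy N xs = ereal D"
    "\<And>t. t \<in> unit_cube \<Longrightarrow> \<bar>empirical_mean xs (indicat_real {0..t}) - measure N {0..t}\<bar> \<le> D"
proof -
  interpret prob_space N by fact
  let ?g = "\<lambda>t. ereal \<bar>empirical_mean xs (indicat_real {0..t}) - measure N {0..t}\<bar>"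
  have bd: "?g t \<le> ereal 1" for t
  proof -
    have "empirical_mean xs (indicat_real {0..t}) \<le> empirical_mean xs (\<lambda>_. 1)"
      "empirical_mean xs (\<lambda>_. 0) \<le> empirical_mean xs (indicat_real {0..t})"
      by (intro empirical_mean_mono; simp add: indicator_def)+
    \<comment> \<open>For an empty list the mean is 0 because of the division by zero, hence only an
      inequality.\<close>
    moreover have "empirical_mean xs (\<lambda>_. 1) \<le> 1" "empirical_mean xs (\<lambda>_. 0) = 0"
      by (auto simp: empirical_mean_def sum_list_triv)
    ultimately have "0 \<le> empirical_mean xs (indicat_real {0..t})" "empirical_mean xs (indicat_real {0..t}) \<le> 1"
      by linarith+
    then have "\<bar>empirical_mean xs (indicat_real {0..t}) - measure N {0..t}\<bar> \<le> 1"
      using prob_le_1[of "{0..t}"] measure_nonneg[of N "{0..t}"] by linarith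
    then show ?thesis by simp
  qed
  have upper: "?g t \<le> star_discrepancy N xs" if "t \<in> unit_cube" for t
    unfolding star_discrepancy_def using that by (rule SUP_upper)
  have "star_discrepancy N xs \<le> ereal 1"
    unfolding star_discrepancy_def by (intro SUP_least bd)
  moreover have "0 \<le> star_discrepancy N xs"
    using upper[OF one_in_cube] by (rule order_trans[rotated]) simp
  ultimately obtain D where D: "star_discrepancy N xs = ereal D"
    by (cases "star_discrepancy N xs") auto
  show ?thesis
    by (rule that[OF D]) (use upper in \<open>simp add: D\<close>)
qed

subsection \<open>Jordan decomposition of signed measures\<close>

text \<open>A supremum of reals, so it is meaningful only for bounded set functions, which the
  locale below guarantees; \<open>ennreal_u\<close> identifies it with the set function of
  \<open>upper_variation\<close>.\<close>

definition signed_sup :: "'a measure \<Rightarrow> ('a set \<Rightarrow> real) \<Rightarrow> 'a set \<Rightarrow> real" where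
  "signed_sup M \<nu> A = (SUP B\<in>{B\<in>sets M. B \<subseteq> A}. \<nu> B)"

locale bounded_signed_measure =
  fixes M :: "'a measure" and \<nu> :: "'a set \<Rightarrow> real" and C :: real
  assumes signed: "signed_measure M \<nu>" and bounded: "\<And>A. A \<in> sets M \<Longrightarrow> \<bar>\<nu> A\<bar> \<le> C"
begin

lemma empty: "\<nu> {} = 0"
  using signed by (simp add: signed_measure_def)

lemma sums: "range A \<subseteq> sets M \<Longrightarrow> disjoint_family A \<Longrightarrow> (\<lambda>n. \<nu> (A n)) sums \<nu> (\<Union>n. A n)"
  using signed by (simp add: signed_measure_def)

lemma union:
  assumes "A \<in> sets M" "B \<in> sets M" "A \<inter> B = {}"
  shows "\<nu> (A \<union> B) = \<nu> A + \<nu> B"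
proof -
  have "(\<lambda>n. \<nu> (binaryset A B n)) sums \<nu> (\<Union>n. binaryset A B n)"
    using assms by (intro sums) (auto simp: binaryset_def disjoint_family_on_def)
  moreover have "(\<lambda>n. \<nu> (binaryset A B n)) sums (\<nu> A + \<nu> B)"
    using empty by (rule binaryset_sums)
  ultimately show ?thesis by (metis UN_binaryset_eq sums_unique2)
qed

lemma diff:
  assumes "A \<in> sets M" "B \<in> sets M" "B \<subseteq> A"
  shows "\<nu> (A - B) = \<nu> A - \<nu> B"
  using union[of "A - B" B] assms by (simp add: Diff_disjoint Un_absorb2 Int_commute)

lemma uminus: "bounded_signed_measure M (\<lambda>A. - \<nu> A) C"
  by unfold_locales (use signed bounded in \<open>auto simp: signed_measure_def sums_minus\<close>)

abbreviation "u \<equiv> signed_sup M \<nu>"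

lemma u_bdd: "bdd_above (\<nu> ` {B\<in>sets M. B \<subseteq> A})"
  using bounded by (force intro!: bdd_aboveI2[of _ _ C] simp: abs_le_iff)

lemma u_upper: "B \<in> sets M \<Longrightarrow> B \<subseteq> A \<Longrightarrow> \<nu> B \<le> u A"
  unfolding signed_sup_def by (rule cSUP_upper[OF _ u_bdd]) auto

lemma u_least: "(\<And>B. B \<in> sets M \<Longrightarrow> B \<subseteq> A \<Longrightarrow> \<nu> B \<le> c) \<Longrightarrow> u A \<le> c"
  unfolding signed_sup_def by (rule cSUP_least) auto

lemma u_nonneg: "0 \<le> u A"
  using u_upper[of "{}" A] empty by simp

lemma u_mono: "A \<subseteq> B \<Longrightarrow> u A \<le> u B"
  by (rule u_least) (auto intro!: u_upper)

lemma u_superadditive: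
  assumes "A \<inter> B = {}"
  shows "u A + u B \<le> u (A \<union> B)"
proof -
  have "u A \<le> u (A \<union> B) - u B"
  proof (rule u_least)
    fix A' assume A': "A' \<in> sets M" "A' \<subseteq> A"
    have "u B \<le> u (A \<union> B) - \<nu> A'"
    proof (rule u_least)
      fix B' assume B': "B' \<in> sets M" "B' \<subseteq> B"
      have "\<nu> A' + \<nu> B' = \<nu> (A' \<union> B')" using A' B' assms by (intro union[symmetric]) auto
      also have "\<dots> \<le> u (A \<union> B)" using A' B' by (intro u_upper) auto
      finally show "\<nu> B' \<le> u (A \<union> B) - \<nu> A'" by simp
    qed
    then show "\<nu> A' \<le> u (A \<union> B) - u B" by simp
  qed
  then show ?thesis by simp
qed

text \<open>\<open>ennreal\<close> sends negative values to 0. This is harmless because the empty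
  set is one of the B, so the real supremum is nonnegative as well.\<close>

lemma ennreal_u: "(SUP B\<in>{B\<in>sets M. B \<subseteq> A}. ennreal (\<nu> B)) = ennreal (u A)"
proof (rule antisym)
  show "(SUP B\<in>{B\<in>sets M. B \<subseteq> A}. ennreal (\<nu> B)) \<le> ennreal (u A)"
    by (intro SUP_least ennreal_leI u_upper) auto
  let ?S = "SUP B\<in>{B\<in>sets M. B \<subseteq> A}. ennreal (\<nu> B)"
  show "ennreal (u A) \<le> ?S"
  proof (cases "?S = \<infinity>")
    case False
    then obtain s where s: "?S = ennreal s" "0 \<le> s" by (cases ?S) auto
    have "u A \<le> s"
    proof (rule u_least)
      fix B assume "B \<in> sets M" "B \<subseteq> A"
      then have "ennreal (\<nu> B) \<le> ?S" by (intro SUP_upper) auto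
      then show "\<nu> B \<le> s" using s by (simp add: ennreal_le_iff)
    qed
    then show ?thesis using s by (simp add: ennreal_leI)
  next
    case True
    show ?thesis unfolding True by simp
  qed
qed

lemma u_countably_additive: "countably_additive (sets M) (\<lambda>A. ennreal (u A))"
proof (rule countably_additiveI)
  fix A :: "nat \<Rightarrow> 'a set"
  assume A: "range A \<subseteq> sets M" "disjoint_family A" "(\<Union>n. A n) \<in> sets M"
  show "(\<Sum>n. ennreal (u (A n))) = ennreal (u (\<Union>n. A n))"
  proof (rule antisym)
    \<comment> \<open>Superadditivity bounds the partial sums, hence the series.\<close>
    have "(\<Sum>i<n. u (A i)) \<le> u (\<Union>i<n. A i)" for n
    proof (induction n)
      case (Suc n)
      have "(\<Union>i<n. A i) \<inter> A n = {}"
      proof -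
        have "A i \<inter> A n = {}" if "i < n" for i
          using disjoint_family_onD[OF A(2)] that by simp
        then show ?thesis by blast
      qed
      from u_superadditive[OF this] Suc show ?case by (simp add: lessThan_Suc Un_commute)
    qed (simp add: u_nonneg)
    then have "(\<Sum>i<n. u (A i)) \<le> u (\<Union>n. A n)" for n
      by (rule order_trans[OF _ u_mono]) auto
    then have "(\<Sum>i<n. ennreal (u (A i))) \<le> ennreal (u (\<Union>n. A n))" for n
      by (simp add: u_nonneg ennreal_leI)
    then show "(\<Sum>n. ennreal (u (A n))) \<le> ennreal (u (\<Union>n. A n))"
      by (intro suminf_le_const summableI)
    \<comment> \<open>Conversely, B is cut along the \<open>A n\<close>, and countable additivity of
      \<nu> bounds \<nu> B by the series.\<close>
    have "ennreal (\<nu> B) \<le> (\<Sum>n. ennreal (u (A n)))" if B: "B \<in> sets M" "B \<subseteq> (\<Union>n. A n)" for B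
    proof -
      have "(\<lambda>n. \<nu> (B \<inter> A n)) sums \<nu> (\<Union>n. B \<inter> A n)"
        using A B by (intro sums) (auto simp: disjoint_family_on_def)
      moreover have "(\<Union>n. B \<inter> A n) = B" using B by auto
      ultimately have "(\<lambda>n. \<Sum>i<n. \<nu> (B \<inter> A i)) \<longlonglongrightarrow> \<nu> B" by (simp add: sums_def)
      then have "(\<lambda>n. ennreal (\<Sum>i<n. \<nu> (B \<inter> A i))) \<longlonglongrightarrow> ennreal (\<nu> B)" by (rule tendsto_ennrealI)
      moreover have "ennreal (\<Sum>i<n. \<nu> (B \<inter> A i)) \<le> (\<Sum>n. ennreal (u (A n)))" for n
      proof -
        have "(\<Sum>i<n. \<nu> (B \<inter> A i)) \<le> (\<Sum>i<n. u (A i))"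
          using A B by (intro sum_mono u_upper) auto
        then have "ennreal (\<Sum>i<n. \<nu> (B \<inter> A i)) \<le> (\<Sum>i<n. ennreal (u (A i)))"
          by (simp add: u_nonneg ennreal_leI)
        also have "\<dots> \<le> (\<Sum>n. ennreal (u (A n)))" by (rule sum_le_suminf) auto
        finally show ?thesis .
      qed
      ultimately show ?thesis by (blast intro: LIMSEQ_le_const2)
    qed
    then show "ennreal (u (\<Union>n. A n)) \<le> (\<Sum>n. ennreal (u (A n)))"
      unfolding ennreal_u[symmetric] by (intro SUP_least) auto
  qed
qed

lemma sets_upper: "sets (upper_variation M \<nu>) = sets M"
  and space_upper: "space (upper_variation M \<nu>) = space M"
  by (simp_all add: upper_variation_def)

lemma emeasure_upper: "A \<in> sets M \<Longrightarrow> emeasure (upper_variation M \<nu>) A = ennreal (u A)"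
proof (subst emeasure_measure_of[OF upper_variation_def])
  show "positive (sets (upper_variation M \<nu>)) (\<lambda>A. SUP B\<in>{B\<in>sets M. B \<subseteq> A}. ennreal (\<nu> B))"
    unfolding ennreal_u positive_def using u_least[of "{}" 0] empty by (auto simp: ennreal_eq_0_iff)
  show "countably_additive (sets (upper_variation M \<nu>)) (\<lambda>A. SUP B\<in>{B\<in>sets M. B \<subseteq> A}. ennreal (\<nu> B))"
    unfolding ennreal_u sets_upper by (rule u_countably_additive)
qed (auto simp: sets_upper ennreal_u dest: sets.sets_into_space)

lemma measure_upper: "A \<in> sets M \<Longrightarrow> measure (upper_variation M \<nu>) A = u A"
  by (simp add: measure_def emeasure_upper u_nonneg)

lemma finite_measure_upper: "finite_measure (upper_variation M \<nu>)"
  by (rule finite_measureI) (simp add: space_upper emeasure_upper)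

text \<open>For B inside A, \<nu> B = \<nu> A - \<nu> (A - B). Applied to \<nu> and to - \<nu>, this
  yields the two inequalities behind \<open>jordan\<close>.\<close>

lemma u_le_lower:
  assumes "A \<in> sets M"
  shows "u A \<le> \<nu> A + signed_sup M (\<lambda>A. - \<nu> A) A"
proof (rule u_least)
  interpret m: bounded_signed_measure M "\<lambda>A. - \<nu> A" C by (rule uminus)
  fix B assume "B \<in> sets M" "B \<subseteq> A"
  with assms m.u_upper[of "A - B" A] diff[of A B] show "\<nu> B \<le> \<nu> A + m.u A" by auto
qed

end

lemma (in bounded_signed_measure) jordan:
  assumes "A \<in> sets M"
  shows "\<nu> A = measure (upper_variation M \<nu>) A - measure (upper_variation M (\<lambda>A. - \<nu> A)) A"
proof -
  interpret m: bounded_signed_measure M "\<lambda>A. - \<nu> A" C by (rule uminus)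
  have "signed_sup M (\<lambda>A. - \<nu> A) A \<le> - \<nu> A + u A" using m.u_le_lower[OF assms] by simp
  with u_le_lower[OF assms] show ?thesis
    by (simp add: measure_upper m.measure_upper assms)
qed

lemma abs_le_total_variation:
  assumes "B \<in> sets M" "\<nu> {} = 0"
  shows "ereal (\<bar>\<nu> B\<bar> + \<bar>\<nu> (space M - B)\<bar>) \<le> total_variation M \<nu> (space M)"
proof -
  have "(\<Sum>A\<in>{B, space M - B}. \<bar>\<nu> A\<bar>) = \<bar>\<nu> B\<bar> + \<bar>\<nu> (space M - B)\<bar>"
  \<comment> \<open>A set equal to its complement forces the space to be empty, and the family of
    two sets collapses to one.\<close>
  proof (cases "B = space M - B")
    case True
    then have "B = {}" by auto
    with True have "{B, space M - B} = {{}}" "space M - B = {}" by auto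
    then show ?thesis using assms(2) \<open>B = {}\<close> by simp
  qed simp
  moreover have "{B, space M - B} \<in> {P. finite P \<and> P \<subseteq> sets M \<and> disjoint P \<and> \<Union>P = space M}"
    using assms(1) sets.sets_into_space[OF assms(1)] unfolding disjoint_def by auto
  ultimately show ?thesis
    unfolding total_variation_def by (intro SUP_upper2[of "{B, space M - B}"]) simp_all
qed

lemma bounded_signed_measureI:
  assumes "signed_measure M \<nu>" "total_variation M \<nu> (space M) = ereal C"
  shows "bounded_signed_measure M \<nu> C"
proof
  fix A assume "A \<in> sets M"
  with abs_le_total_variation[of A M \<nu>] assms show "\<bar>\<nu> A\<bar> \<le> C" by (simp add: signed_measure_def)
qed fact

lemma (in bounded_signed_measure) upper_lower_le_total_variation:
  "ereal (measure (upper_variation M \<nu>) (space M) + measure (upper_variation M (\<lambda>A. - \<nu> A)) (space M))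
     \<le> total_variation M \<nu> (space M)"
proof (cases "total_variation M \<nu> (space M)")
  case (real T)
  \<comment> \<open>Since \<nu> (space M - B) = \<nu> (space M) - \<nu> B, the two-set partition
    gives 2 \<nu> B - \<nu> (space M) \<le> T. After the supremum over B, Jordan's decomposition
    turns the left side into the sum of the two variations.\<close>
  have "u (space M) \<le> (T + \<nu> (space M)) / 2"
  proof (rule u_least)
    fix B assume B: "B \<in> sets M" "B \<subseteq> space M"
    have "\<bar>\<nu> B\<bar> + \<bar>\<nu> (space M - B)\<bar> \<le> T"
      using abs_le_total_variation[OF B(1), of \<nu>] empty real by simp
    with diff[of "space M" B] B show "\<nu> B \<le> (T + \<nu> (space M)) / 2" by simp
  qed
  then show ?thesis
    using jordan[of "space M"] by (simp add: real measure_upper)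
next
  case MInf
  with abs_le_total_variation[of "{}" M \<nu>] empty show ?thesis by simp
qed simp

lemma (in bounded_signed_measure) abs_le_upper_lower:
  assumes "A \<in> sets M"
  shows "\<bar>\<nu> A\<bar> \<le> measure (upper_variation M \<nu>) A + measure (upper_variation M (\<lambda>A. - \<nu> A)) A"
  using jordan[OF assms] measure_nonneg[of "upper_variation M \<nu>" A]
    measure_nonneg[of "upper_variation M (\<lambda>A. - \<nu> A)" A] by linarith

subsection \<open>The Hlawka identity\<close>

lemma fubini_box:
  fixes N U :: "(real ^ 'd) measure"
  assumes "finite_measure N" "finite_measure U"
    and sets_N: "sets N = sets cube_borel" and sets_U: "sets U = sets cube_borel"
  shows "integrable N (\<lambda>t. measure U {t..1})" (is ?N)
    and "integrable U (\<lambda>s. measure N {0..s})" (is ?U)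
    and "(\<integral>t. measure U {t..1} \<partial>N) = (\<integral>s. measure N {0..s} \<partial>U)" (is ?eq)
proof -
  interpret N: finite_measure N by fact
  interpret U: finite_measure U by fact
  interpret pair_sigma_finite N U ..
  interpret P: finite_measure "N \<Otimes>\<^sub>M U"
    by (rule finite_measure_pair_measure) fact+
  have space_N: "space N = unit_cube" and space_U: "space U = unit_cube"
    using sets_eq_imp_space_eq[OF sets_N] sets_eq_imp_space_eq[OF sets_U]
    by (simp_all add: space_restrict_space)
  have [measurable]: "(\<lambda>x. x $ l) \<in> borel_measurable N" "(\<lambda>x. x $ l) \<in> borel_measurable U" for l
    unfolding measurable_cong_sets[OF sets_N refl] measurable_cong_sets[OF sets_U refl]
    by (rule measurable_nth_cube)+
  let ?F = "\<lambda>x. if fst x \<le> snd x then 1 else 0 :: real"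
  have meas: "?F \<in> borel_measurable (N \<Otimes>\<^sub>M U)"
    unfolding less_eq_vec_def by measurable
  have int: "integrable (N \<Otimes>\<^sub>M U) (\<lambda>(t, s). if t \<le> s then 1 else 0 :: real)"
    using P.integrable_const_bound[OF _ meas, of 1] by (simp add: case_prod_unfold)
  have 1: "(\<integral>s. (if t \<le> s then 1 else 0 :: real) \<partial>U) = measure U {t..1}" if "t \<in> space N" for t
  proof -
    have "(\<integral>s. (if t \<le> s then 1 else 0 :: real) \<partial>U) = (\<integral>s. indicat_real {t..1} s \<partial>U)"
      by (rule Bochner_Integration.integral_cong) (auto simp: space_U)
    also have "{t..1} \<inter> space U = {t..1}" using that by (auto simp: space_U space_N)
    then have "(\<integral>s. indicat_real {t..1} s \<partial>U) = measure U {t..1}" by simp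
    finally show ?thesis .
  qed
  have 2: "(\<integral>t. (if t \<le> s then 1 else 0 :: real) \<partial>N) = measure N {0..s}" if "s \<in> space U" for s
  proof -
    have "(\<integral>t. (if t \<le> s then 1 else 0 :: real) \<partial>N) = (\<integral>t. indicat_real {0..s} t \<partial>N)"
      by (rule Bochner_Integration.integral_cong) (auto simp: space_N)
    also have "{0..s} \<inter> space N = {0..s}" using that by (auto simp: space_U space_N intro: order_trans)
    then have "(\<integral>t. indicat_real {0..s} t \<partial>N) = measure N {0..s}" by simp
    finally show ?thesis .
  qed
  show ?N using integrable_fst'[OF int] by (simp add: 1 cong: Bochner_Integration.integrable_cong)
  show ?U using integrable_snd[OF int] by (simp add: 2 cong: Bochner_Integration.integrable_cong)
  show ?eq using Fubini_integral[OF int] by (simp add: 1 2 cong: Bochner_Integration.integral_cong)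
qed

lemma integral_empirical_box:
  fixes U :: "(real ^ 'd) measure"
  assumes "finite_measure U" and sets_U: "sets U = sets cube_borel"
    and "\<And>z. z \<in> set zs \<Longrightarrow> T z \<in> unit_cube"
  shows "integrable U (\<lambda>s. \<Sum>z\<leftarrow>zs. indicat_real {0..s} (T z))"
    and "(\<integral>s. (\<Sum>z\<leftarrow>zs. indicat_real {0..s} (T z)) \<partial>U) = (\<Sum>z\<leftarrow>zs. measure U {T z..1})"
proof -
  interpret finite_measure U by fact
  have space_U: "space U = unit_cube"
    using sets_eq_imp_space_eq[OF sets_U] by (simp add: space_restrict_space)
  have point: "integrable U (\<lambda>s. indicat_real {0..s} x)"
    "(\<integral>s. indicat_real {0..s} x \<partial>U) = measure U {x..1}" if x: "x \<in> unit_cube" for x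
  proof -
    have eq: "indicat_real {0..s} x = indicat_real {x..1} s" if "s \<in> space U" for s
      using that x by (auto simp: indicator_def space_U)
    have box: "{x..1} \<in> sets U" unfolding sets_U using x by (intro box_sets_cube) auto
    then have "{x..1} \<inter> space U = {x..1}" by (auto dest: sets.sets_into_space)
    with box show "integrable U (\<lambda>s. indicat_real {0..s} x)"
      "(\<integral>s. indicat_real {0..s} x \<partial>U) = measure U {x..1}"
      by (simp_all add: eq less_top[symmetric] cong: Bochner_Integration.integrable_cong Bochner_Integration.integral_cong)
  qed
  have "integrable U (\<lambda>s. \<Sum>z\<leftarrow>zs. indicat_real {0..s} (T z)) \<and>
    (\<integral>s. (\<Sum>z\<leftarrow>zs. indicat_real {0..s} (T z)) \<partial>U) = (\<Sum>z\<leftarrow>zs. measure U {T z..1})"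
    using assms(3) by (induction zs) (simp_all add: point)
  then show "integrable U (\<lambda>s. \<Sum>z\<leftarrow>zs. indicat_real {0..s} (T z))"
    "(\<integral>s. (\<Sum>z\<leftarrow>zs. indicat_real {0..s} (T z)) \<partial>U) = (\<Sum>z\<leftarrow>zs. measure U {T z..1})"
    by blast+
qed

text \<open>For each Jordan part, Fubini turns the integral of the box discrepancy into a difference
  of means of the mass of [t,1]. The two parts differ by f t - f 1, and the constant cancels because
  the measure and the empirical mean are both normalized.\<close>

lemma hlawka_identity:
  fixes f :: "real ^ 'd \<Rightarrow> real"
  assumes "prob_space N" and sets_N: "sets N = sets cube_borel"
    and f: "f \<in> borel_measurable cube_borel" and V: "hk_variation f = ereal V"
    and \<nu>: "corresponding_signed_measure f \<nu>"
    and zs: "zs \<noteq> []" "\<And>z. z \<in> set zs \<Longrightarrow> T z \<in> unit_cube"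
  shows "(\<integral>x. f x \<partial>N) = empirical_mean zs (\<lambda>z. f (T z)) + signed_integral cube_borel \<nu>
     (\<lambda>t. measure N {0..t} - 1 / real (length zs) * (\<Sum>z\<leftarrow>zs. indicat_real {0..t} (T z)))"
proof -
  interpret prob_space N by fact
  have space_N: "space N = unit_cube"
    using sets_eq_imp_space_eq[OF sets_N] by (simp add: space_restrict_space)
  have \<nu>': "signed_measure cube_borel \<nu>" "\<And>t. t \<in> unit_cube \<Longrightarrow> f t = \<nu> {t..1} + f 1"
    "total_variation cube_borel \<nu> (space cube_borel) = ereal V"
    using \<nu> V by (auto simp: corresponding_signed_measure_def space_restrict_space)
  interpret \<nu>: bounded_signed_measure cube_borel \<nu> V
    by (rule bounded_signed_measureI[OF \<nu>'(1,3)])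
  interpret \<nu>m: bounded_signed_measure cube_borel "\<lambda>A. - \<nu> A" V
    by (rule \<nu>.uminus)
  let ?U = "upper_variation cube_borel \<nu>" and ?L = "upper_variation cube_borel (\<lambda>A. - \<nu> A)"
  let ?h = "\<lambda>t. measure N {0..t} - 1 / real (length zs) * (\<Sum>z\<leftarrow>zs. indicat_real {0..t} (T z))"
  have h: "(\<integral>t. ?h t \<partial>U) = (\<integral>t. measure U {t..1} \<partial>N) - empirical_mean zs (\<lambda>z. measure U {T z..1})"
    if U: "finite_measure U" "sets U = sets cube_borel" for U
    using fubini_box[OF finite_measure_axioms U(1) sets_N U(2)] integral_empirical_box[OF U, where zs = zs and T = T, OF zs(2)]
    by (simp add: empirical_mean_def)
  have f_diff: "f t - f 1 = measure ?U {t..1} - measure ?L {t..1}" if "t \<in> unit_cube" for t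
    using \<nu>'(2)[OF that] \<nu>.jordan[OF box_sets_cube[OF that one_in_cube]] by simp
  note UL = \<nu>.finite_measure_upper \<nu>m.finite_measure_upper \<nu>.sets_upper \<nu>m.sets_upper
  have "signed_integral cube_borel \<nu> ?h = (\<integral>t. ?h t \<partial>?U) - (\<integral>t. ?h t \<partial>?L)"
    by (simp add: signed_integral_def)
  also have "\<dots> = ((\<integral>t. measure ?U {t..1} \<partial>N) - (\<integral>t. measure ?L {t..1} \<partial>N)) -
      (empirical_mean zs (\<lambda>z. measure ?U {T z..1}) - empirical_mean zs (\<lambda>z. measure ?L {T z..1}))"
    unfolding h[OF UL(1,3)] h[OF UL(2,4)] by simp
  also have "(\<integral>t. measure ?U {t..1} \<partial>N) - (\<integral>t. measure ?L {t..1} \<partial>N) = (\<integral>t. f t - f 1 \<partial>N)"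
  proof -
    have "(\<integral>t. measure ?U {t..1} \<partial>N) - (\<integral>t. measure ?L {t..1} \<partial>N) =
        (\<integral>t. measure ?U {t..1} - measure ?L {t..1} \<partial>N)"
      by (rule Bochner_Integration.integral_diff[symmetric])
        (rule fubini_box(1)[OF finite_measure_axioms UL(1) sets_N UL(3)]
          fubini_box(1)[OF finite_measure_axioms UL(2) sets_N UL(4)])+
    also have "\<dots> = (\<integral>t. f t - f 1 \<partial>N)"
      by (rule Bochner_Integration.integral_cong) (use f_diff in \<open>simp_all add: space_N\<close>)
    finally show ?thesis .
  qed
  also have "\<dots> = (\<integral>t. f t \<partial>N) - f 1"
  proof -
    have "f \<in> borel_measurable N" using f unfolding measurable_cong_sets[OF sets_N refl] .
    then have "integrable N f"
      by (intro integrable_const_bound[of _ "V + \<bar>f 1\<bar>"])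
        (use hk_variation_bdd(2)[OF V] in \<open>auto simp: space_N\<close>)
    then show ?thesis by (simp add: prob_space)
  qed
  also have "empirical_mean zs (\<lambda>z. measure ?U {T z..1}) - empirical_mean zs (\<lambda>z. measure ?L {T z..1})
      = empirical_mean zs (\<lambda>z. f (T z)) - f 1"
  proof -
    have "empirical_mean zs (\<lambda>z. measure ?U {T z..1}) + f 1 =
        empirical_mean zs (\<lambda>z. measure ?U {T z..1} + f 1)"
      using zs(1) by (simp add: empirical_mean_add empirical_mean_const)
    also have "\<dots> = empirical_mean zs (\<lambda>z. f (T z) + measure ?L {T z..1})"
    proof (rule empirical_mean_cong)
      fix z assume "z \<in> set zs"
      from f_diff[OF zs(2)[OF this]]
      show "measure ?U {T z..1} + f 1 = f (T z) + measure ?L {T z..1}" by simp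
    qed
    finally show ?thesis by (simp add: empirical_mean_add)
  qed
  finally show ?thesis by simp
qed

subsection \<open>Variation is at most total variation\<close>

lemma partition_mono:
  assumes "(m, p) \<in> partitions J" "l \<in> J" "a \<le> b" "b \<le> m l"
  shows "p l a \<le> p l b"
  using assms(3,4)
proof (induction b rule: dec_induct)
  case (step b)
  then have "p l b \<le> p l (Suc b)" using assms(1,2) by (auto simp: partitions_def)
  with step show ?case by simp
qed simp

lemma partition_range:
  assumes "(m, p) \<in> partitions J" "l \<in> J" "a \<le> m l"
  shows "0 \<le> p l a" "p l a \<le> 1"
  using partition_mono[OF assms(1,2), of 0 a] partition_mono[OF assms(1,2), of a "m l"] assms
  by (auto simp: partitions_def)

text \<open>K collects the directions in which the box is cut off on the right. For K = {} it is a
  closed box reaching up to 1, whose measure is a value of f minus f 1; for K = J it is a half-open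
  cell. The sets between them serve the induction.\<close>

definition partition_box :: "'d set \<Rightarrow> ('d \<Rightarrow> nat \<Rightarrow> real) \<Rightarrow> 'd set \<Rightarrow> ('d \<Rightarrow> nat) \<Rightarrow> (real ^ 'd) set" where
  "partition_box J p K i = {x\<in>unit_cube. \<forall>l. if l \<in> J then p l (i l) \<le> x $ l \<and> (l \<in> K \<longrightarrow> x $ l < p l (Suc (i l)))
     else x $ l = 1}"

lemma partition_box_sets: "partition_box J p K i \<in> sets cube_borel"
proof -
  have "{x\<in>space cube_borel. \<forall>l. if l \<in> J then p l (i l) \<le> x $ l \<and> (l \<in> K \<longrightarrow> x $ l < p l (Suc (i l)))
     else x $ l = 1} \<in> sets cube_borel"
    by measurable
  then show ?thesis by (simp add: partition_box_def space_restrict_space)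
qed

text \<open>Cutting off one more direction removes the box with its index raised by one, which
  amounts to minus a difference operator.\<close>

lemma measure_partition_box:
  fixes f :: "real ^ 'd \<Rightarrow> real"
  assumes "bounded_signed_measure cube_borel \<nu> C"
    and f: "\<And>t. t \<in> unit_cube \<Longrightarrow> f t = \<nu> {t..1} + f 1"
    and p: "(m, p) \<in> partitions J" and "K \<subseteq> J"
    and "\<And>l. l \<in> J \<Longrightarrow> i l \<le> m l" and "\<And>l. l \<in> K \<Longrightarrow> i l < m l"
  shows "\<nu> (partition_box J p K i) = (-1) ^ card K * mixed_diff K (\<lambda>i. face f J (\<lambda>l. p l (i l)) - f 1) i"
proof -
  interpret bounded_signed_measure cube_borel \<nu> C by fact
  have "finite K" by simp
  then show ?thesis using assms(4-)
  proof (induction K arbitrary: i rule: finite_induct)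
    case empty
    define c where "c = (\<chi> l. if l \<in> J then p l (i l) else 1)"
    have c: "c \<in> unit_cube"
      using partition_range[OF p] empty by (auto simp: c_def less_eq_vec_def)
    have "partition_box J p {} i = {c..1}"
    proof (intro equalityI subsetI)
      fix x assume "x \<in> partition_box J p {} i"
      then have "x \<le> 1" "\<And>l. c $ l \<le> x $ l" by (auto simp: partition_box_def c_def)
      then show "x \<in> {c..1}" by (auto simp: less_eq_vec_def)
    next
      fix x assume x: "x \<in> {c..1}"
      then have "c $ l \<le> x $ l" "x $ l \<le> 1" for l by (auto simp: less_eq_vec_def)
      moreover have "x \<in> unit_cube" using c x by (auto intro: order_trans)
      ultimately show "x \<in> partition_box J p {} i"
        by (auto simp: partition_box_def c_def intro: antisym split: if_splits)
          (metis antisym)+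
    qed
    then show ?case using f[OF c] by (simp add: mixed_diff_empty face_def c_def)
  next
    case (insert k K)
    let ?H = "\<lambda>i. face f J (\<lambda>l. p l (i l)) - f 1"
    let ?B = "partition_box J p K"
    have k: "k \<in> J" "i k < m k" using insert.prems by auto
    then have pk: "p k (i k) \<le> p k (Suc (i k))" using p by (auto simp: partitions_def)
    have box: "partition_box J p (insert k K) i = ?B i - ?B (i(k := Suc (i k)))"
      using k insert.hyps unfolding partition_box_def by (auto split: if_splits)
    have sub: "?B (i(k := Suc (i k))) \<subseteq> ?B i"
    proof
      fix x assume "x \<in> ?B (i(k := Suc (i k)))"
      then have x: "x \<in> unit_cube" "\<And>l. if l \<in> J then p l ((i(k := Suc (i k))) l) \<le> x $ l \<and>
          (l \<in> K \<longrightarrow> x $ l < p l (Suc ((i(k := Suc (i k))) l))) else x $ l = 1"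
        unfolding partition_box_def by blast+
      have "if l \<in> J then p l (i l) \<le> x $ l \<and> (l \<in> K \<longrightarrow> x $ l < p l (Suc (i l))) else x $ l = 1" for l
        using x(2)[of l] k insert.hyps pk by (cases "l = k") auto
      with x(1) show "x \<in> ?B i" unfolding partition_box_def by blast
    qed
    have 1: "\<nu> (?B i) = (-1) ^ card K * mixed_diff K ?H i"
      by (rule insert.IH) (use insert.prems in auto)
    have 2: "\<nu> (?B (i(k := Suc (i k)))) = (-1) ^ card K * mixed_diff K ?H (i(k := Suc (i k)))"
      by (rule insert.IH) (use insert.prems insert.hyps(2) k Suc_leI[OF k(2)] in auto)
    show ?case
      unfolding box diff[OF partition_box_sets partition_box_sets sub] 1 2
      using insert.hyps by (simp add: mixed_diff_insert diff_op_def algebra_simps)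
  qed
qed

lemma face_sets: "{x\<in>unit_cube. {l. x $ l < 1} = J} \<in> sets cube_borel"
proof -
  have "{x\<in>space cube_borel. \<forall>l. x $ l < 1 \<longleftrightarrow> l \<in> J} \<in> sets cube_borel" by measurable
  moreover have "{x\<in>unit_cube. {l. x $ l < 1} = J} = {x\<in>space cube_borel. \<forall>l. x $ l < 1 \<longleftrightarrow> l \<in> J}"
    by (auto simp: space_restrict_space)
  ultimately show ?thesis by (simp only:)
qed

text \<open>The cells of a partition in J are disjoint and lie where exactly the coordinates in J
  are below 1. Bounding by the mass of that part alone lets the bounds for different J be added. U
  and L replace the absolute value of \<nu> by something additive over cells.\<close>

lemma vitali_variation_le:
  fixes f :: "real ^ 'd \<Rightarrow> real"
  assumes "bounded_signed_measure cube_borel \<nu> C"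
    and f: "\<And>t. t \<in> unit_cube \<Longrightarrow> f t = \<nu> {t..1} + f 1"
    and "finite_measure U" and sets_U: "sets U = sets cube_borel"
    and "finite_measure L" and sets_L: "sets L = sets cube_borel"
    and dom: "\<And>A. A \<in> sets cube_borel \<Longrightarrow> \<bar>\<nu> A\<bar> \<le> measure U A + measure L A" and "J \<noteq> {}"
  shows "vitali_variation f J \<le> ereal (measure U {x\<in>unit_cube. {l. x $ l < 1} = J} +
    measure L {x\<in>unit_cube. {l. x $ l < 1} = J})"
  unfolding vitali_variation_def
proof (rule SUP_least, clarify)
  interpret U: finite_measure U by fact
  interpret L: finite_measure L by fact
  fix m :: "'d \<Rightarrow> nat" and p assume p: "(m, p) \<in> partitions J"
  let ?I = "Pi\<^sub>E J (\<lambda>l. {1..<m l})" and ?B = "partition_box J p J"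
  have disj: "disjoint_family_on ?B ?I"
  proof -
    have "?B i \<inter> ?B j = {}" if "i \<in> ?I" "j \<in> ?I" "l \<in> J" "i l < j l" for i j l
    proof (rule ccontr)
      assume "?B i \<inter> ?B j \<noteq> {}"
      then obtain x where "x \<in> ?B i" "x \<in> ?B j" by blast
      then have "x $ l < p l (Suc (i l))" "p l (j l) \<le> x $ l"
        using \<open>l \<in> J\<close> unfolding partition_box_def by auto
      moreover have "p l (Suc (i l)) \<le> p l (j l)"
        using that by (intro partition_mono[OF p]) (auto simp: PiE_iff)
      ultimately show False by simp
    qed
    note * = this
    show ?thesis
      unfolding disjoint_family_on_def
    proof (intro ballI impI)
      fix i j assume ij: "i \<in> ?I" "j \<in> ?I" "i \<noteq> j"
      then obtain l where "l \<in> J" "i l \<noteq> j l" by (meson PiE_ext)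
      then show "?B i \<inter> ?B j = {}" using *[OF ij(1,2)] *[OF ij(2,1)] by (metis Int_commute neqE)
    qed
  qed
  have finI: "finite ?I" by (intro finite_PiE) auto
  let ?F = "{x\<in>unit_cube. {l. x $ l < 1} = J}"
  have box_le: "(\<Sum>i\<in>?I. measure W (?B i)) \<le> measure W ?F"
    if "finite_measure W" and sets_W: "sets W = sets cube_borel" for W
  proof -
    interpret W: finite_measure W by fact
    have "(\<Sum>i\<in>?I. measure W (?B i)) = measure W (\<Union>i\<in>?I. ?B i)"
      using finI disj partition_box_sets sets_W by (intro W.finite_measure_finite_Union[symmetric]) auto
    also have "\<dots> \<le> measure W ?F"
    proof (rule W.finite_measure_mono, rule UN_least)
      show "?F \<in> sets W" unfolding sets_W by (rule face_sets)
    fix i assume i: "i \<in> ?I"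
    show "?B i \<subseteq> {x\<in>unit_cube. {l. x $ l < 1} = J}"
    proof
      fix x assume x: "x \<in> ?B i"
      have "x $ l < 1 \<longleftrightarrow> l \<in> J" for l
      proof (cases "l \<in> J")
        case True
        then have "x $ l < p l (Suc (i l))" using x by (auto simp: partition_box_def)
        also have "\<dots> \<le> 1" using i True by (intro partition_range[OF p]) (auto simp: PiE_iff)
        finally show ?thesis using True by simp
      next
        case False
        then have "x $ l = 1" using x unfolding partition_box_def by auto
        then show ?thesis using False by simp
      qed
      moreover have "x \<in> unit_cube" using x by (simp add: partition_box_def)
      ultimately show "x \<in> {x\<in>unit_cube. {l. x $ l < 1} = J}" by auto
    qed
  qed
    finally show ?thesis .
  qed
  have "(\<Sum>i\<in>?I. \<bar>mixed_diff J (\<lambda>i. face f J (\<lambda>l. p l (i l))) i\<bar>) = (\<Sum>i\<in>?I. \<bar>\<nu> (?B i)\<bar>)"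
  proof (rule sum.cong)
    fix i assume i: "i \<in> ?I"
    have "\<nu> (?B i) = (-1) ^ card J * mixed_diff J (\<lambda>i. face f J (\<lambda>l. p l (i l)) - f 1) i"
      using assms(1) f p by (rule measure_partition_box) (use i in \<open>auto simp: PiE_iff\<close>)
    then show "\<bar>mixed_diff J (\<lambda>i. face f J (\<lambda>l. p l (i l))) i\<bar> = \<bar>\<nu> (?B i)\<bar>"
      using mixed_diff_minus_const[of J] \<open>J \<noteq> {}\<close> by (simp add: abs_mult power_abs)
  qed simp
  also have "\<dots> \<le> (\<Sum>i\<in>?I. measure U (?B i) + measure L (?B i))"
    by (intro sum_mono dom partition_box_sets)
  also have "\<dots> \<le> measure U ?F + measure L ?F"
    unfolding sum.distrib by (intro add_mono box_le assms)
  finally show "ereal (\<Sum>i\<in>?I. \<bar>mixed_diff J (\<lambda>i. face f J (\<lambda>l. p l (i l))) i\<bar>)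
      \<le> ereal (measure U ?F + measure L ?F)" by simp
qed

text \<open>The parts of the cube that belong to different J are disjoint; all of them together omit
  only the corner 1.\<close>

lemma hk_variation_le:
  fixes f :: "real ^ 'd \<Rightarrow> real"
  assumes "bounded_signed_measure cube_borel \<nu> C"
    and f: "\<And>t. t \<in> unit_cube \<Longrightarrow> f t = \<nu> {t..1} + f 1"
    and U: "finite_measure U" "sets U = sets cube_borel"
    and L: "finite_measure L" "sets L = sets cube_borel"
    and dom: "\<And>A. A \<in> sets cube_borel \<Longrightarrow> \<bar>\<nu> A\<bar> \<le> measure U A + measure L A"
  shows "hk_variation f \<le> ereal (measure U unit_cube + measure L unit_cube)"
proof -
  let ?F = "\<lambda>J. {x\<in>unit_cube. {l. x $ l < 1} = J}"
  have le: "(\<Sum>J\<in>{J. J \<noteq> {}}. measure W (?F J)) \<le> measure W unit_cube"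
    if "finite_measure W" and sets_W: "sets W = sets cube_borel" for W :: "(real ^ 'd) measure"
  proof -
    interpret W: finite_measure W by fact
    have "(\<Sum>J\<in>{J. J \<noteq> {}}. measure W (?F J)) = measure W (\<Union>J\<in>{J. J \<noteq> {}}. ?F J)"
      using face_sets sets_W
      by (intro W.finite_measure_finite_Union[symmetric]) (auto simp: disjoint_family_on_def)
    also have "\<dots> \<le> measure W unit_cube"
    proof (rule W.finite_measure_mono)
      show "unit_cube \<in> sets W" unfolding sets_W by (rule box_sets_cube[OF zero_in_cube one_in_cube])
    qed auto
    finally show ?thesis .
  qed
  have "hk_variation f \<le> (\<Sum>J\<in>{J. J \<noteq> {}}. ereal (measure U (?F J) + measure L (?F J)))"
    unfolding hk_variation_def
    by (rule sum_mono, rule vitali_variation_le[OF assms(1) f U L dom]) auto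
  also have "\<dots> = ereal ((\<Sum>J\<in>{J. J \<noteq> {}}. measure U (?F J)) + (\<Sum>J\<in>{J. J \<noteq> {}}. measure L (?F J)))"
    by (simp add: sum.distrib)
  also have "\<dots> \<le> ereal (measure U unit_cube + measure L unit_cube)"
    using le[OF U] le[OF L] by simp
  finally show ?thesis .
qed

lemma hk_variation_le_total_variation:
  fixes f :: "real ^ 'd \<Rightarrow> real"
  assumes "bounded_signed_measure cube_borel \<nu> C"
    and "\<And>t. t \<in> unit_cube \<Longrightarrow> f t = \<nu> {t..1} + f 1"
  shows "hk_variation f \<le> total_variation cube_borel \<nu> unit_cube"
proof -
  interpret \<nu>: bounded_signed_measure cube_borel \<nu> C by fact
  interpret m: bounded_signed_measure cube_borel "\<lambda>A. - \<nu> A" C by (rule \<nu>.uminus)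
  note hk_variation_le[OF assms \<nu>.finite_measure_upper \<nu>.sets_upper
      m.finite_measure_upper m.sets_upper \<nu>.abs_le_upper_lower]
  also have "space cube_borel = (unit_cube :: (real ^ 'd) set)" by (simp add: space_restrict_space)
  with \<nu>.upper_lower_le_total_variation
  have "ereal (measure (upper_variation cube_borel \<nu>) unit_cube +
      measure (upper_variation cube_borel (\<lambda>A. - \<nu> A)) unit_cube)
     \<le> total_variation cube_borel \<nu> unit_cube" by simp
  finally show ?thesis .
qed

subsection \<open>Dyadic grids\<close>

text \<open>Induction on the number of points strictly above x: the weights there already agree and
  cancel.\<close>

lemma moebius_unique:
  fixes u v :: "'a :: order \<Rightarrow> real"
  assumes "finite S"
    and eq: "\<And>x. x \<in> S \<Longrightarrow> (\<Sum>y\<in>{y\<in>S. x \<le> y}. u y) = (\<Sum>y\<in>{y\<in>S. x \<le> y}. v y)"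
    and "x \<in> S"
  shows "u x = v x"
  using \<open>x \<in> S\<close>
proof (induction "card {y\<in>S. x < y}" arbitrary: x rule: less_induct)
  case less
  have split: "(\<Sum>y\<in>{y\<in>S. x \<le> y}. g y) = g x + (\<Sum>y\<in>{y\<in>S. x < y}. g y)" for g :: "'a \<Rightarrow> real"
  proof -
    have "{y\<in>S. x \<le> y} = insert x {y\<in>S. x < y}" using less.prems by (auto simp: le_less)
    then show ?thesis using \<open>finite S\<close> by simp
  qed
  have "(\<Sum>y\<in>{y\<in>S. x < y}. u y) = (\<Sum>y\<in>{y\<in>S. x < y}. v y)"
  proof (rule sum.cong)
    fix y assume "y \<in> {y\<in>S. x < y}"
    then have "y \<in> S" "{z\<in>S. y < z} \<subset> {z\<in>S. x < z}" by auto
    then show "u y = v y"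
      using \<open>finite S\<close> by (intro less.hyps psubset_card_mono) auto
  qed simp
  then show ?case using eq[OF less.prems] by (simp add: split)
qed

definition dyadics :: "nat \<Rightarrow> real set" where
  "dyadics n = (\<lambda>k. real k / 2 ^ n) ` {..2 ^ n}"

definition dyadic_grid :: "nat \<Rightarrow> (real ^ 'd) set" where
  "dyadic_grid n = grid (\<lambda>_. dyadics n)"

text \<open>The lower corner of the dyadic cell of x. Coordinates equal to 1 stay at 1, so the
  points with such coordinates form lower-dimensional cells of their own.\<close>

definition round_down :: "nat \<Rightarrow> real ^ 'd \<Rightarrow> real ^ 'd" where
  "round_down n x = (\<chi> l. of_int \<lfloor>2 ^ n * x $ l\<rfloor> / 2 ^ n)"

lemma dyadicsE:
  assumes "a \<in> dyadics n"
  obtains k where "a = real k / 2 ^ n" "k \<le> 2 ^ n"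
  using assms by (auto simp: dyadics_def)

lemma dyadics_int: "of_int k / 2 ^ n \<in> dyadics n" if "0 \<le> k" "k \<le> 2 ^ n" for k :: int
proof -
  have "nat k \<le> 2 ^ n" using that(2) by (simp add: nat_le_iff)
  moreover have "real_of_int k = real (nat k)" using that(1) by (rule of_nat_nat[symmetric])
  ultimately show ?thesis unfolding dyadics_def image_iff by (metis atMost_iff)
qed

lemma dyadics_props: "finite (dyadics n)" "dyadics n \<subseteq> {0..1}" "1 \<in> dyadics n" "0 \<in> dyadics n"
proof -
  show "dyadics n \<subseteq> {0..1}"
  proof
    fix a assume "a \<in> dyadics n"
    then obtain k where k: "a = real k / 2 ^ n" "k \<le> 2 ^ n" by (rule dyadicsE)
    then have "real k \<le> 2 ^ n" using of_nat_mono[OF k(2), where 'a = real] by simp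
    then show "a \<in> {0..1}" using k by simp
  qed
  show "1 \<in> dyadics n" "0 \<in> dyadics n"
    using dyadics_int[of "2 ^ n" n] dyadics_int[of 0 n] by simp_all
qed (simp add: dyadics_def)

lemma dyadics_mono: "n \<le> m \<Longrightarrow> dyadics n \<subseteq> dyadics m"
proof
  fix a assume "n \<le> m" "a \<in> dyadics n"
  then obtain k where k: "a = real k / 2 ^ n" "k \<le> 2 ^ n" by (auto elim: dyadicsE)
  have "(2 :: nat) ^ m = 2 ^ n * 2 ^ (m - n)" "(2 :: real) ^ m = 2 ^ n * 2 ^ (m - n)"
    using \<open>n \<le> m\<close> by (simp_all flip: power_add)
  then show "a \<in> dyadics m"
    unfolding dyadics_def using k by (intro image_eqI[of _ _ "k * 2 ^ (m - n)"]) auto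
qed

lemma finite_dyadic_grid [simp]: "finite (dyadic_grid n)"
  unfolding dyadic_grid_def by (intro finite_grid dyadics_props)

lemma dyadic_grid_cube: "dyadic_grid n \<subseteq> unit_cube"
  using dyadics_props(2)[of n] by (fastforce simp: dyadic_grid_def grid_def less_eq_vec_def)

lemma dyadic_grid_mono: "n \<le> m \<Longrightarrow> dyadic_grid n \<subseteq> dyadic_grid m"
  using dyadics_mono[of n m] by (auto simp: dyadic_grid_def grid_def)

lemma round_down_grid:
  assumes "x \<in> unit_cube"
  shows "round_down n x \<in> dyadic_grid n"
proof -
  have "of_int \<lfloor>2 ^ n * x $ l\<rfloor> / 2 ^ n \<in> dyadics n" for l
  proof (rule dyadics_int)
    have x: "0 \<le> x $ l" "x $ l \<le> 1" using assms by (auto simp: less_eq_vec_def)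
    then show "0 \<le> \<lfloor>2 ^ n * x $ l\<rfloor>" by simp
    have "2 ^ n * x $ l \<le> 2 ^ n" using x by simp
    then have "2 ^ n * x $ l < real_of_int (2 ^ n) + 1" unfolding of_int_power of_int_numeral by linarith
    then show "\<lfloor>2 ^ n * x $ l\<rfloor> \<le> 2 ^ n" unfolding floor_le_iff .
  qed
  then show ?thesis by (simp add: round_down_def dyadic_grid_def grid_def)
qed

lemma round_down_dyadic: "y \<in> dyadic_grid m \<Longrightarrow> round_down n y \<in> dyadic_grid n"
  using dyadic_grid_cube by (intro round_down_grid) blast

text \<open>An adjunction between rounding and the inclusion of the grid. Up-sets of a coarse grid
  pull back to up-sets of finer grids, which makes weights on different levels comparable.\<close>

lemma le_round_down_iff:
  assumes "x \<in> dyadic_grid n"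
  shows "x \<le> round_down n y \<longleftrightarrow> x \<le> y"
proof -
  have "x $ l \<le> round_down n y $ l \<longleftrightarrow> x $ l \<le> y $ l" for l
  proof -
    obtain k where k: "x $ l = real k / 2 ^ n"
      using assms by (auto simp: dyadic_grid_def grid_def elim: dyadicsE)
    have "x $ l \<le> round_down n y $ l \<longleftrightarrow> real_of_int (int k) \<le> of_int \<lfloor>2 ^ n * y $ l\<rfloor>"
      by (simp add: k round_down_def divide_le_cancel)
    also have "\<dots> \<longleftrightarrow> real k \<le> 2 ^ n * y $ l"
      unfolding of_int_le_iff le_floor_iff by simp
    also have "\<dots> \<longleftrightarrow> x $ l \<le> y $ l" by (simp add: k field_simps)
    finally show ?thesis .
  qed
  then show ?thesis by (simp add: less_eq_vec_def)
qed

lemma round_down_bounds: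
  "round_down n x $ l \<le> x $ l" "x $ l \<le> round_down n x $ l + 1 / 2 ^ n"
proof -
  have "of_int \<lfloor>2 ^ n * x $ l\<rfloor> \<le> 2 ^ n * x $ l" "2 ^ n * x $ l \<le> of_int \<lfloor>2 ^ n * x $ l\<rfloor> + 1"
    by linarith+
  then show "round_down n x $ l \<le> x $ l" "x $ l \<le> round_down n x $ l + 1 / 2 ^ n"
    by (simp_all add: round_down_def field_simps)
qed

lemma round_down_round_down:
  assumes "n \<le> m" "x \<in> unit_cube"
  shows "round_down n (round_down m x) = round_down n x"
proof -
  have rm: "round_down m x \<in> unit_cube"
    using round_down_grid[OF assms(2)] dyadic_grid_cube by blast
  have "z \<le> round_down n (round_down m x) \<longleftrightarrow> z \<le> round_down n x" if z: "z \<in> dyadic_grid n" for z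
  proof -
    have "z \<in> dyadic_grid m" using z dyadic_grid_mono[OF assms(1)] by blast
    then show ?thesis by (simp only: le_round_down_iff z)
  qed
  from this[OF round_down_grid[OF rm]] this[OF round_down_grid[OF assms(2)]]
  show ?thesis by (intro antisym) auto
qed

lemma round_down_round_down_dyadic:
  "n \<le> m \<Longrightarrow> x \<in> dyadic_grid k \<Longrightarrow> round_down n (round_down m x) = round_down n x"
  using dyadic_grid_cube by (intro round_down_round_down) blast+

lemma measurable_round_down [measurable]: "round_down n \<in> borel_measurable borel"
proof (subst borel_measurable_euclidean_space, rule ballI)
  fix b :: "real ^ 'a" assume "b \<in> Basis"
  then obtain l where "b = axis l 1" by (auto simp: Basis_vec_def)
  then have "(\<lambda>x. round_down n x \<bullet> b) = (\<lambda>x. of_int \<lfloor>2 ^ n * x $ l\<rfloor> / 2 ^ n)"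
    by (simp add: round_down_def inner_axis fun_eq_iff)
  then show "(\<lambda>x. round_down n x \<bullet> b) \<in> borel_measurable borel" by simp
qed

text \<open>A finitely additive set function on dyadic cells, each cell being represented by its
  lower corner.\<close>

definition consistent :: "(nat \<Rightarrow> real ^ 'd \<Rightarrow> real) \<Rightarrow> bool" where
  "consistent w \<longleftrightarrow> (\<forall>n m x. n \<le> m \<longrightarrow> x \<in> dyadic_grid n \<longrightarrow>
     (\<Sum>y\<in>{y\<in>dyadic_grid m. round_down n y = x}. w m y) = w n x)"

lemma sum_fibres:
  fixes g :: "real ^ 'd \<Rightarrow> real"
  assumes "A \<subseteq> dyadic_grid n"
  shows "(\<Sum>x\<in>A. \<Sum>y\<in>{y\<in>dyadic_grid m. round_down n y = x}. g y)
    = (\<Sum>y\<in>{y\<in>dyadic_grid m. round_down n y \<in> A}. g y)"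
proof -
  have "finite A" using assms by (rule finite_subset) simp
  let ?S = "{y\<in>dyadic_grid m. round_down n y \<in> A}"
  have "(\<Sum>x\<in>A. \<Sum>y\<in>{y\<in>?S. round_down n y = x}. g y) = (\<Sum>y\<in>?S. g y)"
    using \<open>finite A\<close> by (intro sum.group) auto
  moreover have "{y\<in>?S. round_down n y = x} = {y\<in>dyadic_grid m. round_down n y = x}" if "x \<in> A" for x
    using that by auto
  ultimately show ?thesis by simp
qed

lemma consistent_sum:
  assumes "consistent w" "n \<le> m" "A \<subseteq> dyadic_grid n"
  shows "(\<Sum>y\<in>{y\<in>dyadic_grid m. round_down n y \<in> A}. w m y) = (\<Sum>x\<in>A. w n x)"
  unfolding sum_fibres[OF assms(3), symmetric]
  using assms by (intro sum.cong) (auto simp: consistent_def)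

lemma consistent_sum_ge:
  assumes "consistent w" "n \<le> m" "x \<in> dyadic_grid n"
  shows "(\<Sum>y\<in>{y\<in>dyadic_grid m. x \<le> y}. w m y) = (\<Sum>y\<in>{y\<in>dyadic_grid n. x \<le> y}. w n y)"
proof -
  have "{y\<in>dyadic_grid m. round_down n y \<in> {y\<in>dyadic_grid n. x \<le> y}} = {y\<in>dyadic_grid m. x \<le> y}"
    using round_down_dyadic[of _ m n] le_round_down_iff[OF assms(3)] by auto
  then show ?thesis
    using consistent_sum[OF assms(1,2), of "{y\<in>dyadic_grid n. x \<le> y}"] by simp
qed

text \<open>Both levels reproduce f on the coarse grid, so the collected fine weights and the coarse
  weights have equal sums over up-sets, and Moebius inversion is unique.\<close>

lemma moebius_consistent:
  assumes "\<And>n x. x \<in> dyadic_grid n \<Longrightarrow> f x = f 1 + (\<Sum>y\<in>{y\<in>dyadic_grid n. x \<le> y}. w n y)"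
  shows "consistent w"
  unfolding consistent_def
proof (intro allI impI)
  fix n m :: nat and x :: "real ^ 'a"
  assume "n \<le> m" "x \<in> dyadic_grid n"
  show "(\<Sum>y\<in>{y\<in>dyadic_grid m. round_down n y = x}. w m y) = w n x"
  proof (rule moebius_unique[where S = "dyadic_grid n"])
    fix x :: "real ^ 'a" assume x: "x \<in> dyadic_grid n"
    have "{y\<in>dyadic_grid m. round_down n y \<in> {y\<in>dyadic_grid n. x \<le> y}} = {y\<in>dyadic_grid m. x \<le> y}"
      using round_down_dyadic[of _ m n] le_round_down_iff[OF x] by auto
    then have "(\<Sum>z\<in>{z\<in>dyadic_grid n. x \<le> z}. \<Sum>y\<in>{y\<in>dyadic_grid m. round_down n y = z}. w m y)
        = (\<Sum>y\<in>{y\<in>dyadic_grid m. x \<le> y}. w m y)"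
      using sum_fibres[where A = "{z\<in>dyadic_grid n. x \<le> z}" and n = n and m = m and g = "w m"] by simp
    also have "\<dots> = (\<Sum>y\<in>{y\<in>dyadic_grid n. x \<le> y}. w n y)"
    proof -
      have "x \<in> dyadic_grid m" using x dyadic_grid_mono[OF \<open>n \<le> m\<close>] by blast
      from assms[OF this] assms[OF x] show ?thesis by simp
    qed
    finally show "(\<Sum>z\<in>{z\<in>dyadic_grid n. x \<le> z}. \<Sum>y\<in>{y\<in>dyadic_grid m. round_down n y = z}. w m y)
        = (\<Sum>y\<in>{y\<in>dyadic_grid n. x \<le> y}. w n y)" .
  qed (use \<open>x \<in> dyadic_grid n\<close> in simp_all)
qed

text \<open>The positive parts of \<open>w n\<close> are in general not consistent, because masses
  of opposite sign cancel in coarser cells. The absolute mass of a cell, computed on level m,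
  increases with m. Its limit Q is consistent and dominates the absolute value of w; the parts are
  (Q + w) / 2 and (Q - w) / 2, with sum Q.\<close>

lemma consistent_jordan:
  fixes w :: "nat \<Rightarrow> real ^ 'd \<Rightarrow> real"
  assumes w: "consistent w" and V: "\<And>n. (\<Sum>x\<in>dyadic_grid n. \<bar>w n x\<bar>) \<le> V"
  obtains P N where "consistent P" "consistent N"
    "\<And>n x. x \<in> dyadic_grid n \<Longrightarrow> 0 \<le> P n x" "\<And>n x. x \<in> dyadic_grid n \<Longrightarrow> 0 \<le> N n x"
    "\<And>n x. w n x = P n x - N n x"
    "(\<Sum>x\<in>dyadic_grid 0. P 0 x) + (\<Sum>x\<in>dyadic_grid 0. N 0 x) \<le> V"
proof -
  define a where "a n m x = (\<Sum>y\<in>{y\<in>dyadic_grid m. round_down n y = x}. \<bar>w m y\<bar>)" for n m x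
  define Q where "Q n x = lim (\<lambda>m. a n m x)" for n x
  have a_le: "a n m x \<le> V" for n m x
  proof -
    have "a n m x \<le> (\<Sum>y\<in>dyadic_grid m. \<bar>w m y\<bar>)"
      unfolding a_def by (intro sum_mono2) auto
    with V[of m] show ?thesis by simp
  qed
  have a_sum: "(\<Sum>y\<in>{y\<in>dyadic_grid m. round_down n y = x}. a m k y) = a n k x"
    if "n \<le> m" "m \<le> k" for n m k x
  proof -
    have "{y\<in>dyadic_grid k. round_down m y \<in> {y\<in>dyadic_grid m. round_down n y = x}}
        = {y\<in>dyadic_grid k. round_down n y = x}"
      using round_down_dyadic[of _ k m] round_down_round_down_dyadic[OF \<open>n \<le> m\<close>, of _ k] by auto
    then show ?thesis
      unfolding a_def by (subst sum_fibres) auto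
  qed
  have a_ge: "\<bar>w m y\<bar> \<le> a m k y" if "m \<le> k" "y \<in> dyadic_grid m" for m k y
  proof -
    have "w m y = (\<Sum>z\<in>{z\<in>dyadic_grid k. round_down m z = y}. w k z)"
      using w that by (simp add: consistent_def)
    then show ?thesis unfolding a_def by (metis sum_abs)
  qed
  have a_mono: "a n m x \<le> a n k x" if "n \<le> m" "m \<le> k" for n m k x
  proof -
    have "a n m x \<le> (\<Sum>y\<in>{y\<in>dyadic_grid m. round_down n y = x}. a m k y)"
      unfolding a_def[of n m] using that(2) by (intro sum_mono a_ge) auto
    then show ?thesis unfolding a_sum[OF that] .
  qed
  have a_lim: "(\<lambda>m. a n m x) \<longlonglongrightarrow> Q n x" for n x
  proof -
    \<comment> \<open>Monotonicity starts at m = n, hence the shift.\<close>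
    have "incseq (\<lambda>m. a n (m + n) x)" by (intro incseq_SucI a_mono) auto
    then have "convergent (\<lambda>m. a n (m + n) x)"
      using a_le by (intro Bseq_mono_convergent BseqI'[of _ "V"])
        (auto simp: incseq_def a_def sum_nonneg)
    then have "convergent (\<lambda>m. a n m x)"
      unfolding convergent_def using LIMSEQ_offset[of "\<lambda>m. a n m x" n] by blast
    then show ?thesis unfolding Q_def by (simp add: convergent_LIMSEQ_iff)
  qed
  have Q: "consistent Q"
    unfolding consistent_def
  proof (intro allI impI)
    fix n m :: nat and x :: "real ^ 'd"
    assume "n \<le> m"
    have "(\<lambda>k. \<Sum>y\<in>{y\<in>dyadic_grid m. round_down n y = x}. a m k y)
        \<longlonglongrightarrow> (\<Sum>y\<in>{y\<in>dyadic_grid m. round_down n y = x}. Q m y)"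
      by (intro tendsto_sum a_lim)
    moreover have "\<forall>\<^sub>F k in sequentially. (\<Sum>y\<in>{y\<in>dyadic_grid m. round_down n y = x}. a m k y) = a n k x"
      using eventually_ge_at_top[of m] by eventually_elim (rule a_sum[OF \<open>n \<le> m\<close>])
    ultimately have "(\<lambda>k. a n k x) \<longlonglongrightarrow> (\<Sum>y\<in>{y\<in>dyadic_grid m. round_down n y = x}. Q m y)"
      by (simp add: tendsto_cong)
    with a_lim[of n x] show "(\<Sum>y\<in>{y\<in>dyadic_grid m. round_down n y = x}. Q m y) = Q n x"
      by (rule LIMSEQ_unique[symmetric])
  qed
  have Q_ge: "\<bar>w n x\<bar> \<le> Q n x" if "x \<in> dyadic_grid n" for n x
    using a_lim by (rule LIMSEQ_le_const) (use a_ge that in blast)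
  have "(\<Sum>x\<in>dyadic_grid 0. Q 0 x) \<le> V"
  proof (rule LIMSEQ_le_const2)
    show "(\<lambda>k. \<Sum>x\<in>dyadic_grid 0. a 0 k x) \<longlonglongrightarrow> (\<Sum>x\<in>dyadic_grid 0. Q 0 x)"
      by (intro tendsto_sum a_lim)
    have "(\<Sum>x\<in>dyadic_grid 0. a 0 k x) \<le> V" for k
    proof -
      have "(\<Sum>x\<in>dyadic_grid 0. a 0 k x) =
          (\<Sum>y\<in>{y\<in>dyadic_grid k. round_down 0 y \<in> dyadic_grid 0}. \<bar>w k y\<bar>)"
        unfolding a_def by (intro sum_fibres) simp
      also have "\<dots> \<le> (\<Sum>y\<in>dyadic_grid k. \<bar>w k y\<bar>)" by (intro sum_mono2) auto
      finally show ?thesis using V[of k] by simp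
    qed
    then show "\<exists>K. \<forall>k\<ge>K. (\<Sum>x\<in>dyadic_grid 0. a 0 k x) \<le> V" by blast
  qed
  then have total: "(\<Sum>x\<in>dyadic_grid 0. (Q 0 x + w 0 x) / 2) + (\<Sum>x\<in>dyadic_grid 0. (Q 0 x - w 0 x) / 2) \<le> V"
    by (simp add: sum_subtractf sum.distrib sum_divide_distrib[symmetric] field_simps)
  show ?thesis
  proof (rule that[of "\<lambda>n x. (Q n x + w n x) / 2" "\<lambda>n x. (Q n x - w n x) / 2"])
    show "consistent (\<lambda>n x. (Q n x + w n x) / 2)" "consistent (\<lambda>n x. (Q n x - w n x) / 2)"
      using Q w unfolding consistent_def
      by (simp_all add: sum_divide_distrib[symmetric] sum.distrib sum_subtractf)
  next
    fix n and x :: "real ^ 'd" assume "x \<in> dyadic_grid n"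
    from Q_ge[OF this] have "0 \<le> Q n x + w n x" "0 \<le> Q n x - w n x" by (simp_all add: abs_le_iff)
    then show "0 \<le> (Q n x + w n x) / 2" "0 \<le> (Q n x - w n x) / 2" by simp_all
  qed (use total in \<open>simp_all add: field_simps\<close>)
qed

subsection \<open>Measures with prescribed dyadic masses\<close>

lemma round_down_id: "x \<in> dyadic_grid n \<Longrightarrow> round_down n x = x"
proof (rule antisym)
  show "round_down n x \<le> x" by (simp add: less_eq_vec_def round_down_bounds)
  show "x \<le> round_down n x" if "x \<in> dyadic_grid n" using le_round_down_iff[OF that] by simp
qed

lemma consistent_total:
  fixes P :: "nat \<Rightarrow> real ^ 'd \<Rightarrow> real"
  assumes "consistent P"
  shows "(\<Sum>x\<in>dyadic_grid n. P n x) = (\<Sum>x\<in>dyadic_grid 0. P 0 x)"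
proof -
  have "{y\<in>dyadic_grid n. round_down 0 y \<in> dyadic_grid 0} = (dyadic_grid n :: (real ^ 'd) set)"
    using round_down_dyadic by blast
  then show ?thesis using consistent_sum[OF assms, of 0 n "dyadic_grid 0"] by simp
qed

text \<open>A finite set J of levels is served by its largest one, from which the coarser positions
  are read off by rounding. Consistency of P makes these laws projective.\<close>

lemma consistent_path_space:
  fixes P :: "nat \<Rightarrow> real ^ 'd \<Rightarrow> real"
  assumes P: "consistent P" and nonneg: "\<And>n x. x \<in> dyadic_grid n \<Longrightarrow> 0 \<le> P n x"
    and total: "(\<Sum>x\<in>dyadic_grid 0. P 0 x) = 1"
  obtains \<Omega> :: "(nat \<Rightarrow> real ^ 'd) measure" where "prob_space \<Omega>"
    "\<And>n. (\<lambda>\<omega>. \<omega> n) \<in> borel_measurable \<Omega>"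
    "\<And>n A. A \<in> sets borel \<Longrightarrow> measure \<Omega> {\<omega>\<in>space \<Omega>. \<omega> n \<in> A} = (\<Sum>y\<in>dyadic_grid n \<inter> A. P n y)"
    "AE \<omega> in \<Omega>. \<forall>n m. n \<le> m \<longrightarrow> \<omega> n = round_down n (\<omega> m) \<and> \<omega> n \<in> dyadic_grid n"
proof -
  define p where "p n = embed_pmf (\<lambda>x. if x \<in> dyadic_grid n then P n x else 0)" for n
  have pmf_p: "pmf (p n) x = (if x \<in> dyadic_grid n then P n x else 0)" for n x
    unfolding p_def
  proof (rule pmf_embed_pmf)
    have "(\<integral>\<^sup>+ x. ennreal (if x \<in> dyadic_grid n then P n x else 0) \<partial>count_space UNIV)
        = (\<Sum>x\<in>dyadic_grid n. ennreal (if x \<in> dyadic_grid n then P n x else 0))"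
      by (rule nn_integral_count_space') auto
    also have "\<dots> = ennreal (\<Sum>x\<in>dyadic_grid n. P n x)"
      using nonneg by (simp cong: sum.cong)
    finally show "(\<integral>\<^sup>+ x. ennreal (if x \<in> dyadic_grid n then P n x else 0) \<partial>count_space UNIV) = 1"
      by (simp only: consistent_total[OF P, of n] total ennreal_1)
  qed (simp add: nonneg)
  have set_p: "set_pmf (p n) \<subseteq> dyadic_grid n" for n
    by (auto simp: set_pmf_iff pmf_p split: if_splits)
  have measure_p: "measure (measure_pmf (p n)) A = (\<Sum>y\<in>dyadic_grid n \<inter> A. P n y)" for n A
  proof -
    have "A \<inter> set_pmf (p n) = (dyadic_grid n \<inter> A) \<inter> set_pmf (p n)" using set_p by blast
    then have "measure (measure_pmf (p n)) A = measure (measure_pmf (p n)) (dyadic_grid n \<inter> A)"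
      by (metis measure_Int_set_pmf)
    also have "\<dots> = (\<Sum>y\<in>dyadic_grid n \<inter> A. P n y)"
      by (subst measure_measure_pmf_finite) (auto simp: pmf_p)
    finally show ?thesis .
  qed
  have map_p: "map_pmf (round_down n) (p m) = p n" if "n \<le> m" for n m
  proof (rule pmf_eqI)
    fix x
    have "pmf (map_pmf (round_down n) (p m)) x = (\<Sum>y\<in>{y\<in>dyadic_grid m. round_down n y = x}. P m y)"
      unfolding pmf_map measure_p by (rule sum.cong) auto
    also have "\<dots> = pmf (p n) x"
    proof (cases "x \<in> dyadic_grid n")
      case True
      then show ?thesis using P that by (simp add: consistent_def pmf_p)
    next
      case False
      then have "{y\<in>dyadic_grid m. round_down n y = x} = {}" using round_down_dyadic by blast
      then show ?thesis using False by (simp only: pmf_p sum.empty if_False)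
    qed
    finally show "pmf (map_pmf (round_down n) (p m)) x = pmf (p n) x" .
  qed
  \<comment> \<open>Inserting 0 gives the empty set a maximum.\<close>
  define mx where "mx J = Max (insert 0 J)" for J :: "nat set"
  define Q where "Q J = distr (measure_pmf (p (mx J))) (PiM J (\<lambda>_. borel)) (\<lambda>x. \<lambda>j\<in>J. round_down j x)" for J
  have meas_J: "(\<lambda>x. \<lambda>j\<in>J. round_down j x) \<in> measure_pmf q \<rightarrow>\<^sub>M PiM J (\<lambda>_. borel)"
    for J and q :: "(real ^ 'd) pmf"
    by (rule measurable_restrict) simp
  interpret pp: polish_projective UNIV Q
  proof (rule polish_projective.intro, rule projective_family.intro)
    fix J H :: "nat set" assume JH: "J \<subseteq> H" "finite H"
    have le: "mx J \<le> mx H" unfolding mx_def using JH by (intro Max_mono) (auto intro: finite_subset)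
    have fJ: "finite J" using JH finite_subset by blast
    have r: "(\<lambda>f. restrict f J) \<in> PiM H (\<lambda>_. borel) \<rightarrow>\<^sub>M PiM J (\<lambda>_. borel :: (real ^ 'd) measure)"
      using JH(1) by (rule measurable_restrict_subset)
    have "distr (Q H) (PiM J (\<lambda>_. borel)) (\<lambda>f. restrict f J) =
        distr (measure_pmf (p (mx H))) (PiM J (\<lambda>_. borel)) (\<lambda>x. \<lambda>j\<in>J. round_down j x)"
      unfolding Q_def using JH(1)
      by (subst distr_distr[OF r meas_J]) (auto simp: comp_def restrict_restrict Int_absorb1)
    \<comment> \<open>On the support, rounding through the level \<open>mx J\<close> changes
      nothing, so only the image of the law on that level matters, and this is
      \<open>p (mx J)\<close>.\<close>
    also have "\<dots> = distr (measure_pmf (p (mx H))) (PiM J (\<lambda>_. borel)) (\<lambda>x. \<lambda>j\<in>J. round_down j (round_down (mx J) x))"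
    proof (rule distr_cong_AE)
      show "AE x in measure_pmf (p (mx H)). (\<lambda>j\<in>J. round_down j x) = (\<lambda>j\<in>J. round_down j (round_down (mx J) x))"
      proof (rule AE_pmfI)
        fix x assume "x \<in> set_pmf (p (mx H))"
        then have "x \<in> dyadic_grid (mx H)" using set_p by blast
        moreover have "j \<le> mx J" if "j \<in> J" for j using that fJ by (simp add: mx_def)
        ultimately show "(\<lambda>j\<in>J. round_down j x) = (\<lambda>j\<in>J. round_down j (round_down (mx J) x))"
          by (simp add: round_down_round_down_dyadic cong: restrict_cong)
      qed
    qed (rule refl | rule measurable_restrict, simp)+
    also have "\<dots> = distr (distr (measure_pmf (p (mx H))) (count_space UNIV) (round_down (mx J)))
        (PiM J (\<lambda>_. borel)) (\<lambda>x. \<lambda>j\<in>J. round_down j x)"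
    proof (subst distr_distr)
      show "(\<lambda>x. \<lambda>j\<in>J. round_down j x) \<in> count_space UNIV \<rightarrow>\<^sub>M PiM J (\<lambda>_. borel)"
        by (rule measurable_restrict) simp
    qed (simp_all add: comp_def)
    also have "\<dots> = Q J"
      unfolding Q_def map_pmf_rep_eq[symmetric] map_p[OF le] ..
    finally show "Q J = distr (Q H) (PiM J (\<lambda>_. borel)) (\<lambda>f. restrict f J)" ..
  next
    fix J :: "nat set"
    show "prob_space (Q J)" unfolding Q_def by (rule measure_pmf.prob_space_distr[OF meas_J])
  qed
  have joint: "measure pp.lim {\<omega>\<in>space pp.lim. R (restrict \<omega> J)} =
      measure (measure_pmf (p (mx J))) {x. R (\<lambda>j\<in>J. round_down j x)}"
    if "finite J" and R: "{f\<in>space (PiM J (\<lambda>_. borel)). R f} \<in> sets (PiM J (\<lambda>_. borel))" for J R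
  proof -
    have "{\<omega>\<in>space pp.lim. R (restrict \<omega> J)} = prod_emb UNIV (\<lambda>_. borel) J {f\<in>space (PiM J (\<lambda>_. borel)). R f}"
      by (auto simp: prod_emb_def space_PiM)
    then have "measure pp.lim {\<omega>\<in>space pp.lim. R (restrict \<omega> J)} = measure (Q J) {f\<in>space (PiM J (\<lambda>_. borel)). R f}"
      using pp.measure_lim_emb[OF subset_UNIV that] by simp
    also have "\<dots> = measure (measure_pmf (p (mx J))) {x. R (\<lambda>j\<in>J. round_down j x)}"
      unfolding Q_def by (subst measure_distr[OF meas_J R]) (auto simp: space_PiM intro!: arg_cong[where f = "measure _"])
    finally show ?thesis .
  qed
  have meas_comp: "(\<lambda>\<omega>. \<omega> n) \<in> borel_measurable pp.lim" for n
    unfolding measurable_cong_sets[OF pp.sets_lim refl] by (rule measurable_component_singleton) simp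
  have marginal: "measure pp.lim {\<omega>\<in>space pp.lim. \<omega> n \<in> A} = (\<Sum>y\<in>dyadic_grid n \<inter> A. P n y)"
    if [measurable]: "A \<in> sets borel" for n A
  proof -
    have "{f\<in>space (PiM {n} (\<lambda>_. borel)). f n \<in> A} \<in> sets (PiM {n} (\<lambda>_. borel))" by measurable
    from joint[OF _ this] have "measure pp.lim {\<omega>\<in>space pp.lim. \<omega> n \<in> A} =
        measure (measure_pmf (p (mx {n}))) {x. round_down n x \<in> A}" by simp
    also have "\<dots> = (\<Sum>y\<in>dyadic_grid n \<inter> {x. round_down n x \<in> A}. P n y)"
      unfolding measure_p by (simp add: mx_def)
    also have "dyadic_grid n \<inter> {x. round_down n x \<in> A} = dyadic_grid n \<inter> A"
      by (auto simp: round_down_id)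
    finally show ?thesis .
  qed
  have ae: "AE \<omega> in pp.lim. \<omega> n = round_down n (\<omega> m) \<and> \<omega> n \<in> dyadic_grid n" if "n \<le> m" for n m
  proof -
    let ?R = "\<lambda>f :: nat \<Rightarrow> real ^ 'd. f n = round_down n (f m) \<and> f n \<in> dyadic_grid n"
    have [measurable]: "(dyadic_grid n :: (real ^ 'd) set) \<in> sets borel" by (intro borel_closed finite_imp_closed) simp
    have [measurable]: "(\<lambda>f. f n) \<in> borel_measurable (PiM {n, m} (\<lambda>_. borel :: (real ^ 'd) measure))"
      "(\<lambda>f. f m) \<in> borel_measurable (PiM {n, m} (\<lambda>_. borel :: (real ^ 'd) measure))"
      by (rule measurable_component_singleton, simp)+
    \<comment> \<open>Equality of two positions becomes membership of their difference in {0}, a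
      measurable condition.\<close>
    have 1: "(\<lambda>f. f n - round_down n (f m)) \<in> borel_measurable (PiM {n, m} (\<lambda>_. borel :: (real ^ 'd) measure))"
      by measurable
    have 2: "(\<lambda>f. f n) \<in> borel_measurable (PiM {n, m} (\<lambda>_. borel :: (real ^ 'd) measure))"
      by measurable
    have "{f\<in>space (PiM {n, m} (\<lambda>_. borel)). f n - round_down n (f m) \<in> {0} \<and> f n \<in> dyadic_grid n}
        \<in> sets (PiM {n, m} (\<lambda>_. borel :: (real ^ 'd) measure))"
      by (intro sets.sets_Collect_conj measurable_sets_Collect[OF 1] measurable_sets_Collect[OF 2]) simp_all
    then have "{f\<in>space (PiM {n, m} (\<lambda>_. borel)). ?R f} \<in> sets (PiM {n, m} (\<lambda>_. borel))"
      by simp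
    from joint[OF _ this] have "measure pp.lim {\<omega>\<in>space pp.lim. ?R \<omega>} =
        measure (measure_pmf (p (mx {n, m}))) {x. round_down n x = round_down n (round_down m x) \<and>
          round_down n x \<in> dyadic_grid n}" by simp
    also have "\<dots> = 1"
    proof (rule measure_pmf.prob_eq_1[THEN iffD2])
      show "AE x in measure_pmf (p (mx {n, m})). x \<in> {x. round_down n x = round_down n (round_down m x) \<and>
          round_down n x \<in> dyadic_grid n}"
      proof (rule AE_pmfI)
        fix x assume "x \<in> set_pmf (p (mx {n, m}))"
        then have "x \<in> dyadic_grid (mx {n, m})" using set_p by blast
        then show "x \<in> {x. round_down n x = round_down n (round_down m x) \<and> round_down n x \<in> dyadic_grid n}"
          by (simp add: round_down_round_down_dyadic[OF that] round_down_dyadic)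
      qed
    qed simp
    finally have "AE \<omega> in pp.lim. \<omega> \<in> {\<omega>\<in>space pp.lim. ?R \<omega>}" by (rule pp.P.AE_prob_1)
    then show ?thesis by eventually_elim blast
  qed
  have "AE \<omega> in pp.lim. \<forall>n m. n \<le> m \<longrightarrow> \<omega> n = round_down n (\<omega> m) \<and> \<omega> n \<in> dyadic_grid n"
    unfolding AE_all_countable using ae by (auto intro: AE_impI)
  with pp.P.prob_space_axioms meas_comp marginal show ?thesis by (rule that)
qed

lemma measurable_sets_mem: "f \<in> M \<rightarrow>\<^sub>M N \<Longrightarrow> A \<in> sets N \<Longrightarrow> {x\<in>space M. f x \<in> A} \<in> sets M"
  using measurable_sets[of f M N A] by (simp add: vimage_def Int_def conj_commute)

text \<open>Each coordinate increases and stays within 2^-n of its later values, so the limit lies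
  in the closed cell of level n, possibly on an upper side.\<close>

lemma path_limit:
  fixes \<omega> :: "nat \<Rightarrow> real ^ 'd"
  assumes "\<And>n m. n \<le> m \<Longrightarrow> \<omega> n = round_down n (\<omega> m)" and "\<And>n. \<omega> n \<in> dyadic_grid n"
  obtains x where "\<omega> \<longlonglongrightarrow> x" "x \<in> unit_cube"
    "\<And>n l. \<omega> n $ l \<le> x $ l" "\<And>n l. x $ l \<le> \<omega> n $ l + 1 / 2 ^ n"
proof -
  have range: "0 \<le> \<omega> n $ l" "\<omega> n $ l \<le> 1" for n l
    using assms(2)[of n] dyadic_grid_cube[of n] by (auto simp: less_eq_vec_def)
  have mono: "\<omega> n $ l \<le> \<omega> m $ l" "\<omega> m $ l \<le> \<omega> n $ l + 1 / 2 ^ n" if "n \<le> m" for n m l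
    using round_down_bounds[where n = n and x = "\<omega> m" and l = l] assms(1)[OF that] by simp_all
  have "\<exists>a. (\<lambda>n. \<omega> n $ l) \<longlonglongrightarrow> a" for l
  proof -
    have "incseq (\<lambda>n. \<omega> n $ l)" using mono(1) by (simp add: incseq_def)
    moreover have "\<forall>n. \<omega> n $ l \<le> 1" using range by simp
    ultimately show ?thesis by (rule incseq_convergent) blast
  qed
  then obtain a where a: "\<And>l. (\<lambda>n. \<omega> n $ l) \<longlonglongrightarrow> a l" by metis
  have "a l \<le> \<omega> n $ l + 1 / 2 ^ n" for n l
    using a[of l] by (rule LIMSEQ_le_const2) (use mono(2) in blast)
  moreover have "\<omega> n $ l \<le> a l" for n l
    using a[of l] by (rule LIMSEQ_le_const) (use mono(1) in blast)
  moreover have "0 \<le> a l" "a l \<le> 1" for l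
    using LIMSEQ_le_const[OF a[of l], of 0] LIMSEQ_le_const2[OF a[of l], of 1] range by blast+
  moreover have "\<omega> \<longlonglongrightarrow> (\<chi> l. a l)" by (rule vec_tendstoI) (simp add: a)
  ultimately show ?thesis
    using that[of "\<chi> l. a l"] by (simp add: less_eq_vec_def)
qed

text \<open>As the limit point x may lie on an upper side of a cell, t \<le> x does not yield that
  \<open>\<omega> n\<close> is above t. Relaxing the threshold by 2^-n admits all paths with t \<le>
  x, and every other path eventually leaves the relaxed sets.\<close>

lemma consistent_prob:
  fixes P :: "nat \<Rightarrow> real ^ 'd \<Rightarrow> real"
  assumes P: "consistent P" "\<And>n x. x \<in> dyadic_grid n \<Longrightarrow> 0 \<le> P n x"
    "(\<Sum>x\<in>dyadic_grid 0. P 0 x) = 1"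
  obtains \<mu> where "prob_space \<mu>" "sets \<mu> = sets cube_borel"
    "\<And>t. t \<in> unit_cube \<Longrightarrow>
      (\<lambda>n. \<Sum>y\<in>{y\<in>dyadic_grid n. \<forall>l. t $ l - 1 / 2 ^ n \<le> y $ l}. P n y) \<longlonglongrightarrow> measure \<mu> {t..1}"
proof (rule consistent_path_space[OF P])
  fix \<Omega> :: "(nat \<Rightarrow> real ^ 'd) measure"
  assume "prob_space \<Omega>" and meas [measurable]: "\<And>n. (\<lambda>\<omega>. \<omega> n) \<in> borel_measurable \<Omega>"
    and marginal: "\<And>n A. A \<in> sets borel \<Longrightarrow>
      measure \<Omega> {\<omega>\<in>space \<Omega>. \<omega> n \<in> A} = (\<Sum>y\<in>dyadic_grid n \<inter> A. P n y)"
    and ae: "AE \<omega> in \<Omega>. \<forall>n m. n \<le> m \<longrightarrow> \<omega> n = round_down n (\<omega> m) \<and> \<omega> n \<in> dyadic_grid n"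
  interpret prob_space \<Omega> by fact
  \<comment> \<open>The default 0 keeps X inside the cube everywhere; it concerns only a null set of
    paths.\<close>
  define X where "X \<omega> = (if lim \<omega> \<in> unit_cube then lim \<omega> else 0)" for \<omega> :: "nat \<Rightarrow> real ^ 'd"
  have lim_meas: "(\<lambda>\<omega>. lim \<omega>) \<in> borel_measurable \<Omega>"
    by (rule borel_measurable_lim_metric) (rule meas)
  have cube_meas: "(unit_cube :: (real ^ 'd) set) \<in> sets borel" by simp
  have "X \<in> borel_measurable \<Omega>"
    unfolding X_def by (rule measurable_If[OF lim_meas _ measurable_sets_mem[OF lim_meas cube_meas]]) simp
  then have X [measurable]: "X \<in> \<Omega> \<rightarrow>\<^sub>M cube_borel"
    by (rule measurable_restrict_space2[rotated]) (auto simp: X_def less_eq_vec_def)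
  show ?thesis
  proof (rule that)
    show "prob_space (distr \<Omega> cube_borel X)" by (rule prob_space_distr[OF X])
    fix t :: "real ^ 'd" assume t: "t \<in> unit_cube"
    let ?A = "\<lambda>n. {y :: real ^ 'd. \<forall>l. t $ l - 1 / 2 ^ n \<le> y $ l}"
    have A_sets: "?A n \<in> sets borel" for n
    proof -
      have "?A n = {(\<chi> l. t $ l - 1 / 2 ^ n)..}" by (auto simp: less_eq_vec_def)
      then show ?thesis by simp
    qed
    have An: "{\<omega>\<in>space \<Omega>. \<omega> n \<in> ?A n} \<in> sets \<Omega>" for n
      by (rule measurable_sets_mem[OF meas A_sets])
    have B: "{\<omega>\<in>space \<Omega>. X \<omega> \<in> {t..1}} \<in> sets \<Omega>"
      by (rule measurable_sets_mem[OF X box_sets_cube[OF t one_in_cube]])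
    have "(\<lambda>n. \<integral>\<omega>. indicat_real {\<omega>\<in>space \<Omega>. \<omega> n \<in> ?A n} \<omega> \<partial>\<Omega>)
        \<longlonglongrightarrow> (\<integral>\<omega>. indicat_real {\<omega>\<in>space \<Omega>. X \<omega> \<in> {t..1}} \<omega> \<partial>\<Omega>)"
    proof (rule integral_dominated_convergence[where w = "\<lambda>_. 1"])
      show "AE \<omega> in \<Omega>. (\<lambda>n. indicat_real {\<omega>\<in>space \<Omega>. \<omega> n \<in> ?A n} \<omega>)
          \<longlonglongrightarrow> indicat_real {\<omega>\<in>space \<Omega>. X \<omega> \<in> {t..1}} \<omega>"
        using ae AE_space
      proof eventually_elim
        case (elim \<omega>)
        obtain x where x: "\<omega> \<longlonglongrightarrow> x" "x \<in> unit_cube"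
          "\<And>n l. \<omega> n $ l \<le> x $ l" "\<And>n l. x $ l \<le> \<omega> n $ l + 1 / 2 ^ n"
          using elim(1) by (metis path_limit order_refl)
        have Xx: "X \<omega> = x" using x(1,2) limI[OF x(1)] by (simp add: X_def)
        show ?case
        proof (cases "t \<le> x")
          case True
          have "\<omega> n \<in> ?A n" for n
          proof safe
            fix l
            have "t $ l \<le> x $ l" using True by (simp add: less_eq_vec_def)
            with x(4)[of l n] show "t $ l - 1 / 2 ^ n \<le> \<omega> n $ l" by simp
          qed
          then show ?thesis using elim(2) x(2) True by (simp add: Xx)
        next
          case False
          then obtain l where l: "x $ l < t $ l" by (auto simp: less_eq_vec_def not_le)
          have "(\<lambda>n. (1 / 2) ^ n) \<longlonglongrightarrow> (0 :: real)" by (rule LIMSEQ_power_zero) simp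
          then have "\<forall>\<^sub>F n in sequentially. (1 / 2) ^ n < t $ l - x $ l"
            by (rule order_tendstoD) (use l in simp)
          then have "\<forall>\<^sub>F n in sequentially. indicat_real {\<omega>\<in>space \<Omega>. \<omega> n \<in> ?A n} \<omega> = 0"
          proof eventually_elim
            case (elim n)
            with x(3)[of n l] have "\<omega> n $ l < t $ l - 1 / 2 ^ n" by (simp add: power_one_over)
            then have "\<omega> n \<notin> ?A n" by (auto simp: not_le)
            then show ?case by simp
          qed
          then have "(\<lambda>n. indicat_real {\<omega>\<in>space \<Omega>. \<omega> n \<in> ?A n} \<omega>) \<longlonglongrightarrow> 0"
            by (rule tendsto_eventually)
          then show ?thesis using False by (simp add: Xx)
        qed
      qed
    qed (use An B in \<open>auto simp: indicator_def intro!: AE_I2\<close>)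
    then have "(\<lambda>n. measure \<Omega> {\<omega>\<in>space \<Omega>. \<omega> n \<in> ?A n}) \<longlonglongrightarrow> measure \<Omega> {\<omega>\<in>space \<Omega>. X \<omega> \<in> {t..1}}"
      by (simp add: Int_def conj_commute cong: conj_cong)
    also have "measure \<Omega> {\<omega>\<in>space \<Omega>. X \<omega> \<in> {t..1}} = measure (distr \<Omega> cube_borel X) {t..1}"
      by (subst measure_distr[OF X box_sets_cube[OF t one_in_cube]]) (rule arg_cong[where f = "measure _"], auto)
    also have "(\<lambda>n. measure \<Omega> {\<omega>\<in>space \<Omega>. \<omega> n \<in> ?A n}) = (\<lambda>n. \<Sum>y\<in>dyadic_grid n \<inter> ?A n. P n y)"
      by (intro ext marginal A_sets)
    also have "(\<lambda>n. \<Sum>y\<in>dyadic_grid n \<inter> ?A n. P n y) =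
        (\<lambda>n. \<Sum>y\<in>{y\<in>dyadic_grid n. \<forall>l. t $ l - 1 / 2 ^ n \<le> y $ l}. P n y)"
      by (simp add: Int_def)
    finally show "(\<lambda>n. \<Sum>y\<in>{y\<in>dyadic_grid n. \<forall>l. t $ l - 1 / 2 ^ n \<le> y $ l}. P n y)
        \<longlonglongrightarrow> measure (distr \<Omega> cube_borel X) {t..1}" .
  qed simp
qed

definition limit_measure :: "(nat \<Rightarrow> real ^ 'd \<Rightarrow> real) \<Rightarrow> (real ^ 'd) measure \<Rightarrow> bool" where
  "limit_measure P \<mu> \<longleftrightarrow> finite_measure \<mu> \<and> sets \<mu> = sets cube_borel \<and>
     measure \<mu> unit_cube = (\<Sum>x\<in>dyadic_grid 0. P 0 x) \<and>
     (\<forall>t\<in>unit_cube. (\<lambda>n. \<Sum>y\<in>{y\<in>dyadic_grid n. \<forall>l. t $ l - 1 / 2 ^ n \<le> y $ l}. P n y) \<longlonglongrightarrow> measure \<mu> {t..1})"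

lemma limit_measureD:
  assumes "limit_measure P \<mu>"
  shows "finite_measure \<mu>" and "sets \<mu> = sets cube_borel"
    and "measure \<mu> unit_cube = (\<Sum>x\<in>dyadic_grid 0. P 0 x)"
    and "\<And>t. t \<in> unit_cube \<Longrightarrow>
      (\<lambda>n. \<Sum>y\<in>{y\<in>dyadic_grid n. \<forall>l. t $ l - 1 / 2 ^ n \<le> y $ l}. P n y) \<longlonglongrightarrow> measure \<mu> {t..1}"
  using assms unfolding limit_measure_def by blast+

lemma consistent_limit_measure:
  fixes P :: "nat \<Rightarrow> real ^ 'd \<Rightarrow> real"
  assumes P: "consistent P" and nonneg: "\<And>n x. x \<in> dyadic_grid n \<Longrightarrow> 0 \<le> P n x"
  shows "\<exists>\<mu>. limit_measure P \<mu>"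
proof -
  define c where "c = (\<Sum>x\<in>dyadic_grid 0. P 0 x)"
  have c0: "0 \<le> c" unfolding c_def by (intro sum_nonneg nonneg)
  show ?thesis
  proof (cases "c = 0")
    case True
    \<comment> \<open>Nonnegative weights of total 0 vanish on every level, so the null measure
      serves.\<close>
    have zero: "P n x = 0" if "x \<in> dyadic_grid n" for n x
    proof -
      have "(\<Sum>x\<in>dyadic_grid n. P n x) = 0" using consistent_total[OF P, of n] True by (simp only: c_def)
      then show ?thesis using sum_nonneg_eq_0_iff[of "dyadic_grid n" "P n"] nonneg that by simp
    qed
    show ?thesis
      unfolding limit_measure_def
    proof (intro exI[of _ "null_measure cube_borel"] conjI ballI)
      show "finite_measure (null_measure cube_borel :: (real ^ 'd) measure)" by (rule finite_measureI) simp
    qed (use True in \<open>simp_all add: zero c_def\<close>)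
  next
    case False
    with c0 have c: "0 < c" by simp
    have "consistent (\<lambda>n x. P n x / c)"
      using P by (simp add: consistent_def sum_divide_distrib[symmetric])
    moreover have "0 \<le> P n x / c" if "x \<in> dyadic_grid n" for n x using nonneg[OF that] c by simp
    moreover have "(\<Sum>x\<in>dyadic_grid 0. P 0 x / c) = 1"
      using c by (simp add: sum_divide_distrib[symmetric] c_def[symmetric])
    ultimately show ?thesis
    proof (rule consistent_prob)
      fix \<mu> :: "(real ^ 'd) measure"
      assume "prob_space \<mu>" and sets_\<mu>: "sets \<mu> = sets cube_borel"
        and lim: "\<And>t. t \<in> unit_cube \<Longrightarrow>
          (\<lambda>n. \<Sum>y\<in>{y\<in>dyadic_grid n. \<forall>l. t $ l - 1 / 2 ^ n \<le> y $ l}. P n y / c) \<longlonglongrightarrow> measure \<mu> {t..1}"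
      interpret prob_space \<mu> by fact
      have space_\<mu>: "space \<mu> = unit_cube"
        using sets_eq_imp_space_eq[OF sets_\<mu>] by (simp add: space_restrict_space)
      have scale: "measure (scale_measure (ennreal c) \<mu>) A = c * measure \<mu> A" for A
        using c by simp
      show ?thesis
        unfolding limit_measure_def
      proof (intro exI[of _ "scale_measure (ennreal c) \<mu>"] conjI ballI)
        show "finite_measure (scale_measure (ennreal c) \<mu>)"
          by (rule finite_measureI) (simp add: ennreal_mult_eq_top_iff)
        show "measure (scale_measure (ennreal c) \<mu>) unit_cube = (\<Sum>x\<in>dyadic_grid 0. P 0 x)"
          unfolding scale using prob_space by (simp add: space_\<mu> c_def)
        fix t :: "real ^ 'd" assume "t \<in> unit_cube"
        from tendsto_mult_left[OF lim[OF this], of c]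
        show "(\<lambda>n. \<Sum>y\<in>{y\<in>dyadic_grid n. \<forall>l. t $ l - 1 / 2 ^ n \<le> y $ l}. P n y)
            \<longlonglongrightarrow> measure (scale_measure (ennreal c) \<mu>) {t..1}"
          unfolding scale using c by (simp add: sum_distrib_left)
      qed (simp add: sets_\<mu>)
    qed
  qed
qed

subsection \<open>Existence of the signed measure\<close>

text \<open>
  The joint limit from the left exists by monotonicity of \<open>\<phi>\<close> and \<open>\<psi>\<close>; componentwise continuity
  identifies it with \<open>f t\<close> by passing to the limit in one coordinate after the other.
\<close>

lemma joint_left_limit:
  fixes f \<phi> \<psi> :: "real ^ 'd \<Rightarrow> real" and s :: "nat \<Rightarrow> real ^ 'd"
  assumes f: "left_continuous_componentwise f"
    and t: "t \<in> unit_cube" and s_cube: "\<And>n. s n \<in> unit_cube"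
    and s_mono: "\<And>n m. n \<le> m \<Longrightarrow> s n \<le> s m"
    and s_lim: "\<And>l. (\<forall>n. s n $ l = t $ l) \<or> (\<forall>n. s n $ l < t $ l) \<and> (\<lambda>n. s n $ l) \<longlonglongrightarrow> t $ l"
    and S: "\<And>x. (\<And>l. \<exists>k. x $ l = s k $ l) \<Longrightarrow> x \<in> S"
    and diff: "\<And>x. x \<in> S \<Longrightarrow> f x = \<phi> x - \<psi> x"
    and \<phi>: "\<And>x y. x \<in> S \<Longrightarrow> y \<in> S \<Longrightarrow> x \<le> y \<Longrightarrow> \<phi> y \<le> \<phi> x" "\<And>x. x \<in> S \<Longrightarrow> b \<le> \<phi> x"
    and \<psi>: "\<And>x y. x \<in> S \<Longrightarrow> y \<in> S \<Longrightarrow> x \<le> y \<Longrightarrow> \<psi> y \<le> \<psi> x" "\<And>x. x \<in> S \<Longrightarrow> b \<le> \<psi> x"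
  shows "(\<lambda>n. f (s n)) \<longlonglongrightarrow> f t"
proof -
  have sS: "s n \<in> S" for n by (rule S) blast
  have conv: "\<exists>L. (\<lambda>n. g (s n)) \<longlonglongrightarrow> L \<and> (\<forall>n. L \<le> g (s n))"
    if g: "\<And>x y. x \<in> S \<Longrightarrow> y \<in> S \<Longrightarrow> x \<le> y \<Longrightarrow> g y \<le> g x" "\<And>x. x \<in> S \<Longrightarrow> b \<le> g x" for g :: "real ^ 'd \<Rightarrow> real"
  proof -
    have dec: "decseq (\<lambda>n. g (s n))" using g(1) sS s_mono by (simp add: decseq_def)
    have "\<forall>n. b \<le> g (s n)" using g(2) sS by blast
    then show ?thesis by (rule decseq_convergent[OF dec]) blast
  qed
  obtain L1 where L1: "(\<lambda>n. \<phi> (s n)) \<longlonglongrightarrow> L1" "\<And>n. L1 \<le> \<phi> (s n)" using conv[of \<phi>, OF \<phi>] by blast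
  obtain L2 where L2: "(\<lambda>n. \<psi> (s n)) \<longlonglongrightarrow> L2" "\<And>n. L2 \<le> \<psi> (s n)" using conv[of \<psi>, OF \<psi>] by blast
  have lim: "(\<lambda>n. f (s n)) \<longlonglongrightarrow> L1 - L2"
    using tendsto_diff[OF L1(1) L2(1)] by (simp add: diff sS)
  have "\<bar>f t - (L1 - L2)\<bar> \<le> e" if "0 < e" for e
  proof -
    have "\<forall>\<^sub>F n in sequentially. \<phi> (s n) < L1 + e \<and> \<psi> (s n) < L2 + e"
      using order_tendstoD(2)[OF L1(1), of "L1 + e"] order_tendstoD(2)[OF L2(1), of "L2 + e"] \<open>0 < e\<close>
      by (simp add: eventually_conj)
    then obtain n0 where n0: "\<phi> (s n0) < L1 + e" "\<psi> (s n0) < L2 + e"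
      by (auto simp: eventually_sequentially)
    \<comment> \<open>The coordinates of x may stem from different late terms. Monotonicity squeezes
      \<phi> and \<psi> between their values at \<open>s n0\<close> and at a later
      \<open>s m\<close>.\<close>
    have base: "\<bar>f x - (L1 - L2)\<bar> \<le> e" if x: "\<And>l. \<exists>k\<ge>n0. x $ l = s k $ l" for x
    proof -
      obtain k where k: "\<And>l. k l \<ge> n0" "\<And>l. x $ l = s (k l) $ l" using x by metis
      define m where "m = Max (range k)"
      have km: "k l \<le> m" for l by (simp add: m_def)
      have xS: "x \<in> S" using k by (intro S) blast
      have "s n0 \<le> x" "x \<le> s m"
        using s_mono[OF k(1)] s_mono[OF km] by (auto simp: less_eq_vec_def k(2))
      then have "\<phi> x \<le> \<phi> (s n0)" "\<phi> (s m) \<le> \<phi> x" "\<psi> x \<le> \<psi> (s n0)" "\<psi> (s m) \<le> \<psi> x"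
        using \<phi>(1) \<psi>(1) sS xS by auto
      with L1(2)[of m] L2(2)[of m] n0 diff[OF xS] show ?thesis by linarith
    qed
    \<comment> \<open>K is the set of coordinates already moved to t; the bound survives each limit
      in a single coordinate.\<close>
    have "finite K \<Longrightarrow> (\<And>l. l \<in> K \<Longrightarrow> x $ l = t $ l) \<Longrightarrow> (\<And>l. l \<notin> K \<Longrightarrow> \<exists>k\<ge>n0. x $ l = s k $ l) \<Longrightarrow>
        \<bar>f x - (L1 - L2)\<bar> \<le> e" for K x
    proof (induction K arbitrary: x rule: finite_induct)
      case empty
      then show ?case by (intro base) auto
    next
      case (insert i K)
      define z where "z k = (\<chi> j. if j = i then s k $ i else x $ j)" for k
      have z: "\<bar>f (z k) - (L1 - L2)\<bar> \<le> e" if "k \<ge> n0" for k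
        using insert that by (intro insert.IH) (auto simp: z_def)
      have "(\<lambda>k. f (z k)) \<longlonglongrightarrow> f x"
      proof (cases "\<forall>n. s n $ i = t $ i")
        case True
        then have "z k = x" for k using insert.prems(1)[of i] by (auto simp: z_def vec_eq_iff)
        then show ?thesis by simp
      next
        case False
        then have si: "\<And>n. s n $ i < t $ i" "(\<lambda>n. s n $ i) \<longlonglongrightarrow> t $ i" using s_lim[of i] by auto
        have xi: "x $ i = t $ i" using insert.prems(1) by simp
        have cube: "0 \<le> s k $ l" "s k $ l \<le> 1" "0 \<le> t $ l" "t $ l \<le> 1" for k l
          using s_cube[of k] t by (auto simp: less_eq_vec_def)
        have "0 \<le> x $ l \<and> x $ l \<le> 1" for l
        proof (cases "l \<in> insert i K")
          case True
          with insert.prems(1) cube show ?thesis by simp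
        next
          case False
          with insert.prems(2) cube show ?thesis by metis
        qed
        then have "x \<in> unit_cube" by (auto simp: less_eq_vec_def)
        then have "((\<lambda>a. f (\<chi> j. if j = i then a else x $ j)) \<longlongrightarrow> f x) (at (x $ i) within {0..<x $ i})"
          using f by (simp add: left_continuous_componentwise_def)
        moreover have "filterlim (\<lambda>k. s k $ i) (at (x $ i) within {0..<x $ i}) sequentially"
          unfolding filterlim_at xi using si cube by (auto simp: less_imp_neq)
        ultimately show ?thesis unfolding z_def by (rule filterlim_compose)
      qed
      then have "(\<lambda>k. \<bar>f (z k) - (L1 - L2)\<bar>) \<longlonglongrightarrow> \<bar>f x - (L1 - L2)\<bar>"
        by (intro tendsto_intros)
      then show ?case by (rule LIMSEQ_le_const2) (use z in blast)
    qed
    from this[of UNIV t] show ?thesis by simp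
  qed
  then have "\<bar>f t - (L1 - L2)\<bar> \<le> 0" by (rule field_le_epsilon) simp
  with lim show ?thesis by simp
qed

text \<open>The largest dyadic of level \<open>n\<close> strictly below \<open>a\<close>, but \<open>0\<close> for \<open>a = 0\<close>.\<close>

definition dyadic_below :: "nat \<Rightarrow> real \<Rightarrow> real" where
  "dyadic_below n a = of_int (max 0 (\<lceil>2 ^ n * a\<rceil> - 1)) / 2 ^ n"

lemma dyadic_below_dyadic:
  assumes "a \<le> 1"
  shows "dyadic_below n a \<in> dyadics n"
proof -
  have "2 ^ n * a \<le> real_of_int (2 ^ n)" using assms by simp
  then have "\<lceil>2 ^ n * a\<rceil> \<le> 2 ^ n" unfolding ceiling_le_iff .
  then show ?thesis unfolding dyadic_below_def by (intro dyadics_int) auto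
qed

lemma dyadic_below_0: "dyadic_below n 0 = 0"
  by (simp add: dyadic_below_def)

lemma dyadic_below_less:
  assumes "0 < a"
  shows "dyadic_below n a < a"
proof -
  have "of_int \<lceil>2 ^ n * a\<rceil> - 1 < 2 ^ n * a" by linarith
  moreover have "0 < 2 ^ n * a" using assms by simp
  ultimately have "of_int (max 0 (\<lceil>2 ^ n * a\<rceil> - 1)) < 2 ^ n * a" by (simp add: max_def)
  then show ?thesis by (simp add: dyadic_below_def pos_divide_less_eq mult.commute)
qed

text \<open>Translates the relaxed threshold of the limit measure into the order of the grid. For a
  = 0 both sides hold because dyadics are nonnegative.\<close>

lemma dyadic_below_le_iff:
  assumes "z \<in> dyadics n"
  shows "dyadic_below n a \<le> z \<longleftrightarrow> a - 1 / 2 ^ n \<le> z"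
proof -
  obtain k where k: "z = real k / 2 ^ n" using assms by (auto elim: dyadicsE)
  have "dyadic_below n a \<le> z \<longleftrightarrow> of_int (max 0 (\<lceil>2 ^ n * a\<rceil> - 1)) \<le> real_of_int (int k)"
    by (simp only: k dyadic_below_def divide_le_cancel) simp
  also have "\<dots> \<longleftrightarrow> \<lceil>2 ^ n * a\<rceil> \<le> int k + 1" unfolding of_int_le_iff by auto
  also have "\<dots> \<longleftrightarrow> 2 ^ n * a \<le> real k + 1" unfolding ceiling_le_iff by simp
  also have "\<dots> \<longleftrightarrow> a \<le> (real k + 1) / 2 ^ n" by (simp add: pos_le_divide_eq mult.commute)
  also have "\<dots> \<longleftrightarrow> a - 1 / 2 ^ n \<le> z" by (simp add: k add_divide_distrib diff_le_eq)
  finally show ?thesis .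
qed

lemma le_dyadic_below:
  assumes "z \<in> dyadics n" "z < a"
  shows "z \<le> dyadic_below n a"
proof -
  obtain k where k: "z = real k / 2 ^ n" using assms by (auto elim: dyadicsE)
  have "real_of_int (int k) < 2 ^ n * a" using assms(2) by (simp add: k field_simps)
  then have "int k < \<lceil>2 ^ n * a\<rceil>" unfolding less_ceiling_iff .
  then have "real_of_int (int k) \<le> of_int (max 0 (\<lceil>2 ^ n * a\<rceil> - 1))" unfolding of_int_le_iff by simp
  then show ?thesis by (simp only: k dyadic_below_def divide_le_cancel) simp
qed

lemma dyadic_below_mono:
  assumes "0 \<le> a" "a \<le> 1" "n \<le> m"
  shows "dyadic_below n a \<le> dyadic_below m a"
proof (cases "a = 0")
  case False
  then show ?thesis
    using assms dyadics_mono[OF assms(3)]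
    by (intro le_dyadic_below dyadic_below_less) (auto intro: dyadic_below_dyadic[THEN subsetD[rotated]])
qed (simp add: dyadic_below_0)

lemma dyadic_below_tendsto:
  assumes "0 < a" "a \<le> 1"
  shows "(\<lambda>n. dyadic_below n a) \<longlonglongrightarrow> a"
proof (rule tendsto_sandwich)
  show "\<forall>\<^sub>F n in sequentially. a - (1 / 2) ^ n \<le> dyadic_below n a"
    using dyadic_below_le_iff[OF dyadic_below_dyadic[OF assms(2)], of _ a] by (simp add: power_one_over)
  show "\<forall>\<^sub>F n in sequentially. dyadic_below n a \<le> a"
    using dyadic_below_less[OF assms(1)] by (simp add: less_imp_le)
  have "(\<lambda>n. a - (1 / 2) ^ n) \<longlonglongrightarrow> a - 0"
    by (intro tendsto_intros LIMSEQ_power_zero) simp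
  then show "(\<lambda>n. a - (1 / 2) ^ n) \<longlonglongrightarrow> a" by simp
qed simp

text \<open>The least level is merely a choice: by \<open>consistent_sum_ge\<close>, every level
  containing x gives the same sum. A function of x alone is what expresses f on all dyadic points as
  a difference of decreasing functions.\<close>

definition upper_mass :: "(nat \<Rightarrow> real ^ 'd \<Rightarrow> real) \<Rightarrow> real ^ 'd \<Rightarrow> real" where
  "upper_mass P x = (let n = LEAST n. x \<in> dyadic_grid n in \<Sum>y\<in>{y\<in>dyadic_grid n. x \<le> y}. P n y)"

lemma upper_mass_eq:
  assumes "consistent P" "x \<in> dyadic_grid n"
  shows "upper_mass P x = (\<Sum>y\<in>{y\<in>dyadic_grid n. x \<le> y}. P n y)"
  unfolding upper_mass_def Let_def
  by (rule consistent_sum_ge[symmetric])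
    (use assms in \<open>auto intro: Least_le LeastI\<close>)

lemma upper_mass_nonneg:
  assumes "consistent P" "\<And>n x. x \<in> dyadic_grid n \<Longrightarrow> 0 \<le> P n x" "x \<in> (\<Union>n. dyadic_grid n)"
  shows "0 \<le> upper_mass P x"
  using assms by (auto simp: upper_mass_eq intro!: sum_nonneg)

lemma upper_mass_antimono:
  assumes P: "consistent P" "\<And>n x. x \<in> dyadic_grid n \<Longrightarrow> 0 \<le> P n x"
    and "x \<in> (\<Union>n. dyadic_grid n)" "y \<in> (\<Union>n. dyadic_grid n)" "x \<le> y"
  shows "upper_mass P y \<le> upper_mass P x"
proof -
  obtain i j where "x \<in> dyadic_grid i" "y \<in> dyadic_grid j" using assms by blast
  then have "x \<in> dyadic_grid (max i j)" "y \<in> dyadic_grid (max i j)"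
    using dyadic_grid_mono[of i "max i j"] dyadic_grid_mono[of j "max i j"] by auto
  then show ?thesis
    using P \<open>x \<le> y\<close> by (simp only: upper_mass_eq) (intro sum_mono2; auto)
qed

section \<open>Signed measures as differences of finite measures\<close>

lemma total_variation_le:
  assumes "finite_measure U" "finite_measure L" "sets U = sets M" "sets L = sets M"
  shows "total_variation M (\<lambda>A. measure U A - measure L A) E \<le> ereal (measure U E + measure L E)"
  unfolding total_variation_def
proof (rule SUP_least, clarify)
  fix Q assume Q: "finite Q" "Q \<subseteq> sets M" "disjoint Q"
  have *: "(\<Sum>A\<in>Q. measure W A) = measure W (\<Union>Q)" if "finite_measure W" "sets W = sets M" for W
  proof -
    have "measure W (\<Union>A\<in>Q. A) = (\<Sum>A\<in>Q. measure W A)"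
      using Q that
      by (intro finite_measure.finite_measure_finite_Union) (auto simp: disjoint_family_on_def disjoint_def)
    then show ?thesis by simp
  qed
  have "(\<Sum>A\<in>Q. \<bar>measure U A - measure L A\<bar>) \<le> (\<Sum>A\<in>Q. measure U A + measure L A)"
  proof (rule sum_mono)
    fix A show "\<bar>measure U A - measure L A\<bar> \<le> measure U A + measure L A"
      using measure_nonneg[of U A] measure_nonneg[of L A] by linarith
  qed
  also have "\<dots> = measure U (\<Union>Q) + measure L (\<Union>Q)"
    using assms by (simp add: sum.distrib *)
  finally show "ereal (\<Sum>A\<in>Q. \<bar>measure U A - measure L A\<bar>) \<le> ereal (measure U (\<Union>Q) + measure L (\<Union>Q))"
    by simp
qed

lemma signed_measure_diff:
  assumes "finite_measure U" "finite_measure L" "sets U = sets M" "sets L = sets M"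
  shows "signed_measure M (\<lambda>A. measure U A - measure L A)"
  unfolding signed_measure_def using assms
  by (auto intro!: sums_diff finite_measure.finite_measure_UNION)

lemma corresponding_signed_measure_exists:
  fixes f :: "real ^ 'd \<Rightarrow> real"
  assumes left: "left_continuous_componentwise f" and V: "hk_variation f = ereal V"
  shows "\<exists>\<nu>. corresponding_signed_measure f \<nu>"
proof -
  have "\<forall>n. \<exists>w. (\<forall>x\<in>dyadic_grid n. f x = f 1 + (\<Sum>y\<in>{y\<in>dyadic_grid n. x \<le> y}. w y)) \<and>
      (\<Sum>y\<in>dyadic_grid n. \<bar>w y\<bar>) \<le> V"
  proof
    fix n
    show "\<exists>w. (\<forall>x\<in>dyadic_grid n. f x = f 1 + (\<Sum>y\<in>{y\<in>dyadic_grid n. x \<le> y}. w y)) \<and>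
      (\<Sum>y\<in>dyadic_grid n. \<bar>w y\<bar>) \<le> V"
    proof (rule grid_moebius[where f = f and G = "\<lambda>_. dyadics n"])
      fix w assume "\<And>x. x \<in> grid (\<lambda>_. dyadics n) \<Longrightarrow> f x = f 1 + (\<Sum>y\<in>{y\<in>grid (\<lambda>_. dyadics n). x \<le> y}. w y)"
        "ereal (\<Sum>y\<in>grid (\<lambda>_. dyadics n). \<bar>w y\<bar>) \<le> hk_variation f"
      then show ?thesis unfolding dyadic_grid_def V by (intro exI[of _ w]) simp
    qed (rule dyadics_props)+
  qed
  from choice[OF this] obtain w where
    W: "\<forall>n. (\<forall>x\<in>dyadic_grid n. f x = f 1 + (\<Sum>y\<in>{y\<in>dyadic_grid n. x \<le> y}. w n y)) \<and>
      (\<Sum>y\<in>dyadic_grid n. \<bar>w n y\<bar>) \<le> V" ..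
  have w: "f x = f 1 + (\<Sum>y\<in>{y\<in>dyadic_grid n. x \<le> y}. w n y)" if "x \<in> dyadic_grid n" for n x
    using W[THEN spec[of _ n], THEN conjunct1] that by (rule bspec)
  have w_V: "(\<Sum>y\<in>dyadic_grid n. \<bar>w n y\<bar>) \<le> V" for n
    using W[THEN spec[of _ n]] by (rule conjunct2)
  have "consistent w" by (rule moebius_consistent[where f = f]) (rule w)
  from this w_V show ?thesis
  proof (rule consistent_jordan[where w = w and V = V])
    fix P N :: "nat \<Rightarrow> real ^ 'd \<Rightarrow> real"
    assume P: "consistent P" "\<And>n x. x \<in> dyadic_grid n \<Longrightarrow> 0 \<le> P n x"
      and N: "consistent N" "\<And>n x. x \<in> dyadic_grid n \<Longrightarrow> 0 \<le> N n x"
      and w_diff: "\<And>n x. w n x = P n x - N n x"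
      and total: "(\<Sum>x\<in>dyadic_grid 0. P 0 x) + (\<Sum>x\<in>dyadic_grid 0. N 0 x) \<le> V"
    obtain U L where "limit_measure P U" "limit_measure N L"
      using consistent_limit_measure[OF P] consistent_limit_measure[OF N] by blast
    note U = limit_measureD[OF this(1)] and L = limit_measureD[OF this(2)]
    define \<nu> where "\<nu> A = measure U A - measure L A" for A
    have f_\<nu>: "f t = \<nu> {t..1} + f 1" if t: "t \<in> unit_cube" for t
    proof -
      have t01: "0 \<le> t $ l" "t $ l \<le> 1" for l using t by (auto simp: less_eq_vec_def)
      define s where "s n = (\<chi> l. dyadic_below n (t $ l))" for n
      have s_grid: "s n \<in> dyadic_grid n" for n
        using dyadic_below_dyadic[OF t01(2)] by (simp add: s_def dyadic_grid_def grid_def)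
      let ?S = "\<Union>n. dyadic_grid n :: (real ^ 'd) set"
      \<comment> \<open>On dyadic points f is f 1 plus the upper mass of P minus that of N, both
        decreasing; mixing coordinates of several \<open>s k\<close> stays within the dyadic
        points.\<close>
      have f_lim: "(\<lambda>n. f (s n)) \<longlonglongrightarrow> f t"
      proof (rule joint_left_limit[OF left t, where S = ?S and \<phi> = "\<lambda>x. f 1 + upper_mass P x"
            and \<psi> = "upper_mass N" and b = "min 0 (f 1)"])
        show "s n \<in> unit_cube" for n using s_grid dyadic_grid_cube by blast
        show "s n \<le> s m" if "n \<le> m" for n m
          using dyadic_below_mono[OF t01 that] by (simp add: s_def less_eq_vec_def)
        show "(\<forall>n. s n $ l = t $ l) \<or> (\<forall>n. s n $ l < t $ l) \<and> (\<lambda>n. s n $ l) \<longlonglongrightarrow> t $ l" for l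
        proof (cases "t $ l = 0")
          case False
          then have "0 < t $ l" using t01(1)[of l] by simp
          then show ?thesis using dyadic_below_less dyadic_below_tendsto t01(2) by (simp add: s_def)
        qed (simp add: s_def dyadic_below_0)
        show "x \<in> ?S" if x: "\<And>l. \<exists>k. x $ l = s k $ l" for x
        proof -
          obtain k where k: "\<And>l. x $ l = s (k l) $ l" using x by metis
          have "x $ l \<in> dyadics (Max (range k))" for l
          proof -
            have "k l \<le> Max (range k)" by simp
            moreover have "x $ l \<in> dyadics (k l)" using s_grid[of "k l"] by (simp add: k dyadic_grid_def grid_def)
            ultimately show ?thesis using dyadics_mono by blast
          qed
          then show ?thesis by (auto simp: dyadic_grid_def grid_def)
        qed
        show "f x = f 1 + upper_mass P x - upper_mass N x" if x: "x \<in> ?S" for x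
        proof -
          obtain n where n: "x \<in> dyadic_grid n" using x by blast
          show ?thesis
            unfolding w[OF n] upper_mass_eq[OF P(1) n] upper_mass_eq[OF N(1) n]
            by (simp add: w_diff sum_subtractf)
        qed
        show "f 1 + upper_mass P y \<le> f 1 + upper_mass P x" if "x \<in> ?S" "y \<in> ?S" "x \<le> y" for x y
          using upper_mass_antimono[OF P that] by simp
        show "min 0 (f 1) \<le> f 1 + upper_mass P x" if "x \<in> ?S" for x
          using upper_mass_nonneg[OF P that] by simp
        show "upper_mass N y \<le> upper_mass N x" if "x \<in> ?S" "y \<in> ?S" "x \<le> y" for x y
          using upper_mass_antimono[OF N that] .
        show "min 0 (f 1) \<le> upper_mass N x" if "x \<in> ?S" for x
          using upper_mass_nonneg[OF N that] by simp
      qed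
      \<comment> \<open>The grid points beyond the relaxed threshold are those above
        \<open>s n\<close>, so the difference of the two sums is a value of f minus f 1. This joins
        the limit measures to the left limit of f.\<close>
      have "(\<Sum>y\<in>{y\<in>dyadic_grid n. \<forall>l. t $ l - 1 / 2 ^ n \<le> y $ l}. P n y) -
          (\<Sum>y\<in>{y\<in>dyadic_grid n. \<forall>l. t $ l - 1 / 2 ^ n \<le> y $ l}. N n y) = f (s n) - f 1" for n
      proof -
        have "(\<forall>l. t $ l - 1 / 2 ^ n \<le> y $ l) \<longleftrightarrow> s n \<le> y" if "y \<in> dyadic_grid n" for y
          using that dyadic_below_le_iff by (simp add: s_def less_eq_vec_def dyadic_grid_def grid_def)
        then have "{y\<in>dyadic_grid n. \<forall>l. t $ l - 1 / 2 ^ n \<le> y $ l} = {y\<in>dyadic_grid n. s n \<le> y}"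
          by blast
        then show ?thesis
          using w[OF s_grid[of n]] by (simp add: w_diff sum_subtractf)
      qed
      then have "(\<lambda>n. f (s n) - f 1) \<longlonglongrightarrow> \<nu> {t..1}"
        using tendsto_diff[OF U(4)[OF t] L(4)[OF t]] by (simp add: \<nu>_def)
      moreover have "(\<lambda>n. f (s n) - f 1) \<longlonglongrightarrow> f t - f 1"
        using f_lim by (intro tendsto_intros)
      ultimately have "f t - f 1 = \<nu> {t..1}" by (metis LIMSEQ_unique)
      then show ?thesis by simp
    qed
    have signed: "signed_measure cube_borel \<nu>"
      unfolding \<nu>_def using U(1) L(1) U(2) L(2) by (rule signed_measure_diff)
    have le: "total_variation cube_borel \<nu> unit_cube \<le> ereal V"
    proof -
      have "total_variation cube_borel \<nu> unit_cube \<le> ereal (measure U unit_cube + measure L unit_cube)"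
        unfolding \<nu>_def using U(1) L(1) U(2) L(2) by (rule total_variation_le)
      also have "\<dots> \<le> ereal V" using total U(3) L(3) by simp
      finally show ?thesis .
    qed
    have "bounded_signed_measure cube_borel \<nu> V"
    proof
      fix A :: "(real ^ 'd) set" assume "A \<in> sets cube_borel"
      from abs_le_total_variation[OF this, of \<nu>] signed
      have "ereal (\<bar>\<nu> A\<bar> + \<bar>\<nu> (unit_cube - A)\<bar>) \<le> total_variation cube_borel \<nu> unit_cube"
        by (simp add: signed_measure_def space_restrict_space)
      from order_trans[OF this le] show "\<bar>\<nu> A\<bar> \<le> V" by simp
    qed (rule signed)
    then have "hk_variation f \<le> total_variation cube_borel \<nu> unit_cube"
      using f_\<nu> by (rule hk_variation_le_total_variation)
    with le V have "total_variation cube_borel \<nu> unit_cube = hk_variation f" by simp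
    with signed f_\<nu> show ?thesis unfolding corresponding_signed_measure_def by blast
  qed
qed

section \<open>Transfer of the loss to the cube\<close>

lemma representation_expected:
  fixes T :: "'z \<Rightarrow> real ^ 'd"
  assumes "prob_space M" and rep: "(T, f) \<in> representations M g" and zs: "set zs \<subseteq> space M"
  shows "prob_space (distr M cube_borel T)"
    and "expected M g = ereal (\<integral>x. f x \<partial>distr M cube_borel T)"
    and "empirical_mean zs g = empirical_mean zs (\<lambda>z. f (T z))"
    and "\<And>z. z \<in> set zs \<Longrightarrow> T z \<in> unit_cube"
proof -
  interpret prob_space M by fact
  have T: "T \<in> M \<rightarrow>\<^sub>M cube_borel" and f: "f \<in> borel_measurable cube_borel" and fin: "hk_variation f < \<infinity>"
    and g: "\<And>z. z \<in> space M \<Longrightarrow> g z = f (T z)"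
    using rep by (auto simp: representations_def)
  obtain V where V: "hk_variation f = ereal V" using hk_variation_real[OF fin] by blast
  show prob: "prob_space (distr M cube_borel T)" by (rule prob_space_distr[OF T])
  have T_cube: "T z \<in> unit_cube" if "z \<in> space M" for z
    using measurable_space[OF T that] by (simp add: space_restrict_space)
  then show "\<And>z. z \<in> set zs \<Longrightarrow> T z \<in> unit_cube" using zs by blast
  \<comment> \<open>Finite variation bounds f, so the extended expectation is an ordinary integral;
    g inherits integrability because it agrees with f after T on the space.\<close>
  have "integrable M (\<lambda>z. f (T z))"
    by (rule integrable_const_bound[of _ "V + \<bar>f 1\<bar>"])
      (use hk_variation_bdd(2)[OF V T_cube] measurable_compose[OF T f] in auto)
  moreover have "integrable M g \<longleftrightarrow> integrable M (\<lambda>z. f (T z))" "integral\<^sup>L M g = (\<integral>z. f (T z) \<partial>M)"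
    by (rule Bochner_Integration.integrable_cong Bochner_Integration.integral_cong; simp add: g)+
  ultimately show "expected M g = ereal (\<integral>x. f x \<partial>distr M cube_borel T)"
    by (simp add: expected_eq_integral integral_distr[OF T f])
  show "empirical_mean zs g = empirical_mean zs (\<lambda>z. f (T z))"
    using zs g by (intro empirical_mean_cong) auto
qed

theorem theorem1:
  fixes M :: "'z measure"
    and loss :: "'z list \<Rightarrow> 'z \<Rightarrow> real"
    and S zs :: "'z list"
    and m m' :: nat
  assumes "prob_space M"
    and "length S = m" and "set S \<subseteq> space M"
    and "length zs = m'" and "m' \<ge> 1" and "set zs \<subseteq> space M"
    and "integral_meaningful M (loss S)"
  shows "expected M (loss S) \<le>
           ereal (empirical_mean zs (loss S)) +
           (INF (T, f)\<in>(representations M (loss S) ::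
                          (('z \<Rightarrow> real ^ 'd) \<times> (real ^ 'd \<Rightarrow> real)) set).
              hk_variation f * star_discrepancy (distr M cube_borel T) (map T zs))
         \<and>
         (\<forall>(T, f)\<in>(representations M (loss S) ::
                      (('z \<Rightarrow> real ^ 'd) \<times> (real ^ 'd \<Rightarrow> real)) set).
            left_continuous_componentwise f \<longrightarrow>
              (\<exists>\<nu>. corresponding_signed_measure f \<nu>) \<and>
              (\<forall>\<nu>. corresponding_signed_measure f \<nu> \<longrightarrow>
                 expected M (loss S) =
                   ereal (empirical_mean zs (loss S) +
                     signed_integral cube_borel \<nu>
                       (\<lambda>t. measure (distr M cube_borel T) {0..t}
                            - 1 / real m' * (\<Sum>z\<leftarrow>zs. indicat_real {0..t} (T z))))))"
proof (rule conjI)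
  let ?R = "representations M (loss S) :: (('z \<Rightarrow> real ^ 'd) \<times> (real ^ 'd \<Rightarrow> real)) set"
  let ?b = "\<lambda>(T, f). hk_variation f * star_discrepancy (distr M cube_borel T) (map T zs)"
  let ?e = "empirical_mean zs (loss S)"
  have zs: "zs \<noteq> []" using assms by auto
  have rep: "f \<in> borel_measurable cube_borel" "hk_variation f < \<infinity>" if "(T, f) \<in> ?R" for T f
    using that by (auto simp: representations_def)
  have bound: "expected M (loss S) \<le> ereal ?e + ?b (T, f)" if R: "(T, f) \<in> ?R" for T f
  proof -
    note E = representation_expected[OF assms(1) R assms(6)]
    obtain V where V: "hk_variation f = ereal V" using hk_variation_real[OF rep(2)[OF R]] by blast
    obtain D where D: "star_discrepancy (distr M cube_borel T) (map T zs) = ereal D"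
      "\<And>t. t \<in> unit_cube \<Longrightarrow> \<bar>empirical_mean (map T zs) (indicat_real {0..t}) -
        measure (distr M cube_borel T) {0..t}\<bar> \<le> D"
      using star_discrepancy_real[OF E(1)] by metis
    have "(\<integral>x. f x \<partial>distr M cube_borel T) \<le> empirical_mean (map T zs) f + V * D"
      by (rule koksma_hlawka_le[OF E(1) _ rep(1)[OF R] V]) (use zs E(4) D(2) in auto)
    moreover have "empirical_mean (map T zs) f = ?e"
      unfolding E(3) by (simp add: empirical_mean_def comp_def)
    ultimately show ?thesis by (simp add: E(2) V D(1))
  qed
  show "expected M (loss S) \<le> ereal ?e + (INF x\<in>?R. ?b x)"
  \<comment> \<open>Without a representation the infimum is infinite. Otherwise the expectation is
    finite, and subtracting the real empirical mean reduces the claim to a lower bound for the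
    infimum itself.\<close>
  proof (cases "?R = {}")
    case False
    then obtain T f where "(T, f) \<in> ?R" by auto
    from representation_expected(2)[OF assms(1) this assms(6)]
    obtain E where E: "expected M (loss S) = ereal E" by blast
    have unshift: "ereal E \<le> ereal ?e + y" if "ereal (E - ?e) \<le> y" for y
      using that by (cases y) auto
    have "ereal (E - ?e) \<le> (INF x\<in>?R. ?b x)"
    proof (rule INF_greatest)
      have shift: "ereal (E - ?e) \<le> y" if "ereal E \<le> ereal ?e + y" for y
        using that by (cases y) auto
      fix x assume "x \<in> ?R"
      then show "ereal (E - ?e) \<le> ?b x"
        using bound[of "fst x" "snd x"] unfolding E prod.collapse by (intro shift)
    qed
    then show ?thesis unfolding E by (rule unshift)
  qed (simp add: top_ereal_def)
next
  have zs: "zs \<noteq> []" using assms by auto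
  show "\<forall>(T, f)\<in>(representations M (loss S) ::
                      (('z \<Rightarrow> real ^ 'd) \<times> (real ^ 'd \<Rightarrow> real)) set).
            left_continuous_componentwise f \<longrightarrow>
              (\<exists>\<nu>. corresponding_signed_measure f \<nu>) \<and>
              (\<forall>\<nu>. corresponding_signed_measure f \<nu> \<longrightarrow>
                 expected M (loss S) =
                   ereal (empirical_mean zs (loss S) +
                     signed_integral cube_borel \<nu>
                       (\<lambda>t. measure (distr M cube_borel T) {0..t}
                            - 1 / real m' * (\<Sum>z\<leftarrow>zs. indicat_real {0..t} (T z)))))"
  proof (safe del: notI)
    fix T :: "'z \<Rightarrow> real ^ 'd" and f
    assume R: "(T, f) \<in> representations M (loss S)" and left: "left_continuous_componentwise f"
    note E = representation_expected[OF assms(1) R assms(6)]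
    have f: "f \<in> borel_measurable cube_borel" and fin: "hk_variation f < \<infinity>"
      using R by (auto simp: representations_def)
    obtain V where V: "hk_variation f = ereal V" using hk_variation_real[OF fin] by blast
    show "\<exists>\<nu>. corresponding_signed_measure f \<nu>"
      by (rule corresponding_signed_measure_exists[OF left V])
    fix \<nu> assume \<nu>: "corresponding_signed_measure f \<nu>"
    show "expected M (loss S) =
        ereal (empirical_mean zs (loss S) + signed_integral cube_borel \<nu>
          (\<lambda>t. measure (distr M cube_borel T) {0..t} - 1 / real m' * (\<Sum>z\<leftarrow>zs. indicat_real {0..t} (T z))))"
      unfolding E(2,3) using hlawka_identity[OF E(1) _ f V \<nu> zs E(4)] assms(4) by simp
  qed
qed

end
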